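(* Let $\pi:(M_r^3,g)\to(B_s^2,g')$ be a pseudo-Riemannian submersion with an adapted frame $\{e_1,e_2,e_3\}$ and integrability functions $l_1,l_2,\lambda,\mu,\sigma$, and let $\delta_i=g(e_i,e_i)=\pm1$. Then $\pi$ is biharmonic if and only if $$\begin{aligned}\Delta^M\lambda={}&-\delta_2 l_1e_1(\mu)-\delta_2e_1(\mu l_1)-\delta_2l_2e_2(\mu)-\delta_2e_2(\mu l_2)+\delta_2\lambda\mu l_1+\delta_2\mu^2l_2\\&+\lambda\{\delta_2l_1^2+\delta_1l_2^2-\delta_1\delta_2K^B\},\\ \Delta^M\mu={}&\delta_1l_1e_1(\lambda)+\delta_1e_1(\lambda l_1)+\delta_1l_2e_2(\lambda)+\delta_1e_2(\lambda l_2)-\delta_1\lambda\mu l_2-\delta_1\lambda^2l_1\\&+\mu\{\delta_2l_1^2+\delta_1l_2^2-\delta_1\delta_2K^B\},\end{aligned}$$ where $K^B=R^B_{1221}\circ\pi=\delta_2e_1(l_2)-\delta_1e_2(l_1)-\delta_1l_1^2-\delta_2l_2^2$ is the Gauss curvature of $(B_s^2,g')$.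
   Context: Pseudo-Riemannian submersion: a smooth surjective map $\pi:(M,g)\to(B,g')$ between connected pseudo-Riemannian manifolds such that $\pi_*|_p$ is onto for every $p\in M$, the restriction of $g$ to each fibre is nondegenerate, and $\pi_*$ preserves scalar products of vectors normal to the fibres; fibres are assumed connected. Here $M_r^3$ is $3$-dimensional of index $r$ ($0\le r\le3$) and $B_s^2$ is $2$-dimensional of index $s$ ($0\le s\le 2$, $s\le r$). Vectors tangent to fibres are vertical, those normal to fibres are horizontal; a vector field on $M$ is basic if it is the horizontal lift of a vector field on $B$. Adapted frame and integrability functions: an adapted frame is a (local) orthonormal frame $\{e_1,e_2,e_3\}$ of $M$, $g(e_i,e_j)=0$ for $i\ne j$, $g(e_i,e_i)=\delta_i=\pm1$, with $e_3$ vertical and $e_1,e_2$ basic, $\pi$-related to an orthonormal frame $\{\varepsilon_1,\varepsilon_2\}$ of $B$. Writing $[\varepsilon_1,\varepsilon_2]=L_1\varepsilon_1+L_2\varepsilon_2$ and $l_i=L_i\circ\pi$, one has $$[e_1,e_3]=\lambda e_3,\quad[e_2,e_3]=\mu e_3,\quad[e_1,e_2]=l_1e_1+l_2e_2-2\sigma e_3,$$ and the smooth functions $l_1,l_2,\lambda,\mu,\sigma$ are the integrability functions of the adapted frame. If the frame is only local, $M$ is understood to be replaced by its domain. Conventions: $\Delta^M f=\sum_i g(e_i,e_i)\,g(\nabla_{e_i}\mathrm{grad} f,e_i)$; $R(X,Y)=\nabla_X\nabla_Y-\nabla_Y\nabla_X-\nabla_{[X,Y]}$; $R^B_{1221}=g'(R^B(\varepsilon_1,\varepsilon_2)\varepsilon_2,\varepsilon_1)$.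 Biharmonic: for a smooth map $\varphi:M\to B$ with pulled-back connection $\nabla^\varphi$ on $\varphi^*TB$, put $\tau(\varphi)=\sum_i g(e_i,e_i)(\nabla^\varphi_{e_i}d\varphi(e_i)-d\varphi(\nabla_{e_i}e_i))$ and $\tau_2(\varphi)=\sum_i g(e_i,e_i)\big((\nabla^\varphi_{e_i}\nabla^\varphi_{e_i}-\nabla^\varphi_{\nabla_{e_i}e_i})\tau(\varphi)-R^B(d\varphi(e_i),\tau(\varphi))d\varphi(e_i)\big)$; $\varphi$ is biharmonic if $\tau_2(\varphi)=0$. *)

theory Defs
  imports "HOL-Analysis.Analysis"
begin

section \<open>Smooth functions and smooth manifolds\<close>

text \<open>Only meaningful for open \<open>S\<close>.\<close>

fun Ck_on :: "nat \<Rightarrow> 'a::euclidean_space set \<Rightarrow> ('a \<Rightarrow> 'b::real_normed_vector) \<Rightarrow> bool" where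
  "Ck_on 0 S f \<longleftrightarrow> continuous_on S f"
| "Ck_on (Suc k) S f \<longleftrightarrow>
     f differentiable_on S \<and> (\<forall>b\<in>Basis. Ck_on k S (\<lambda>x. frechet_derivative f (at x) b))"

definition smooth_on :: "'a::euclidean_space set \<Rightarrow> ('a \<Rightarrow> 'b::real_normed_vector) \<Rightarrow> bool" where
  "smooth_on S f \<longleftrightarrow> (\<forall>k. Ck_on k S f)"

text \<open>An atlas is a set of charts \<open>(U, x)\<close>. The manifold is the union of the chart domains, an open
  subset of the ambient type, which carries the topology; for an atlas modelled on the Euclidean
  space \<open>'e\<close> the dimension is \<open>DIM('e)\<close>. The atlas need not be maximal.\<close>

type_synonym ('m, 'e) atlas = "('m set \<times> ('m \<Rightarrow> 'e)) set"

definition carrier :: "('m, 'e) atlas \<Rightarrow> 'm set" where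
  "carrier M = (\<Union>(U, x)\<in>M. U)"

definition smooth_manifold ::
  "('m::{t2_space,second_countable_topology}, 'e::euclidean_space) atlas \<Rightarrow> bool" where
  "smooth_manifold M \<longleftrightarrow>
     (\<forall>(U, x)\<in>M. open U \<and> open (x ` U) \<and> inj_on x U \<and> homeomorphism U (x ` U) x (inv_into U x)) \<and>
     (\<forall>(U, x)\<in>M. \<forall>(V, y)\<in>M. smooth_on (x ` (U \<inter> V)) (y \<circ> inv_into U x))"

definition smooth_fun ::
  "('m::topological_space, 'e::euclidean_space) atlas \<Rightarrow> 'm set \<Rightarrow> ('m \<Rightarrow> real) \<Rightarrow> bool" where
  "smooth_fun M W f \<longleftrightarrow> (\<forall>(U, x)\<in>M. smooth_on (x ` (U \<inter> W)) (f \<circ> inv_into U x))"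

definition smooth_map ::
  "('m::topological_space, 'e::euclidean_space) atlas \<Rightarrow>
   ('b::topological_space, 'k::euclidean_space) atlas \<Rightarrow> ('m \<Rightarrow> 'b) \<Rightarrow> bool" where
  "smooth_map M B \<phi> \<longleftrightarrow>
     \<phi> ` carrier M \<subseteq> carrier B \<and> continuous_on (carrier M) \<phi> \<and>
     (\<forall>(U, x)\<in>M. \<forall>(V, y)\<in>B. smooth_on (x ` (U \<inter> \<phi> -` V)) (y \<circ> \<phi> \<circ> inv_into U x))"


section \<open>Tangent vectors and vector fields\<close>

definition smooth_at ::
  "('m::topological_space, 'e::euclidean_space) atlas \<Rightarrow> 'm \<Rightarrow> ('m \<Rightarrow> real) \<Rightarrow> bool" where
  "smooth_at M p f \<longleftrightarrow> (\<exists>W. open W \<and> p \<in> W \<and> W \<subseteq> carrier M \<and> smooth_fun M W f)"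

text \<open>Tangent vectors at \<open>p\<close> are derivations of the germs at \<open>p\<close> of smooth functions. A germ is
  represented by any function on the ambient type that is smooth near \<open>p\<close>; derivations are
  normalised to be \<open>0\<close> on all other functions, so that equality of tangent vectors is equality
  of functionals. As only germs are involved, the tangent spaces of an open submanifold are
  literally those of the whole manifold.\<close>

type_synonym 'm tvec = "('m \<Rightarrow> real) \<Rightarrow> real"

definition tangent_space ::
  "('m::topological_space, 'e::euclidean_space) atlas \<Rightarrow> 'm \<Rightarrow> 'm tvec set" where
  "tangent_space M p = {v.
     (\<forall>f. \<not> smooth_at M p f \<longrightarrow> v f = 0) \<and>
     (\<forall>f g. smooth_at M p f \<longrightarrow> smooth_at M p g \<longrightarrow>
        v (\<lambda>x. f x + g x) = v f + v g \<and>
        v (\<lambda>x. f x * g x) = f p * v g + g p * v f) \<and>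
     (\<forall>f c. smooth_at M p f \<longrightarrow> v (\<lambda>x. c * f x) = c * v f) \<and>
     (\<forall>f g. smooth_at M p f \<longrightarrow> (\<forall>\<^sub>F x in nhds p. f x = g x) \<longrightarrow> v f = v g)}"

text \<open>Values of vector fields outside of the open set \<open>U\<close> under consideration are irrelevant.\<close>

definition vfield ::
  "('m::topological_space, 'e::euclidean_space) atlas \<Rightarrow> 'm set \<Rightarrow> ('m \<Rightarrow> 'm tvec) \<Rightarrow> bool" where
  "vfield M U X \<longleftrightarrow>
     (\<forall>p\<in>U. X p \<in> tangent_space M p) \<and>
     (\<forall>W f. open W \<and> W \<subseteq> U \<and> smooth_fun M W f \<longrightarrow> smooth_fun M W (\<lambda>p. X p f))"

definition bracket ::
  "('m::topological_space, 'e::euclidean_space) atlas \<Rightarrow> ('m \<Rightarrow> 'm tvec) \<Rightarrow> ('m \<Rightarrow> 'm tvec) \<Rightarrow> 'm \<Rightarrow> 'm tvec" where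
  "bracket M X Y p f =
     (if smooth_at M p f then X p (\<lambda>q. Y q f) - Y p (\<lambda>q. X q f) else 0)"

definition differential ::
  "('b::topological_space, 'k::euclidean_space) atlas \<Rightarrow> ('m \<Rightarrow> 'b) \<Rightarrow> 'm \<Rightarrow> 'm tvec \<Rightarrow> 'b tvec" where
  "differential B \<phi> p v f = (if smooth_at B (\<phi> p) f then v (f \<circ> \<phi>) else 0)"


section \<open>Pseudo-Riemannian metrics\<close>

type_synonym 'm metric = "'m \<Rightarrow> 'm tvec \<Rightarrow> 'm tvec \<Rightarrow> real"

definition neg_def_family ::
  "('m::topological_space, 'e::euclidean_space) atlas \<Rightarrow> 'm metric \<Rightarrow> 'm \<Rightarrow> nat \<Rightarrow> bool" where
  "neg_def_family M g p k \<longleftrightarrow>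
     (\<exists>v::nat \<Rightarrow> 'm tvec. (\<forall>i<k. v i \<in> tangent_space M p) \<and>
        (\<forall>c::nat \<Rightarrow> real. (\<exists>i<k. c i \<noteq> 0) \<longrightarrow>
           g p (\<lambda>f. \<Sum>i<k. c i * v i f) (\<lambda>f. \<Sum>i<k. c i * v i f) < 0))"

text \<open>The index \<open>r\<close> is the maximal dimension of a subspace on which the scalar product is
  negative definite.\<close>

definition pseudo_riemannian ::
  "('m::{t2_space,second_countable_topology}, 'e::euclidean_space) atlas \<Rightarrow> 'm metric \<Rightarrow> nat \<Rightarrow> bool" where
  "pseudo_riemannian M g r \<longleftrightarrow>
     smooth_manifold M \<and>
     (\<forall>p\<in>carrier M. \<forall>u\<in>tangent_space M p. \<forall>v\<in>tangent_space M p. \<forall>w\<in>tangent_space M p. \<forall>a b.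
        g p u v = g p v u \<and>
        g p (\<lambda>f. a * u f + b * v f) w = a * g p u w + b * g p v w) \<and>
     (\<forall>p\<in>carrier M. \<forall>u\<in>tangent_space M p.
        (\<forall>v\<in>tangent_space M p. g p u v = 0) \<longrightarrow> u = (\<lambda>f. 0)) \<and>
     (\<forall>U X Y. open U \<and> U \<subseteq> carrier M \<and> vfield M U X \<and> vfield M U Y \<longrightarrow>
        smooth_fun M U (\<lambda>p. g p (X p) (Y p))) \<and>
     (\<forall>p\<in>carrier M. neg_def_family M g p r \<and> \<not> neg_def_family M g p (Suc r))"

definition gradient ::
  "('m::topological_space, 'e::euclidean_space) atlas \<Rightarrow> 'm metric \<Rightarrow> ('m \<Rightarrow> real) \<Rightarrow> 'm \<Rightarrow> 'm tvec" where
  "gradient M g f p =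
     (THE v. v \<in> tangent_space M p \<and> (\<forall>w\<in>tangent_space M p. g p v w = w f))"

text \<open>The frame consists of the fields \<open>e 1, \<dots>, e n\<close>, where \<open>n\<close> is the dimension.\<close>

definition orthonormal_frame ::
  "('m::topological_space, 'e::euclidean_space) atlas \<Rightarrow> 'm metric \<Rightarrow> 'm set \<Rightarrow> (nat \<Rightarrow> 'm \<Rightarrow> 'm tvec) \<Rightarrow> bool" where
  "orthonormal_frame M g U e \<longleftrightarrow>
     (\<forall>i\<in>{1..DIM('e)}. vfield M U (e i)) \<and>
     (\<forall>p\<in>U. \<forall>v\<in>tangent_space M p. \<exists>c::nat \<Rightarrow> real. v = (\<lambda>f. \<Sum>i=1..DIM('e). c i * e i p f)) \<and>
     (\<forall>p\<in>U. \<forall>i\<in>{1..DIM('e)}. \<forall>j\<in>{1..DIM('e)}. i \<noteq> j \<longrightarrow> g p (e i p) (e j p) = 0) \<and>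
     (\<forall>p\<in>U. \<forall>i\<in>{1..DIM('e)}. g p (e i p) (e i p) \<in> {1, -1})"


section \<open>Connections and curvature\<close>

text \<open>The Levi-Civita connection of the open submanifold \<open>U\<close> of \<open>(M, g)\<close>.\<close>

definition is_levi_civita ::
  "('m::topological_space, 'e::euclidean_space) atlas \<Rightarrow> 'm metric \<Rightarrow> 'm set \<Rightarrow>
   (('m \<Rightarrow> 'm tvec) \<Rightarrow> ('m \<Rightarrow> 'm tvec) \<Rightarrow> 'm \<Rightarrow> 'm tvec) \<Rightarrow> bool" where
  "is_levi_civita M g U D \<longleftrightarrow>
     (\<forall>X Y Z f. vfield M U X \<and> vfield M U Y \<and> vfield M U Z \<and> smooth_fun M U f \<longrightarrow>
        vfield M U (D X Y) \<and>
        (\<forall>p\<in>U.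
           D (\<lambda>q h. X q h + Y q h) Z p = (\<lambda>h. D X Z p h + D Y Z p h) \<and>
           D (\<lambda>q h. f q * X q h) Y p = (\<lambda>h. f p * D X Y p h) \<and>
           D X (\<lambda>q h. Y q h + Z q h) p = (\<lambda>h. D X Y p h + D X Z p h) \<and>
           D X (\<lambda>q h. f q * Y q h) p = (\<lambda>h. X p f * Y p h + f p * D X Y p h) \<and>
           (\<lambda>h. D X Y p h - D Y X p h) = bracket M X Y p \<and>
           X p (\<lambda>q. g q (Y q) (Z q)) = g p (D X Y p) (Z p) + g p (Y p) (D X Z p)))"

text \<open>By the fundamental theorem of pseudo-Riemannian geometry such a connection exists, and its
  values on \<open>U\<close> are uniquely determined for smooth arguments, so the choice below only concerns junk
  values. The same applies to the pull-back connection.\<close>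

definition levi_civita ::
  "('m::topological_space, 'e::euclidean_space) atlas \<Rightarrow> 'm metric \<Rightarrow> 'm set \<Rightarrow>
   ('m \<Rightarrow> 'm tvec) \<Rightarrow> ('m \<Rightarrow> 'm tvec) \<Rightarrow> 'm \<Rightarrow> 'm tvec" where
  "levi_civita M g U = (SOME D. is_levi_civita M g U D)"

definition riemann ::
  "('m::topological_space, 'e::euclidean_space) atlas \<Rightarrow> 'm metric \<Rightarrow> 'm set \<Rightarrow>
   ('m \<Rightarrow> 'm tvec) \<Rightarrow> ('m \<Rightarrow> 'm tvec) \<Rightarrow> ('m \<Rightarrow> 'm tvec) \<Rightarrow> 'm \<Rightarrow> 'm tvec" where
  "riemann M g U X Y Z = (let D = levi_civita M g U in
     (\<lambda>p f. D X (D Y Z) p f - D Y (D X Z) p f - D (bracket M X Y) Z p f))"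

text \<open>The curvature tensor at a point, obtained by extending tangent vectors to vector fields.\<close>

definition riemann_at ::
  "('m::topological_space, 'e::euclidean_space) atlas \<Rightarrow> 'm metric \<Rightarrow> 'm set \<Rightarrow>
   'm \<Rightarrow> 'm tvec \<Rightarrow> 'm tvec \<Rightarrow> 'm tvec \<Rightarrow> 'm tvec" where
  "riemann_at M g U p u v w =
     (THE t. \<exists>X Y Z. vfield M U X \<and> vfield M U Y \<and> vfield M U Z \<and>
        X p = u \<and> Y p = v \<and> Z p = w \<and> t = riemann M g U X Y Z p)"

definition R1221 ::
  "('m::topological_space, 'e::euclidean_space) atlas \<Rightarrow> 'm metric \<Rightarrow> 'm set \<Rightarrow>
   (nat \<Rightarrow> 'm \<Rightarrow> 'm tvec) \<Rightarrow> 'm \<Rightarrow> real" where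
  "R1221 M g U e p = g p (riemann M g U (e 1) (e 2) (e 2) p) (e 1 p)"

definition laplacian ::
  "('m::topological_space, 'e::euclidean_space) atlas \<Rightarrow> 'm metric \<Rightarrow> 'm set \<Rightarrow>
   (nat \<Rightarrow> 'm \<Rightarrow> 'm tvec) \<Rightarrow> ('m \<Rightarrow> real) \<Rightarrow> 'm \<Rightarrow> real" where
  "laplacian M g U e f p =
     (\<Sum>i=1..DIM('e). g p (e i p) (e i p) *
        g p (levi_civita M g U (e i) (gradient M g f) p) (e i p))"


section \<open>Biharmonic maps\<close>

text \<open>Smooth sections over \<open>U\<close> of the pull-back of the tangent bundle of \<open>B\<close> under \<open>\<phi>\<close>.\<close>

definition section_along ::
  "('m::topological_space, 'e::euclidean_space) atlas \<Rightarrow> 'm set \<Rightarrow>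
   ('b::topological_space, 'k::euclidean_space) atlas \<Rightarrow> ('m \<Rightarrow> 'b) \<Rightarrow> ('m \<Rightarrow> 'b tvec) \<Rightarrow> bool" where
  "section_along M U B \<phi> S \<longleftrightarrow>
     (\<forall>p\<in>U. S p \<in> tangent_space B (\<phi> p)) \<and>
     (\<forall>W f. open W \<and> W \<subseteq> carrier B \<and> smooth_fun B W f \<longrightarrow>
        smooth_fun M (U \<inter> \<phi> -` W) (\<lambda>p. S p f))"

definition is_pullback_connection ::
  "('m::topological_space, 'e::euclidean_space) atlas \<Rightarrow> 'm set \<Rightarrow>
   ('b::topological_space, 'k::euclidean_space) atlas \<Rightarrow> 'b metric \<Rightarrow> 'b set \<Rightarrow> ('m \<Rightarrow> 'b) \<Rightarrow>
   (('m \<Rightarrow> 'm tvec) \<Rightarrow> ('m \<Rightarrow> 'b tvec) \<Rightarrow> 'm \<Rightarrow> 'b tvec) \<Rightarrow> bool" where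
  "is_pullback_connection M U B h V \<phi> D \<longleftrightarrow>
     (\<forall>X Y S T f. vfield M U X \<and> vfield M U Y \<and> section_along M U B \<phi> S \<and> section_along M U B \<phi> T \<and>
        smooth_fun M U f \<longrightarrow>
        section_along M U B \<phi> (D X S) \<and>
        (\<forall>p\<in>U.
           D (\<lambda>q k. X q k + Y q k) S p = (\<lambda>k. D X S p k + D Y S p k) \<and>
           D (\<lambda>q k. f q * X q k) S p = (\<lambda>k. f p * D X S p k) \<and>
           D X (\<lambda>q k. S q k + T q k) p = (\<lambda>k. D X S p k + D X T p k) \<and>
           D X (\<lambda>q k. f q * S q k) p = (\<lambda>k. X p f * S p k + f p * D X S p k))) \<and>
     (\<forall>X Y Z. vfield M U X \<and> vfield B V Y \<and> vfield B V Z \<longrightarrow>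
        (\<forall>p\<in>U. Z (\<phi> p) = differential B \<phi> p (X p) \<longrightarrow>
           D X (\<lambda>q. Y (\<phi> q)) p = levi_civita B h V Z Y (\<phi> p)))"

definition pullback_connection ::
  "('m::topological_space, 'e::euclidean_space) atlas \<Rightarrow> 'm set \<Rightarrow>
   ('b::topological_space, 'k::euclidean_space) atlas \<Rightarrow> 'b metric \<Rightarrow> 'b set \<Rightarrow> ('m \<Rightarrow> 'b) \<Rightarrow>
   ('m \<Rightarrow> 'm tvec) \<Rightarrow> ('m \<Rightarrow> 'b tvec) \<Rightarrow> 'm \<Rightarrow> 'b tvec" where
  "pullback_connection M U B h V \<phi> = (SOME D. is_pullback_connection M U B h V \<phi> D)"

text \<open>The tension and bitension fields of \<open>\<phi>\<close> as a map from the open submanifold \<open>U\<close> of \<open>(M, g)\<close> into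
  the open submanifold \<open>V\<close> of \<open>(B, h)\<close>, computed in a frame \<open>e\<close> on \<open>U\<close>.\<close>

definition tension ::
  "('m::topological_space, 'e::euclidean_space) atlas \<Rightarrow> 'm metric \<Rightarrow> 'm set \<Rightarrow>
   ('b::topological_space, 'k::euclidean_space) atlas \<Rightarrow> 'b metric \<Rightarrow> 'b set \<Rightarrow> ('m \<Rightarrow> 'b) \<Rightarrow>
   (nat \<Rightarrow> 'm \<Rightarrow> 'm tvec) \<Rightarrow> 'm \<Rightarrow> 'b tvec" where
  "tension M g U B h V \<phi> e p k =
     (\<Sum>i=1..DIM('e). g p (e i p) (e i p) *
        (pullback_connection M U B h V \<phi> (e i) (\<lambda>q. differential B \<phi> q (e i q)) p k
         - differential B \<phi> p (levi_civita M g U (e i) (e i) p) k))"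

definition bitension ::
  "('m::topological_space, 'e::euclidean_space) atlas \<Rightarrow> 'm metric \<Rightarrow> 'm set \<Rightarrow>
   ('b::topological_space, 'k::euclidean_space) atlas \<Rightarrow> 'b metric \<Rightarrow> 'b set \<Rightarrow> ('m \<Rightarrow> 'b) \<Rightarrow>
   (nat \<Rightarrow> 'm \<Rightarrow> 'm tvec) \<Rightarrow> 'm \<Rightarrow> 'b tvec" where
  "bitension M g U B h V \<phi> e p k =
     (let D = pullback_connection M U B h V \<phi>; \<tau> = tension M g U B h V \<phi> e in
      \<Sum>i=1..DIM('e). g p (e i p) (e i p) *
        (D (e i) (D (e i) \<tau>) p k
         - D (levi_civita M g U (e i) (e i)) \<tau> p k
         - riemann_at B h V (\<phi> p) (differential B \<phi> p (e i p)) (\<tau> p) (differential B \<phi> p (e i p)) k))"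

text \<open>The bitension field does not depend on the orthonormal frame. As such frames need only exist
  locally, its vanishing is tested on all frames over open subsets of \<open>U\<close>.\<close>

definition biharmonic ::
  "('m::topological_space, 'e::euclidean_space) atlas \<Rightarrow> 'm metric \<Rightarrow> 'm set \<Rightarrow>
   ('b::topological_space, 'k::euclidean_space) atlas \<Rightarrow> 'b metric \<Rightarrow> 'b set \<Rightarrow> ('m \<Rightarrow> 'b) \<Rightarrow> bool" where
  "biharmonic M g U B h V \<phi> \<longleftrightarrow>
     (\<forall>W e. open W \<and> W \<subseteq> U \<and> orthonormal_frame M g W e \<longrightarrow>
        (\<forall>p\<in>W. bitension M g W B h V \<phi> e p = (\<lambda>k. 0)))"


section \<open>Pseudo-Riemannian submersions\<close>

text \<open>For a submersion, the tangent space of the fibre through \<open>p\<close> is the kernel of the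
  differential at \<open>p\<close>.\<close>

definition vertical_space ::
  "('m::topological_space, 'e::euclidean_space) atlas \<Rightarrow>
   ('b::topological_space, 'k::euclidean_space) atlas \<Rightarrow> ('m \<Rightarrow> 'b) \<Rightarrow> 'm \<Rightarrow> 'm tvec set" where
  "vertical_space M B \<pi> p = {v \<in> tangent_space M p. differential B \<pi> p v = (\<lambda>f. 0)}"

definition horizontal_space ::
  "('m::topological_space, 'e::euclidean_space) atlas \<Rightarrow> 'm metric \<Rightarrow>
   ('b::topological_space, 'k::euclidean_space) atlas \<Rightarrow> ('m \<Rightarrow> 'b) \<Rightarrow> 'm \<Rightarrow> 'm tvec set" where
  "horizontal_space M g B \<pi> p =
     {v \<in> tangent_space M p. \<forall>w\<in>vertical_space M B \<pi> p. g p v w = 0}"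

definition pseudo_riemannian_submersion ::
  "('m::{t2_space,second_countable_topology}, 'e::euclidean_space) atlas \<Rightarrow> 'm metric \<Rightarrow> nat \<Rightarrow>
   ('b::{t2_space,second_countable_topology}, 'k::euclidean_space) atlas \<Rightarrow> 'b metric \<Rightarrow> nat \<Rightarrow>
   ('m \<Rightarrow> 'b) \<Rightarrow> bool" where
  "pseudo_riemannian_submersion M g r B h s \<pi> \<longleftrightarrow>
     pseudo_riemannian M g r \<and> connected (carrier M) \<and>
     pseudo_riemannian B h s \<and> connected (carrier B) \<and>
     smooth_map M B \<pi> \<and> \<pi> ` carrier M = carrier B \<and>
     (\<forall>p\<in>carrier M. differential B \<pi> p ` tangent_space M p = tangent_space B (\<pi> p)) \<and>
     (\<forall>p\<in>carrier M. \<forall>v\<in>vertical_space M B \<pi> p.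
        (\<forall>w\<in>vertical_space M B \<pi> p. g p v w = 0) \<longrightarrow> v = (\<lambda>f. 0)) \<and>
     (\<forall>p\<in>carrier M. \<forall>v\<in>horizontal_space M g B \<pi> p. \<forall>w\<in>horizontal_space M g B \<pi> p.
        h (\<pi> p) (differential B \<pi> p v) (differential B \<pi> p w) = g p v w) \<and>
     (\<forall>b\<in>carrier B. connected {p \<in> carrier M. \<pi> p = b})"

text \<open>An adapted frame \<open>e\<close> over the open set \<open>U\<close>, lying over an orthonormal frame \<open>\<epsilon>\<close> on the open set
  \<open>V\<close>; a global frame is the case \<open>U = carrier M\<close>, \<open>V = carrier B\<close>.\<close>

definition adapted_frame ::
  "('m::{t2_space,second_countable_topology}, real^3) atlas \<Rightarrow> 'm metric \<Rightarrow> 'm set \<Rightarrow>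
   ('b::{t2_space,second_countable_topology}, real^2) atlas \<Rightarrow> 'b metric \<Rightarrow> 'b set \<Rightarrow> ('m \<Rightarrow> 'b) \<Rightarrow>
   (nat \<Rightarrow> 'm \<Rightarrow> 'm tvec) \<Rightarrow> (nat \<Rightarrow> 'b \<Rightarrow> 'b tvec) \<Rightarrow> bool" where
  "adapted_frame M g U B h V \<pi> e \<epsilon> \<longleftrightarrow>
     open U \<and> U \<subseteq> carrier M \<and> open V \<and> V \<subseteq> carrier B \<and> \<pi> ` U \<subseteq> V \<and>
     orthonormal_frame M g U e \<and> orthonormal_frame B h V \<epsilon> \<and>
     (\<forall>p\<in>U. e 3 p \<in> vertical_space M B \<pi> p) \<and>
     (\<forall>p\<in>U. \<forall>a\<in>{1,2}. e a p \<in> horizontal_space M g B \<pi> p \<and>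
        differential B \<pi> p (e a p) = \<epsilon> a (\<pi> p))"

definition integrability_functions ::
  "('m::{t2_space,second_countable_topology}, real^3) atlas \<Rightarrow> 'm set \<Rightarrow>
   ('b::{t2_space,second_countable_topology}, real^2) atlas \<Rightarrow> 'b set \<Rightarrow> ('m \<Rightarrow> 'b) \<Rightarrow>
   (nat \<Rightarrow> 'm \<Rightarrow> 'm tvec) \<Rightarrow> (nat \<Rightarrow> 'b \<Rightarrow> 'b tvec) \<Rightarrow>
   ('m \<Rightarrow> real) \<Rightarrow> ('m \<Rightarrow> real) \<Rightarrow> ('m \<Rightarrow> real) \<Rightarrow> ('m \<Rightarrow> real) \<Rightarrow> ('m \<Rightarrow> real) \<Rightarrow> bool" where
  "integrability_functions M U B V \<pi> e \<epsilon> l1 l2 lam \<mu> \<sigma> \<longleftrightarrow>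
     smooth_fun M U l1 \<and> smooth_fun M U l2 \<and> smooth_fun M U lam \<and>
     smooth_fun M U \<mu> \<and> smooth_fun M U \<sigma> \<and>
     (\<exists>L1 L2. smooth_fun B V L1 \<and> smooth_fun B V L2 \<and>
        (\<forall>q\<in>V. bracket B (\<epsilon> 1) (\<epsilon> 2) q = (\<lambda>f. L1 q * \<epsilon> 1 q f + L2 q * \<epsilon> 2 q f)) \<and>
        (\<forall>p\<in>U. l1 p = L1 (\<pi> p) \<and> l2 p = L2 (\<pi> p))) \<and>
     (\<forall>p\<in>U.
        bracket M (e 1) (e 3) p = (\<lambda>f. lam p * e 3 p f) \<and>
        bracket M (e 2) (e 3) p = (\<lambda>f. \<mu> p * e 3 p f) \<and>
        bracket M (e 1) (e 2) p = (\<lambda>f. l1 p * e 1 p f + l2 p * e 2 p f - 2 * \<sigma> p * e 3 p f))"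

end

theory Submission
  imports Defs
begin

text \<open>In an adapted frame everything is determined by the brackets of the frame fields. The fibres are
  curves, and \<open>\<nabla>\<^sub>3 e\<^sub>3 = \<delta>\<^sub>3 (\<delta>\<^sub>1 \<lambda> e\<^sub>1 + \<delta>\<^sub>2 \<mu> e\<^sub>2)\<close> is their curvature vector. The horizontal directions do not
  contribute to the tension field, as \<open>\<nabla>\<^sub>a e\<^sub>a\<close> projects onto the corresponding field of the base. Hence
  \<open>\<tau> = - \<delta>\<^sub>1 \<lambda> \<epsilon>\<^sub>1 - \<delta>\<^sub>2 \<mu> \<epsilon>\<^sub>2\<close> (lemma \<open>tension_adapted\<close>). The pulled-back frame \<open>\<epsilon> \<circ> \<pi>\<close> is differentiated by
  the connection matrix of the base, whose entries are \<open>\<plusminus> l\<^sub>1\<close> and \<open>\<plusminus> l\<^sub>2\<close>, and it is parallel along the fibres.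
  Differentiating \<open>\<tau>\<close> twice turns the two coefficients of the bitension field into the two equations, up to
  the factors \<open>- \<delta>\<^sub>1\<close> and \<open>- \<delta>\<^sub>2\<close> (lemma \<open>bitension_adapted\<close>); they vanish together with the field because
  \<open>\<epsilon>\<^sub>1\<close> and \<open>\<epsilon>\<^sub>2\<close> are linearly independent.

  The definition of biharmonicity tests all local orthonormal frames. Tension and bitension are traces of
  tensors, so the test in an arbitrary frame reduces to the one in the adapted frame, restricted to a smaller
  open set (lemmas \<open>trace_frame_independent\<close> and \<open>bitension_any_frame\<close>).

  The connections involved are chosen by their axioms, so their existence has to be shown. Over the domain of a
  frame this is elementary. A matrix of one-forms defines a connection (\<open>linear_connection_from_coefficients\<close>);
  Koszul's formula supplies the matrix for the Levi-Civita connection, and its pull-back that for the pull-back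
  connection. For the latter one has to know that the coordinates of a smooth section in the frame are smooth
  (\<open>coord_sect_smooth\<close>). The axioms then determine the values on frames
  from the brackets alone (\<open>nabla_frame_self\<close>), and the curvature of the base is computed from them
  (\<open>curvature_frame\<close>).\<close>

section \<open>Functions of class \<open>C\<^sup>k\<close>\<close>

lemma Ck_on_cong:
  assumes "open S" and "\<And>x. x \<in> S \<Longrightarrow> f x = g x" and "Ck_on k S f"
  shows "Ck_on k S g"
  using assms
proof (induction k arbitrary: f g)
  case 0
  then show ?case by (metis Ck_on.simps(1) continuous_on_cong)
next
  case (Suc k)
  have d: "f differentiable at x" if "x \<in> S" for x
    using Suc.prems that by (simp add: differentiable_on_eq_differentiable_at)
  have hd: "(g has_derivative frechet_derivative f (at x)) (at x)" if "x \<in> S" for x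
    by (rule has_derivative_transform_within_open[OF frechet_derivative_works[THEN iffD1, OF d[OF that]] Suc.prems(1) that])
      (use Suc.prems in auto)
  then have eq: "frechet_derivative g (at x) = frechet_derivative f (at x)" if "x \<in> S" for x
    using frechet_derivative_at[OF hd[OF that]] by simp
  have "g differentiable_on S"
    using hd Suc.prems(1) by (auto simp: differentiable_on_eq_differentiable_at differentiable_def)
  moreover have "Ck_on k S (\<lambda>x. frechet_derivative g (at x) b)" if "b \<in> Basis" for b
    by (rule Suc.IH[of "\<lambda>x. frechet_derivative f (at x) b"]) (use Suc.prems that eq in auto)
  ultimately show ?case by simp
qed

text \<open>Derivatives of concrete expressions are known through \<^const>\<open>has_derivative\<close>, not through
  \<^const>\<open>frechet_derivative\<close>; this rule makes any such formula usable in the inductions over the order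
  of differentiability below.\<close>

lemma Ck_on_SucI:
  assumes "open S" and hd: "\<And>x. x \<in> S \<Longrightarrow> (f has_derivative f' x) (at x)"
    and "\<And>b. b \<in> Basis \<Longrightarrow> Ck_on k S (\<lambda>x. f' x b)"
  shows "Ck_on (Suc k) S f"
proof -
  have "f differentiable_on S"
    using hd assms(1) by (auto simp: differentiable_on_eq_differentiable_at differentiable_def)
  moreover have "Ck_on k S (\<lambda>x. frechet_derivative f (at x) b)" if "b \<in> Basis" for b
    by (rule Ck_on_cong[OF assms(1) _ assms(3)[OF that]]) (metis hd frechet_derivative_at)
  ultimately show ?thesis by simp
qed

lemma Ck_on_Suc_has_derivative:
  assumes "open S" "Ck_on (Suc k) S f" "x \<in> S"
  shows "(f has_derivative frechet_derivative f (at x)) (at x)"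
  using assms by (auto simp: differentiable_on_eq_differentiable_at frechet_derivative_works[symmetric])

lemma Ck_on_Suc_imp: "Ck_on (Suc k) S f \<Longrightarrow> Ck_on k S f"
  by (induction k arbitrary: f) (auto intro: differentiable_imp_continuous_on)

lemma Ck_on_subset: "Ck_on k S f \<Longrightarrow> T \<subseteq> S \<Longrightarrow> Ck_on k T f"
  by (induction k arbitrary: f) (auto intro: continuous_on_subset differentiable_on_subset)

lemma Ck_on_local:
  assumes "open S" and "\<And>x. x \<in> S \<Longrightarrow> \<exists>T. open T \<and> x \<in> T \<and> T \<subseteq> S \<and> Ck_on k T f"
  shows "Ck_on k S f"
  using assms(2)
proof (induction k arbitrary: f)
  case 0
  then show ?case
    using assms(1) by (metis Ck_on.simps(1) continuous_on_eq_continuous_at)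
next
  case (Suc k)
  have "f differentiable_on S"
    using Suc.prems assms(1)
    by (metis Ck_on.simps(2) differentiable_on_eq_differentiable_at)
  moreover have "Ck_on k S (\<lambda>x. frechet_derivative f (at x) b)" if "b \<in> Basis" for b
    by (rule Suc.IH) (use Suc.prems that in \<open>metis Ck_on.simps(2)\<close>)
  ultimately show ?case by simp
qed

lemma Ck_on_const: "Ck_on k S (\<lambda>x. c)"
  by (induction k arbitrary: c) (auto simp: frechet_derivative_const)

lemma Ck_on_add:
  assumes "open S" "Ck_on k S f" "Ck_on k S g"
  shows "Ck_on k S (\<lambda>x. f x + g x)"
  using assms(2,3)
proof (induction k arbitrary: f g)
  case 0 then show ?case by (auto intro: continuous_on_add)
next
  case (Suc k)
  show ?case
    by (rule Ck_on_SucI[OF assms(1) has_derivative_add[OF Ck_on_Suc_has_derivative[OF assms(1) Suc.prems(1)]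
            Ck_on_Suc_has_derivative[OF assms(1) Suc.prems(2)]]])
      (use Suc in auto)
qed

lemma Ck_on_mult:
  fixes f g :: "'a::euclidean_space \<Rightarrow> real"
  assumes "open S" "Ck_on k S f" "Ck_on k S g"
  shows "Ck_on k S (\<lambda>x. f x * g x)"
  using assms(2,3)
proof (induction k arbitrary: f g)
  case 0 then show ?case by (auto intro: continuous_on_mult)
next
  case (Suc k)
  show ?case
    by (rule Ck_on_SucI[OF assms(1) has_derivative_mult[OF Ck_on_Suc_has_derivative[OF assms(1) Suc.prems(1)]
            Ck_on_Suc_has_derivative[OF assms(1) Suc.prems(2)]]])
      (use Suc Ck_on_Suc_imp[OF Suc.prems(1)] Ck_on_Suc_imp[OF Suc.prems(2)] in \<open>auto intro!: Ck_on_add[OF assms(1)]\<close>)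
qed

lemma Ck_on_sum:
  assumes "open S" "\<And>i. i \<in> I \<Longrightarrow> Ck_on k S (f i)"
  shows "Ck_on k S (\<lambda>x. \<Sum>i\<in>I. f i x)"
  using assms(2)
  by (induction I rule: infinite_finite_induct) (auto intro!: Ck_on_add[OF assms(1)] simp: Ck_on_const)

lemma Ck_on_inner:
  fixes f :: "'a::euclidean_space \<Rightarrow> 'b::euclidean_space"
  assumes "open S" "Ck_on k S f"
  shows "Ck_on k S (\<lambda>x. f x \<bullet> c)"
  using assms(2)
proof (induction k arbitrary: f)
  case 0 then show ?case by (auto intro: continuous_on_inner)
next
  case (Suc k)
  show ?case
    by (rule Ck_on_SucI[OF assms(1) has_derivative_inner_left[OF Ck_on_Suc_has_derivative[OF assms(1) Suc.prems(1)]]])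
      (use Suc in auto)
qed

lemma Ck_on_inverse:
  fixes f :: "'a::euclidean_space \<Rightarrow> real"
  assumes "open S" "Ck_on k S f" "\<And>x. x \<in> S \<Longrightarrow> f x \<noteq> 0"
  shows "Ck_on k S (\<lambda>x. inverse (f x))"
  using assms(2)
proof (induction k)
  case 0 then show ?case using assms(3) by (auto intro: continuous_on_inverse)
next
  case (Suc k)
  have "Ck_on k S (\<lambda>x. (-1) * (inverse (f x) * frechet_derivative f (at x) b * inverse (f x)))"
    if "b \<in> Basis" for b
    using Suc that Ck_on_Suc_imp[OF Suc.prems]
    by (intro Ck_on_mult[OF assms(1)] Ck_on_const) auto
  then show ?case
    by (intro Ck_on_SucI[OF assms(1) Deriv.has_derivative_inverse[OF assms(3) Ck_on_Suc_has_derivative[OF assms(1) Suc.prems(1)]]])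
       auto
qed

text \<open>By the chain rule \<open>D (g \<circ> f) b = (\<Sum>c\<in>Basis. (Df b \<bullet> c) * (D\<^sub>c g \<circ> f))\<close>. Each factor on the
  right is one order less regular than \<open>f\<close> or \<open>g\<close>, and \<open>D\<^sub>c g \<circ> f\<close> is again a composition, so the
  induction is over the order with \<open>g\<close> arbitrary.\<close>

lemma Ck_on_compose:
  fixes f :: "'a::euclidean_space \<Rightarrow> 'b::euclidean_space" and g :: "'b \<Rightarrow> real"
  assumes "open S" "open T" "Ck_on k S f" "Ck_on k T g" "f ` S \<subseteq> T"
  shows "Ck_on k S (g \<circ> f)"
  using assms(3,4)
proof (induction k arbitrary: g)
  case 0 then show ?case using assms(5) by (simp only: Ck_on.simps) (rule continuous_on_compose, auto intro: continuous_on_subset)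
next
  case (Suc k)
  have fx: "f x \<in> T" if "x \<in> S" for x using assms(5) that by auto
  have hd: "((g \<circ> f) has_derivative (frechet_derivative g (at (f x)) \<circ> frechet_derivative f (at x))) (at x)"
    if "x \<in> S" for x
    by (rule diff_chain_at[OF Ck_on_Suc_has_derivative[OF assms(1) Suc.prems(1) that]
          Ck_on_Suc_has_derivative[OF assms(2) Suc.prems(2) fx[OF that]]])
  have lin: "linear (frechet_derivative g (at (f x)))" if "x \<in> S" for x
    using Ck_on_Suc_has_derivative[OF assms(2) Suc.prems(2) fx[OF that]] has_derivative_linear by blast
  have *: "(frechet_derivative g (at (f x)) \<circ> frechet_derivative f (at x)) b
        = (\<Sum>c\<in>Basis. (frechet_derivative f (at x) b \<bullet> c) * ((\<lambda>y. frechet_derivative g (at y) c) \<circ> f) x)"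
    if "x \<in> S" for x b
    using Linear_Algebra.linear_componentwise[OF lin[OF that], of "frechet_derivative f (at x) b" 1]
    by simp
  have "Ck_on k S (\<lambda>x. \<Sum>c\<in>Basis. (frechet_derivative f (at x) b \<bullet> c) * ((\<lambda>y. frechet_derivative g (at y) c) \<circ> f) x)"
    if "b \<in> Basis" for b
    using Suc.prems that Ck_on_Suc_imp[OF Suc.prems(1)]
    by (intro Ck_on_sum Ck_on_mult assms(1) Ck_on_inner Suc.IH) auto
  then show ?case
    by (intro Ck_on_SucI[OF assms(1) hd]) (auto intro: Ck_on_cong[OF assms(1)] simp only: *)
qed

lemma smooth_on_cong:
  assumes "open S" and "\<And>x. x \<in> S \<Longrightarrow> f x = g x" and "smooth_on S f"
  shows "smooth_on S g"
  using assms unfolding smooth_on_def by (meson Ck_on_cong)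

lemma smooth_on_subset: "smooth_on S f \<Longrightarrow> T \<subseteq> S \<Longrightarrow> smooth_on T f"
  unfolding smooth_on_def using Ck_on_subset by blast

lemma smooth_on_local:
  assumes "open S" and "\<And>x. x \<in> S \<Longrightarrow> \<exists>T. open T \<and> x \<in> T \<and> T \<subseteq> S \<and> smooth_on T f"
  shows "smooth_on S f"
  using assms unfolding smooth_on_def by (meson Ck_on_local)

lemma smooth_on_compose:
  fixes f :: "'a::euclidean_space \<Rightarrow> 'b::euclidean_space" and g :: "'b \<Rightarrow> real"
  assumes "open S" "open T" "smooth_on S f" "smooth_on T g" "f ` S \<subseteq> T"
  shows "smooth_on S (g \<circ> f)"
  using assms unfolding smooth_on_def by (meson Ck_on_compose)

lemma smooth_on_continuous: "smooth_on S f \<Longrightarrow> continuous_on S f"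
  unfolding smooth_on_def by (metis Ck_on.simps(1))

lemma smooth_on_const: "smooth_on S (\<lambda>x. c)"
  by (simp add: smooth_on_def Ck_on_const)

lemma smooth_on_add: "open S \<Longrightarrow> smooth_on S f \<Longrightarrow> smooth_on S g \<Longrightarrow> smooth_on S (\<lambda>x. f x + g x)"
  by (simp add: smooth_on_def Ck_on_add)

lemma smooth_on_mult:
  fixes f g :: "'a::euclidean_space \<Rightarrow> real"
  shows "open S \<Longrightarrow> smooth_on S f \<Longrightarrow> smooth_on S g \<Longrightarrow> smooth_on S (\<lambda>x. f x * g x)"
  by (simp add: smooth_on_def Ck_on_mult)

lemma smooth_on_inverse:
  fixes f :: "'a::euclidean_space \<Rightarrow> real"
  shows "open S \<Longrightarrow> smooth_on S f \<Longrightarrow> (\<And>x. x \<in> S \<Longrightarrow> f x \<noteq> 0) \<Longrightarrow> smooth_on S (\<lambda>x. inverse (f x))"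
  by (simp add: smooth_on_def Ck_on_inverse)

section \<open>Smooth functions, tangent vectors and vector fields\<close>

locale smooth_mfd =
  fixes M :: "('m::{t2_space,second_countable_topology}, 'e::euclidean_space) atlas"
  assumes mfd: "smooth_manifold M"
begin

lemma chart_domain_open: "(U, x) \<in> M \<Longrightarrow> open U"
  using mfd by (auto simp: smooth_manifold_def)

lemma chart_inj: "(U, x) \<in> M \<Longrightarrow> inj_on x U"
  using mfd by (auto simp: smooth_manifold_def)

lemma chart_homeomorphism: "(U, x) \<in> M \<Longrightarrow> homeomorphism U (x ` U) x (inv_into U x)"
  using mfd by (auto simp: smooth_manifold_def)

lemma chart_image_open:
  assumes "(U, x) \<in> M" "open W"
  shows "open (x ` (U \<inter> W))"
proof -
  have "openin (top_of_set (x ` U)) (x ` (U \<inter> W))"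
    using homeomorphism_imp_open_map[OF chart_homeomorphism[OF assms(1)]] assms(2)
    by (simp add: openin_open_Int)
  moreover have "open (x ` U)" using assms(1) mfd by (auto simp: smooth_manifold_def)
  ultimately show ?thesis by (simp add: openin_open_eq)
qed

lemma carrier_open: "open (carrier M)"
  unfolding carrier_def using chart_domain_open by auto

lemma smooth_fun_cong:
  assumes "open W" "smooth_fun M W f" "\<And>p. p \<in> W \<Longrightarrow> f p = f' p"
  shows "smooth_fun M W f'"
  unfolding smooth_fun_def
proof clarify
  fix U x assume c: "(U, x) \<in> M"
  show "smooth_on (x ` (U \<inter> W)) (f' \<circ> inv_into U x)"
    by (rule smooth_on_cong[OF chart_image_open[OF c assms(1)], of "f \<circ> inv_into U x"])
      (use assms(2,3) c chart_inj[OF c] in \<open>auto simp: smooth_fun_def\<close>)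
qed

lemma smooth_fun_subset: "smooth_fun M W f \<Longrightarrow> W' \<subseteq> W \<Longrightarrow> smooth_fun M W' f"
  unfolding smooth_fun_def by (fast elim: smooth_on_subset)

lemma smooth_fun_local:
  assumes "open W" "\<And>p. p \<in> W \<Longrightarrow> \<exists>W'. open W' \<and> p \<in> W' \<and> W' \<subseteq> W \<and> smooth_fun M W' f"
  shows "smooth_fun M W f"
  unfolding smooth_fun_def
proof clarify
  fix U x assume c: "(U, x) \<in> M"
  show "smooth_on (x ` (U \<inter> W)) (f \<circ> inv_into U x)"
  proof (rule smooth_on_local[OF chart_image_open[OF c assms(1)]])
    fix y assume "y \<in> x ` (U \<inter> W)"
    then obtain p where p: "p \<in> U" "p \<in> W" "y = x p" by auto
    then obtain W' where W': "open W'" "p \<in> W'" "W' \<subseteq> W" "smooth_fun M W' f" using assms(2) by blast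
    show "\<exists>T. open T \<and> y \<in> T \<and> T \<subseteq> x ` (U \<inter> W) \<and> smooth_on T (f \<circ> inv_into U x)"
      by (rule exI[of _ "x ` (U \<inter> W')"])
        (use W' p c chart_image_open[OF c W'(1)] in \<open>auto simp: smooth_fun_def\<close>)
  qed
qed

lemma smooth_fun_const: "smooth_fun M W (\<lambda>p. c)"
  by (auto simp: smooth_fun_def o_def smooth_on_const)

lemma smooth_fun_add:
  "open W \<Longrightarrow> smooth_fun M W f \<Longrightarrow> smooth_fun M W f' \<Longrightarrow> smooth_fun M W (\<lambda>p. f p + f' p)"
  unfolding smooth_fun_def o_def by (auto intro!: smooth_on_add dest: chart_image_open)

lemma smooth_fun_mult:
  "open W \<Longrightarrow> smooth_fun M W f \<Longrightarrow> smooth_fun M W f' \<Longrightarrow> smooth_fun M W (\<lambda>p. f p * f' p)"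
  unfolding smooth_fun_def o_def by (auto intro!: smooth_on_mult dest: chart_image_open)

lemma smooth_fun_inverse:
  assumes "open W" "smooth_fun M W f" "\<And>p. p \<in> W \<Longrightarrow> f p \<noteq> 0"
  shows "smooth_fun M W (\<lambda>p. inverse (f p))"
  unfolding smooth_fun_def o_def
proof clarify
  fix U x assume c: "(U, x) \<in> M"
  show "smooth_on (x ` (U \<inter> W)) (\<lambda>y. inverse (f (inv_into U x y)))"
    by (rule smooth_on_inverse[OF chart_image_open[OF c assms(1)]])
     (use assms(2,3) c chart_inj[OF c] in \<open>auto simp: smooth_fun_def o_def\<close>)
qed

lemma smooth_fun_minus: "open W \<Longrightarrow> smooth_fun M W f \<Longrightarrow> smooth_fun M W (\<lambda>p. - f p)"
  using smooth_fun_mult[OF _ smooth_fun_const, of W f "-1"] by simp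

lemma smooth_fun_diff:
  "open W \<Longrightarrow> smooth_fun M W f \<Longrightarrow> smooth_fun M W f' \<Longrightarrow> smooth_fun M W (\<lambda>p. f p - f' p)"
  using smooth_fun_add[OF _ _ smooth_fun_minus, of W f f'] by simp

lemma smooth_fun_sum:
  "open W \<Longrightarrow> (\<And>i. i \<in> I \<Longrightarrow> smooth_fun M W (f i)) \<Longrightarrow> smooth_fun M W (\<lambda>p. \<Sum>i\<in>I. f i p)"
  by (induction I rule: infinite_finite_induct) (auto intro: smooth_fun_add smooth_fun_const)

lemma smooth_fun_continuous:
  assumes "open W" "W \<subseteq> carrier M" "smooth_fun M W f"
  shows "continuous_on W f"
proof -
  have "continuous (at p) f" if p: "p \<in> W" for p
  proof -
    obtain U x where c: "(U, x) \<in> M" "p \<in> U" using p assms(2) by (auto simp: carrier_def)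
    have "continuous_on (U \<inter> W) x"
      using chart_homeomorphism[OF c(1)] by (auto simp: homeomorphism_def intro: continuous_on_subset)
    moreover have "continuous_on (x ` (U \<inter> W)) (f \<circ> inv_into U x)"
      using assms(3) c by (intro smooth_on_continuous) (auto simp: smooth_fun_def)
    ultimately have "continuous_on (U \<inter> W) ((f \<circ> inv_into U x) \<circ> x)"
      by (rule continuous_on_compose)
    then have "continuous_on (U \<inter> W) f"
      by (rule continuous_on_cong[THEN iffD1, rotated 2]) (use chart_inj[OF c(1)] in auto)
    then show ?thesis
      using c p assms(1) chart_domain_open[OF c(1)]
      by (meson IntI continuous_on_eq_continuous_at open_Int)
  qed
  then show ?thesis using assms(1) by (simp add: continuous_on_eq_continuous_at)
qed

lemma smooth_atI: "open W \<Longrightarrow> p \<in> W \<Longrightarrow> W \<subseteq> carrier M \<Longrightarrow> smooth_fun M W f \<Longrightarrow> smooth_at M p f"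
  by (auto simp: smooth_at_def)

lemma smooth_at_const: "p \<in> carrier M \<Longrightarrow> smooth_at M p (\<lambda>x. c)"
  by (rule smooth_atI[OF carrier_open _ order_refl smooth_fun_const])

lemma smooth_at_add:
  assumes "smooth_at M p f" "smooth_at M p f'"
  shows "smooth_at M p (\<lambda>x. f x + f' x)"
proof -
  obtain W W' where "open W" "p \<in> W" "W \<subseteq> carrier M" "smooth_fun M W f"
    "open W'" "p \<in> W'" "smooth_fun M W' f'"
    using assms by (auto simp: smooth_at_def)
  then show ?thesis
    by (intro smooth_atI[of "W \<inter> W'"] smooth_fun_add) (auto elim: smooth_fun_subset)
qed

lemma smooth_at_mult:
  assumes "smooth_at M p f" "smooth_at M p f'"
  shows "smooth_at M p (\<lambda>x. f x * f' x)"
proof -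
  obtain W W' where "open W" "p \<in> W" "W \<subseteq> carrier M" "smooth_fun M W f"
    "open W'" "p \<in> W'" "smooth_fun M W' f'"
    using assms by (auto simp: smooth_at_def)
  then show ?thesis
    by (intro smooth_atI[of "W \<inter> W'"] smooth_fun_mult) (auto elim: smooth_fun_subset)
qed

lemma smooth_at_cong:
  assumes "smooth_at M p f" "open W" "p \<in> W" "\<And>x. x \<in> W \<Longrightarrow> f x = f' x"
  shows "smooth_at M p f'"
proof -
  obtain W' where W': "open W'" "p \<in> W'" "W' \<subseteq> carrier M" "smooth_fun M W' f"
    using assms by (auto simp: smooth_at_def)
  have "smooth_fun M (W \<inter> W') f'"
    by (rule smooth_fun_cong[of _ f]) (use assms W' in \<open>auto elim: smooth_fun_subset\<close>)
  then show ?thesis using assms W' by (intro smooth_atI[of "W \<inter> W'"]) auto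
qed

lemma tv_nonsmooth: "v \<in> tangent_space M p \<Longrightarrow> \<not> smooth_at M p f \<Longrightarrow> v f = 0"
  by (simp add: tangent_space_def)

lemma tv_add: "v \<in> tangent_space M p \<Longrightarrow> smooth_at M p f \<Longrightarrow> smooth_at M p f' \<Longrightarrow>
    v (\<lambda>x. f x + f' x) = v f + v f'"
  by (simp add: tangent_space_def)

lemma tv_mult: "v \<in> tangent_space M p \<Longrightarrow> smooth_at M p f \<Longrightarrow> smooth_at M p f' \<Longrightarrow>
    v (\<lambda>x. f x * f' x) = f p * v f' + f' p * v f"
  by (simp add: tangent_space_def)

text \<open>Only the germ of the argument matters, even if it is not smooth: then both values are \<open>0\<close>.\<close>

lemma tv_cong:
  assumes "v \<in> tangent_space M p" "open W" "p \<in> W" "\<And>x. x \<in> W \<Longrightarrow> f x = f' x"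
  shows "v f = v f'"
proof (cases "smooth_at M p f")
  case True
  have "\<forall>\<^sub>F x in nhds p. f x = f' x"
    using assms by (auto simp: eventually_nhds)
  then show ?thesis using assms True by (simp add: tangent_space_def)
next
  case False
  then have "\<not> smooth_at M p f'" using smooth_at_cong[of p f' W f] assms by auto
  then show ?thesis using False assms tv_nonsmooth by metis
qed

lemma tv_scale: "v \<in> tangent_space M p \<Longrightarrow> smooth_at M p f \<Longrightarrow> v (\<lambda>x. c * f x) = c * v f"
  by (simp add: tangent_space_def)

lemma tv_const:
  assumes "v \<in> tangent_space M p" "p \<in> carrier M"
  shows "v (\<lambda>x. c) = 0"
proof -
  have "v (\<lambda>x. 1) = v (\<lambda>x. 1 * 1)" by simp
  also have "\<dots> = v (\<lambda>x. 1) + v (\<lambda>x. 1)"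
    by (subst tv_mult[OF assms(1)]) (use assms smooth_at_const in auto)
  finally have "v (\<lambda>x. 1) = 0" by simp
  moreover have "v (\<lambda>x. c * 1) = c * v (\<lambda>x. 1)"
    using assms smooth_at_const by (intro tv_scale)
  ultimately show ?thesis by simp
qed

lemma tangent_spaceI:
  assumes "\<And>f. \<not> smooth_at M p f \<Longrightarrow> v f = 0"
    and "\<And>f f'. smooth_at M p f \<Longrightarrow> smooth_at M p f' \<Longrightarrow> v (\<lambda>x. f x + f' x) = v f + v f'"
    and "\<And>f f'. smooth_at M p f \<Longrightarrow> smooth_at M p f' \<Longrightarrow> v (\<lambda>x. f x * f' x) = f p * v f' + f' p * v f"
    and "\<And>f c. smooth_at M p f \<Longrightarrow> v (\<lambda>x. c * f x) = c * v f"
    and "\<And>f f' W. smooth_at M p f \<Longrightarrow> open W \<Longrightarrow> p \<in> W \<Longrightarrow> (\<And>x. x \<in> W \<Longrightarrow> f x = f' x) \<Longrightarrow> v f = v f'"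
  shows "v \<in> tangent_space M p"
  using assms unfolding tangent_space_def eventually_nhds by (intro CollectI conjI allI impI) blast+

lemma tangent_add:
  assumes "u \<in> tangent_space M p" "v \<in> tangent_space M p"
  shows "(\<lambda>f. u f + v f) \<in> tangent_space M p"
  by (rule tangent_spaceI)
    (auto simp: tv_nonsmooth[OF assms(1)] tv_nonsmooth[OF assms(2)] tv_add[OF assms(1)] tv_add[OF assms(2)]
      tv_mult[OF assms(1)] tv_mult[OF assms(2)] tv_scale[OF assms(1)] tv_scale[OF assms(2)] algebra_simps
      intro!: arg_cong2[of _ _ _ _ "(+)"] tv_cong[OF assms(1)] tv_cong[OF assms(2)])

lemma tangent_scale:
  assumes "u \<in> tangent_space M p"
  shows "(\<lambda>f. c * u f) \<in> tangent_space M p"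
  by (rule tangent_spaceI)
    (auto simp: tv_nonsmooth[OF assms(1)] tv_add[OF assms(1)]
      tv_mult[OF assms(1)] tv_scale[OF assms(1)] algebra_simps
      intro!: tv_cong[OF assms(1)])

lemma tangent_zero: "(\<lambda>f. 0) \<in> tangent_space M p"
  by (simp add: tangent_space_def)

lemma tangent_sum:
  "(\<And>i. i \<in> I \<Longrightarrow> v i \<in> tangent_space M p) \<Longrightarrow> (\<lambda>f. \<Sum>i\<in>I. c i * v i f) \<in> tangent_space M p"
  by (induction I rule: infinite_finite_induct) (auto simp: tangent_zero intro!: tangent_add tangent_scale)

lemma vfieldD: "vfield M U X \<Longrightarrow> p \<in> U \<Longrightarrow> X p \<in> tangent_space M p"
  by (simp add: vfield_def)

lemma vfield_smooth: "vfield M U X \<Longrightarrow> open W \<Longrightarrow> W \<subseteq> U \<Longrightarrow> smooth_fun M W f \<Longrightarrow> smooth_fun M W (\<lambda>p. X p f)"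
  by (simp add: vfield_def)

lemma vfield_subset: "vfield M U X \<Longrightarrow> W \<subseteq> U \<Longrightarrow> vfield M W X"
  by (auto simp: vfield_def)

lemma vfield_cong:
  assumes "open U" "vfield M U X" "\<And>p. p \<in> U \<Longrightarrow> X p = Y p"
  shows "vfield M U Y"
  unfolding vfield_def
proof (intro conjI allI impI ballI)
  fix W f assume W: "open W \<and> W \<subseteq> U \<and> smooth_fun M W f"
  show "smooth_fun M W (\<lambda>p. Y p f)"
    by (rule smooth_fun_cong[of _ "\<lambda>p. X p f"]) (use W assms in \<open>auto intro: vfield_smooth\<close>)
qed (use assms vfieldD in metis)

lemma vfield_add: "vfield M U X \<Longrightarrow> vfield M U Y \<Longrightarrow> vfield M U (\<lambda>p f. X p f + Y p f)"
  unfolding vfield_def by (auto intro: tangent_add smooth_fun_add)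

lemma vfield_scale: "smooth_fun M U c \<Longrightarrow> vfield M U X \<Longrightarrow> vfield M U (\<lambda>p f. c p * X p f)"
  unfolding vfield_def by (auto intro!: tangent_scale smooth_fun_mult elim: smooth_fun_subset)

lemma vfield_zero: "vfield M U (\<lambda>p f. 0)"
  unfolding vfield_def by (auto intro: tangent_zero smooth_fun_const)

lemma vfield_sum:
  "(\<And>i. i \<in> I \<Longrightarrow> smooth_fun M U (c i)) \<Longrightarrow> (\<And>i. i \<in> I \<Longrightarrow> vfield M U (X i)) \<Longrightarrow>
    vfield M U (\<lambda>p f. \<Sum>i\<in>I. c i p * X i p f)"
  by (induction I rule: infinite_finite_induct) (auto simp: vfield_zero intro!: vfield_add vfield_scale)

lemma smooth_at_vfield:
  assumes "open U" "vfield M U X" "p \<in> U" "smooth_at M p f"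
  shows "smooth_at M p (\<lambda>q. X q f)"
proof -
  obtain W where W: "open W" "p \<in> W" "W \<subseteq> carrier M" "smooth_fun M W f"
    using assms by (auto simp: smooth_at_def)
  have "smooth_fun M (U \<inter> W) (\<lambda>q. X q f)"
    by (rule vfield_smooth[OF assms(2)]) (use assms W in \<open>auto elim: smooth_fun_subset\<close>)
  then show ?thesis using assms W by (intro smooth_atI[of "U \<inter> W"]) auto
qed

lemma smooth_at_nhd: "smooth_at M p f \<Longrightarrow> \<exists>W. open W \<and> p \<in> W \<and> W \<subseteq> carrier M \<and> (\<forall>q\<in>W. smooth_at M q f)"
  unfolding smooth_at_def by blast

text \<open>In \<open>X (Y (f f')) - Y (X (f f'))\<close> the mixed products \<open>X f * Y f'\<close> cancel; this is why the commutator
  of two derivations is a derivation.\<close>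

lemma vfield_bracket:
  assumes U: "open U" "U \<subseteq> carrier M" and X: "vfield M U X" and Y: "vfield M U Y"
  shows "vfield M U (bracket M X Y)"
  unfolding vfield_def
proof (intro conjI allI impI ballI)
  fix p assume p: "p \<in> U"
  note Xp = vfieldD[OF X p] and Yp = vfieldD[OF Y p]
  note Xf = smooth_at_vfield[OF U(1) X p] and Yf = smooth_at_vfield[OF U(1) Y p]
  note sm = smooth_at_add smooth_at_mult
  have add: "A p (\<lambda>q. C q (\<lambda>x. f x + f' x)) = A p (\<lambda>q. C q f) + A p (\<lambda>q. C q f')"
    if A: "vfield M U A" and C: "vfield M U C" and f: "smooth_at M p f" "smooth_at M p f'" for A C f f'
  proof -
    obtain W where W: "open W" "p \<in> W" "\<forall>q\<in>W. smooth_at M q f" using smooth_at_nhd[OF f(1)] by blast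
    obtain W' where W': "open W'" "p \<in> W'" "\<forall>q\<in>W'. smooth_at M q f'" using smooth_at_nhd[OF f(2)] by blast
    have "A p (\<lambda>q. C q (\<lambda>x. f x + f' x)) = A p (\<lambda>q. C q f + C q f')"
      by (rule tv_cong[OF vfieldD[OF A p], of "U \<inter> W \<inter> W'"])
        (use W W' U p vfieldD[OF C] in \<open>auto intro!: tv_add\<close>)
    then show ?thesis
      using tv_add[OF vfieldD[OF A p] smooth_at_vfield[OF U(1) C p f(1)] smooth_at_vfield[OF U(1) C p f(2)]]
      by simp
  qed
  have mult: "A p (\<lambda>q. C q (\<lambda>x. f x * f' x)) =
      f p * A p (\<lambda>q. C q f') + C p f' * A p f + f' p * A p (\<lambda>q. C q f) + C p f * A p f'"
    if A: "vfield M U A" and C: "vfield M U C" and f: "smooth_at M p f" "smooth_at M p f'" for A C f f'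
  proof -
    obtain W where W: "open W" "p \<in> W" "\<forall>q\<in>W. smooth_at M q f" using smooth_at_nhd[OF f(1)] by blast
    obtain W' where W': "open W'" "p \<in> W'" "\<forall>q\<in>W'. smooth_at M q f'" using smooth_at_nhd[OF f(2)] by blast
    note s = smooth_at_vfield[OF U(1) C p f(1)] smooth_at_vfield[OF U(1) C p f(2)]
    have "A p (\<lambda>q. C q (\<lambda>x. f x * f' x)) = A p (\<lambda>q. f q * C q f' + f' q * C q f)"
      by (rule tv_cong[OF vfieldD[OF A p], of "U \<inter> W \<inter> W'"])
        (use W W' U p vfieldD[OF C] in \<open>auto intro!: tv_mult\<close>)
    also have "\<dots> = A p (\<lambda>q. f q * C q f') + A p (\<lambda>q. f' q * C q f)"
      by (intro tv_add[OF vfieldD[OF A p]] smooth_at_mult f s)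
    finally show ?thesis
      by (simp add: tv_mult[OF vfieldD[OF A p] f(1) s(2)] tv_mult[OF vfieldD[OF A p] f(2) s(1)])
  qed
  have scale: "A p (\<lambda>q. C q (\<lambda>x. c * f x)) = c * A p (\<lambda>q. C q f)"
    if A: "vfield M U A" and C: "vfield M U C" and f: "smooth_at M p f" for A C f c
  proof -
    obtain W where W: "open W" "p \<in> W" "\<forall>q\<in>W. smooth_at M q f" using smooth_at_nhd[OF f(1)] by blast
    have "A p (\<lambda>q. C q (\<lambda>x. c * f x)) = A p (\<lambda>q. c * C q f)"
      by (rule tv_cong[OF vfieldD[OF A p], of "U \<inter> W"])
        (use W U p vfieldD[OF C] in \<open>auto intro!: tv_scale\<close>)
    then show ?thesis
      using tv_scale[OF vfieldD[OF A p] smooth_at_vfield[OF U(1) C p f(1)]] by simp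
  qed
  have cong: "A p (\<lambda>q. C q f) = A p (\<lambda>q. C q f')"
    if A: "vfield M U A" and C: "vfield M U C" and W: "open W" "p \<in> W" "\<And>x. x \<in> W \<Longrightarrow> f x = f' x"
    for A C f f' W
    by (rule tv_cong[OF vfieldD[OF A p], of "U \<inter> W"])
      (use W U p in \<open>auto intro!: tv_cong[OF vfieldD[OF C], of _ W]\<close>)
  have pc: "p \<in> carrier M" using p U by auto
  show "bracket M X Y p \<in> tangent_space M p"
  proof (rule tangent_spaceI)
    fix f f' W assume *: "smooth_at M p f" "open W" "p \<in> W" "\<And>x. x \<in> W \<Longrightarrow> f x = f' x"
    then have "smooth_at M p f'" by (rule smooth_at_cong)
    then show "bracket M X Y p f = bracket M X Y p f'"
      using cong[OF X Y *(2-4)] cong[OF Y X *(2-4)] *(1) by (simp add: bracket_def)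
  next
    fix f and c :: real assume "smooth_at M p f"
    then show "bracket M X Y p (\<lambda>x. c * f x) = c * bracket M X Y p f"
      using scale[OF X Y] scale[OF Y X] smooth_at_mult[OF smooth_at_const[OF pc]]
      by (simp add: bracket_def algebra_simps)
  next
    fix f f' assume "smooth_at M p f" "smooth_at M p f'"
    then show "bracket M X Y p (\<lambda>x. f x * f' x) = f p * bracket M X Y p f' + f' p * bracket M X Y p f"
      using mult[OF X Y] mult[OF Y X] by (simp add: bracket_def smooth_at_mult algebra_simps)
  qed (auto simp: bracket_def smooth_at_add add[OF X Y] add[OF Y X])
next
  fix W f assume W: "open W \<and> W \<subseteq> U \<and> smooth_fun M W f"
  have "smooth_fun M W (\<lambda>p. X p (\<lambda>q. Y q f) - Y p (\<lambda>q. X q f))"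
    using W by (intro smooth_fun_diff vfield_smooth[OF X] vfield_smooth[OF Y]) auto
  then show "smooth_fun M W (\<lambda>p. bracket M X Y p f)"
  proof (rule smooth_fun_cong[rotated])
    fix p assume "p \<in> W"
    then have "smooth_at M p f" using W U by (intro smooth_atI[of W]) auto
    then show "X p (\<lambda>q. Y q f) - Y p (\<lambda>q. X q f) = bracket M X Y p f" by (simp add: bracket_def)
  qed (use W in auto)
qed

end

context smooth_mfd
begin

text \<open>Vector fields are the sections along the identity, so the Levi-Civita connection is an instance of a
  connection along a map and shares its theory with the pull-back connection.\<close>

lemma section_id:
  assumes "open U" "U \<subseteq> carrier M"
  shows "section_along M U M id = vfield M U"
proof (intro ext iffI)
  fix X assume X: "section_along M U M id X"
  show "vfield M U X"
    unfolding vfield_def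
  proof (intro conjI allI impI ballI)
    fix W f assume W: "open W \<and> W \<subseteq> U \<and> smooth_fun M W f"
    then have "smooth_fun M (U \<inter> id -` W) (\<lambda>p. X p f)"
      using X assms unfolding section_along_def by blast
    moreover have "U \<inter> id -` W = W" using W by auto
    ultimately show "smooth_fun M W (\<lambda>p. X p f)" by simp
  qed (use X in \<open>auto simp: section_along_def\<close>)
next
  fix X assume X: "vfield M U X"
  show "section_along M U M id X"
    unfolding section_along_def
  proof (intro conjI allI impI ballI)
    fix W f assume W: "open W \<and> W \<subseteq> carrier M \<and> smooth_fun M W f"
    show "smooth_fun M (U \<inter> id -` W) (\<lambda>p. X p f)"
      using W assms by (intro vfield_smooth[OF X]) (auto elim: smooth_fun_subset)
  qed (use X in \<open>auto dest: vfieldD\<close>)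
qed

lemma tv_minus: "v \<in> tangent_space M p \<Longrightarrow> smooth_at M p f \<Longrightarrow> v (\<lambda>x. - f x) = - v f"
  using tv_scale[of v p f "-1"] by simp

lemma tv_sum:
  assumes "v \<in> tangent_space M p" "p \<in> carrier M" "\<And>i. i \<in> I \<Longrightarrow> smooth_at M p (f i)"
  shows "v (\<lambda>x. \<Sum>i\<in>I. f i x) = (\<Sum>i\<in>I. v (f i))"
proof -
  have "smooth_at M p (\<lambda>x. \<Sum>i\<in>I. f i x) \<and> v (\<lambda>x. \<Sum>i\<in>I. f i x) = (\<Sum>i\<in>I. v (f i))"
    using assms(3)
    by (induction I rule: infinite_finite_induct)
      (auto simp: smooth_at_const[OF assms(2)] tv_const[OF assms(1,2)] tv_add[OF assms(1)] intro!: smooth_at_add)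
  then show ?thesis by simp
qed

lemma vfield_scale_const: "vfield M U X \<Longrightarrow> vfield M U (\<lambda>p f. c * X p f)"
  using vfield_scale[OF smooth_fun_const] by blast

lemma bracket_swap: "bracket M Y X p = (\<lambda>f. (-1) * bracket M X Y p f)"
  by (auto simp: bracket_def fun_eq_iff)

lemma bracket_add:
  assumes "open U" "U \<subseteq> carrier M" "vfield M U X" "vfield M U Y" "vfield M U Z" "p \<in> U"
  shows "bracket M (\<lambda>q h. X q h + Y q h) Z p = (\<lambda>f. bracket M X Z p f + bracket M Y Z p f)"
proof
  fix f
  show "bracket M (\<lambda>q h. X q h + Y q h) Z p f = bracket M X Z p f + bracket M Y Z p f"
    using tv_add[OF vfieldD[OF assms(5,6)] smooth_at_vfield[OF assms(1,3,6)] smooth_at_vfield[OF assms(1,4,6)], of f f]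
    by (simp add: bracket_def)
qed

lemma bracket_scale:
  assumes "open U" "U \<subseteq> carrier M" "vfield M U X" "vfield M U Z" "smooth_fun M U c" "p \<in> U"
  shows "bracket M (\<lambda>q h. c q * X q h) Z p = (\<lambda>f. c p * bracket M X Z p f + (- Z p c) * X p f)"
proof
  fix f
  show "bracket M (\<lambda>q h. c q * X q h) Z p f = c p * bracket M X Z p f + (- Z p c) * X p f"
    using tv_mult[OF vfieldD[OF assms(4,6)] smooth_atI[OF assms(1,6,2,5)] smooth_at_vfield[OF assms(1,3,6)], of f]
      tv_nonsmooth[OF vfieldD[OF assms(3,6)]]
    by (auto simp: bracket_def algebra_simps)
qed

end

section \<open>Metrics, orthonormal frames and tensoriality\<close>

locale pseudo_riem = smooth_mfd M
  for M :: "('m::{t2_space,second_countable_topology}, 'e::euclidean_space) atlas" +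
  fixes g :: "'m metric" and r :: nat
  assumes metric: "pseudo_riemannian M g r"
begin

lemma metric_pointwise:
  "\<forall>p\<in>carrier M. \<forall>u\<in>tangent_space M p. \<forall>v\<in>tangent_space M p. \<forall>w\<in>tangent_space M p. \<forall>a b.
        g p u v = g p v u \<and>
        g p (\<lambda>f. a * u f + b * v f) w = a * g p u w + b * g p v w"
  using metric unfolding pseudo_riemannian_def by (elim conjE)

lemma metric_sym: "p \<in> carrier M \<Longrightarrow> u \<in> tangent_space M p \<Longrightarrow> v \<in> tangent_space M p \<Longrightarrow> g p u v = g p v u"
  using metric_pointwise[THEN bspec, THEN bspec, THEN bspec, THEN bspec, THEN spec, THEN spec, THEN conjunct1] .

lemma metric_lin: "p \<in> carrier M \<Longrightarrow> u \<in> tangent_space M p \<Longrightarrow> v \<in> tangent_space M p \<Longrightarrow> w \<in> tangent_space M p \<Longrightarrow>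
    g p (\<lambda>f. a * u f + b * v f) w = a * g p u w + b * g p v w"
  using metric_pointwise[THEN bspec, THEN bspec, THEN bspec, THEN bspec, THEN spec, THEN spec, THEN conjunct2] .

lemma metric_add: "p \<in> carrier M \<Longrightarrow> u \<in> tangent_space M p \<Longrightarrow> v \<in> tangent_space M p \<Longrightarrow> w \<in> tangent_space M p \<Longrightarrow>
    g p (\<lambda>f. u f + v f) w = g p u w + g p v w"
  using metric_lin[of p u v w 1 1] by simp

lemma metric_scale: "p \<in> carrier M \<Longrightarrow> u \<in> tangent_space M p \<Longrightarrow> w \<in> tangent_space M p \<Longrightarrow>
    g p (\<lambda>f. a * u f) w = a * g p u w"
  using metric_lin[of p u u w a 0] by simp

lemma metric_zero: "p \<in> carrier M \<Longrightarrow> w \<in> tangent_space M p \<Longrightarrow> g p (\<lambda>f. 0) w = 0"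
  using metric_scale[of p w w 0] by simp

lemma metric_diff: "p \<in> carrier M \<Longrightarrow> u \<in> tangent_space M p \<Longrightarrow> v \<in> tangent_space M p \<Longrightarrow> w \<in> tangent_space M p \<Longrightarrow>
    g p (\<lambda>f. u f - v f) w = g p u w - g p v w"
  using metric_lin[of p u v w 1 "-1"] by simp

lemma metric_sum:
  assumes "p \<in> carrier M" "w \<in> tangent_space M p" "\<And>i. i \<in> I \<Longrightarrow> v i \<in> tangent_space M p"
  shows "g p (\<lambda>f. \<Sum>i\<in>I. c i * v i f) w = (\<Sum>i\<in>I. c i * g p (v i) w)"
  using assms(3)
proof (induction I rule: infinite_finite_induct)
  case (insert i I)
  have "g p (\<lambda>f. \<Sum>i\<in>insert i I. c i * v i f) w = g p (\<lambda>f. c i * v i f + (\<Sum>i\<in>I. c i * v i f)) w"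
    using insert by simp
  also have "\<dots> = c i * g p (v i) w + g p (\<lambda>f. \<Sum>i\<in>I. c i * v i f) w"
    using insert assms by (subst metric_add) (auto intro!: tangent_scale tangent_sum simp: metric_scale)
  finally show ?case using insert by simp
qed (auto simp: assms metric_zero)

lemma metric_smooth: "open U \<Longrightarrow> U \<subseteq> carrier M \<Longrightarrow> vfield M U X \<Longrightarrow> vfield M U Y \<Longrightarrow>
    smooth_fun M U (\<lambda>p. g p (X p) (Y p))"
  using metric unfolding pseudo_riemannian_def by (elim conjE) simp

end

locale framed = pseudo_riem M g r
  for M :: "('m::{t2_space,second_countable_topology}, 'e::euclidean_space) atlas" and g r +
  fixes U :: "'m set" and e :: "nat \<Rightarrow> 'm \<Rightarrow> 'm tvec"
  assumes dom_open: "open U" and dom_carrier: "U \<subseteq> carrier M"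
    and frame: "orthonormal_frame M g U e"
begin

definition sign :: "nat \<Rightarrow> 'm \<Rightarrow> real" where
  "sign i p = g p (e i p) (e i p)"

definition coord :: "'m \<Rightarrow> 'm tvec \<Rightarrow> nat \<Rightarrow> real" where
  "coord p v i = sign i p * g p v (e i p)"

lemma in_carrier: "p \<in> U \<Longrightarrow> p \<in> carrier M"
  using dom_carrier by auto

lemma frame_vfield: "i \<in> {1..DIM('e)} \<Longrightarrow> vfield M U (e i)"
  using frame by (simp add: orthonormal_frame_def)

lemma frame_tangent: "i \<in> {1..DIM('e)} \<Longrightarrow> p \<in> U \<Longrightarrow> e i p \<in> tangent_space M p"
  using frame_vfield vfieldD by blast

lemma frame_orthogonal: "p \<in> U \<Longrightarrow> i \<in> {1..DIM('e)} \<Longrightarrow> j \<in> {1..DIM('e)} \<Longrightarrow> i \<noteq> j \<Longrightarrow> g p (e i p) (e j p) = 0"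
  using frame unfolding orthonormal_frame_def by blast

lemma sgn_cases: "p \<in> U \<Longrightarrow> i \<in> {1..DIM('e)} \<Longrightarrow> sign i p = 1 \<or> sign i p = -1"
  using frame unfolding orthonormal_frame_def sign_def by blast

lemma sgn_square: "p \<in> U \<Longrightarrow> i \<in> {1..DIM('e)} \<Longrightarrow> sign i p * sign i p = 1"
  using sgn_cases by fastforce

lemma sgn_smooth: "i \<in> {1..DIM('e)} \<Longrightarrow> smooth_fun M U (sign i)"
  unfolding sign_def using metric_smooth[OF dom_open dom_carrier frame_vfield frame_vfield] by simp

lemma smooth_at_U: "smooth_fun M U f \<Longrightarrow> p \<in> U \<Longrightarrow> smooth_at M p f"
  using smooth_atI[OF dom_open _ dom_carrier] by blast

text \<open>The signs \<open>g(e\<^sub>i, e\<^sub>i)\<close> are locally constant: differentiate \<open>g(e\<^sub>i, e\<^sub>i)\<^sup>2 = 1\<close>. They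
  may differ between components of the domain, so they are kept as functions.\<close>

lemma tangent_sgn:
  assumes "p \<in> U" "i \<in> {1..DIM('e)}" "v \<in> tangent_space M p"
  shows "v (sign i) = 0"
proof -
  note s = smooth_at_U[OF sgn_smooth[OF assms(2)] assms(1)]
  have "v (\<lambda>q. sign i q * sign i q) = v (\<lambda>q. 1)"
    by (rule tv_cong[OF assms(3) dom_open assms(1)]) (use sgn_square assms in auto)
  then have "2 * (sign i p * v (sign i)) = 0"
    using tv_mult[OF assms(3) s s] tv_const[OF assms(3)] assms(1) in_carrier by simp
  then show ?thesis using sgn_square[OF assms(1,2)] by auto
qed

lemma frame_expand:
  assumes "p \<in> U" "v \<in> tangent_space M p"
  shows "v = (\<lambda>f. \<Sum>i=1..DIM('e). coord p v i * e i p f)"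
proof -
  obtain c where c: "v = (\<lambda>f. \<Sum>i=1..DIM('e). c i * e i p f)"
    using frame assms unfolding orthonormal_frame_def by blast
  have "coord p v j = c j" if j: "j \<in> {1..DIM('e)}" for j
  proof -
    have "g p v (e j p) = (\<Sum>i=1..DIM('e). c i * g p (e i p) (e j p))"
      unfolding c using assms j by (intro metric_sum in_carrier frame_tangent) auto
    also have "\<dots> = (\<Sum>i=1..DIM('e). if i = j then c j * sign j p else 0)"
      using frame_orthogonal[OF assms(1) _ j] by (intro sum.cong) (auto simp: sign_def)
    finally show ?thesis using sgn_square[OF assms(1) j] j by (simp add: coord_def mult.left_commute)
  qed
  then show ?thesis using c by simp
qed

lemma coord_smooth: "vfield M U X \<Longrightarrow> i \<in> {1..DIM('e)} \<Longrightarrow> smooth_fun M U (\<lambda>p. coord p (X p) i)"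
  unfolding coord_def
  by (intro smooth_fun_mult dom_open sgn_smooth metric_smooth dom_carrier frame_vfield)

lemma coord_add: "p \<in> U \<Longrightarrow> u \<in> tangent_space M p \<Longrightarrow> v \<in> tangent_space M p \<Longrightarrow> i \<in> {1..DIM('e)} \<Longrightarrow>
    coord p (\<lambda>f. u f + v f) i = coord p u i + coord p v i"
  by (simp add: coord_def metric_add in_carrier frame_tangent algebra_simps)

lemma coord_scale: "p \<in> U \<Longrightarrow> u \<in> tangent_space M p \<Longrightarrow> i \<in> {1..DIM('e)} \<Longrightarrow>
    coord p (\<lambda>f. c * u f) i = c * coord p u i"
  by (simp add: coord_def metric_scale in_carrier frame_tangent algebra_simps)

lemma metric_expand:
  assumes "p \<in> U" "u \<in> tangent_space M p" "v \<in> tangent_space M p"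
  shows "g p u v = (\<Sum>i=1..DIM('e). sign i p * (g p u (e i p) * g p v (e i p)))"
proof -
  have "g p u v = g p (\<lambda>f. \<Sum>i=1..DIM('e). coord p u i * e i p f) v"
    using frame_expand[OF assms(1,2)] by simp
  also have "\<dots> = (\<Sum>i=1..DIM('e). coord p u i * g p (e i p) v)"
    using assms by (intro metric_sum in_carrier frame_tangent) auto
  also have "\<dots> = (\<Sum>i=1..DIM('e). sign i p * (g p u (e i p) * g p v (e i p)))"
    using assms by (intro sum.cong) (auto simp: coord_def metric_sym[of p v] in_carrier frame_tangent)
  finally show ?thesis .
qed

lemma tangent_eqI:
  assumes "p \<in> U" "u \<in> tangent_space M p" "v \<in> tangent_space M p"
    and "\<And>i. i \<in> {1..DIM('e)} \<Longrightarrow> g p u (e i p) = g p v (e i p)"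
  shows "u = v"
proof -
  have "coord p u i = coord p v i" if "i \<in> {1..DIM('e)}" for i using assms(4) that by (simp add: coord_def)
  then show ?thesis using frame_expand[OF assms(1,2)] frame_expand[OF assms(1,3)] by simp
qed

text \<open>\<open>C\<^sup>\<infinity>\<close>-linearity of a functional of vector fields. Its value at a point then depends only on the value
  of the field there.\<close>

definition tensorial :: "(('m \<Rightarrow> 'm tvec) \<Rightarrow> 'm \<Rightarrow> real) \<Rightarrow> bool" where
  "tensorial L \<longleftrightarrow> (\<forall>X Y f p. vfield M U X \<and> vfield M U Y \<and> smooth_fun M U f \<and> p \<in> U \<longrightarrow>
     L (\<lambda>q h. X q h + Y q h) p = L X p + L Y p \<and> L (\<lambda>q h. f q * X q h) p = f p * L X p)"

lemma tensorial_add: "tensorial L \<Longrightarrow> vfield M U X \<Longrightarrow> vfield M U Y \<Longrightarrow> p \<in> U \<Longrightarrow>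
    L (\<lambda>q h. X q h + Y q h) p = L X p + L Y p"
  unfolding tensorial_def using smooth_fun_const[of U 0] by simp

lemma tensorial_scale: "tensorial L \<Longrightarrow> vfield M U X \<Longrightarrow> smooth_fun M U f \<Longrightarrow> p \<in> U \<Longrightarrow>
    L (\<lambda>q h. f q * X q h) p = f p * L X p"
  unfolding tensorial_def by presburger

lemma indicator_smooth: "smooth_fun M U (\<lambda>p. if p \<in> U then 1 else 0)"
  by (rule smooth_fun_cong[OF dom_open smooth_fun_const[of _ 1]]) auto

text \<open>Two fields that agree on \<open>U\<close> may differ as functions outside of it. Multiplying both by the
  function that is \<open>1\<close> on \<open>U\<close> and \<open>0\<close> elsewhere makes them equal.\<close>

lemma tensorial_cong:
  assumes "tensorial L" "vfield M U X" "vfield M U Y" "\<And>q. q \<in> U \<Longrightarrow> X q = Y q" "p \<in> U"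
  shows "L X p = L Y p"
proof -
  let ?f = "\<lambda>q. if q \<in> U then 1 else (0::real)"
  have "L X p = L (\<lambda>q h. ?f q * X q h) p"
    using tensorial_scale[OF assms(1) _ indicator_smooth assms(5)] assms by simp
  also have "(\<lambda>q h. ?f q * X q h) = (\<lambda>q h. ?f q * Y q h)" using assms(4) by auto
  also have "L \<dots> p = L Y p"
    using tensorial_scale[OF assms(1) _ indicator_smooth assms(5)] assms by simp
  finally show ?thesis .
qed

lemma tensorial_zero:
  assumes "tensorial L" "p \<in> U"
  shows "L (\<lambda>q h. 0) p = 0"
proof -
  show ?thesis
    using tensorial_scale[OF assms(1) vfield_zero smooth_fun_const assms(2), of 0] by simp
qed

lemma tensorial_sum:
  assumes "tensorial L" "p \<in> U"
    "\<And>i. i \<in> I \<Longrightarrow> smooth_fun M U (c i)" "\<And>i. i \<in> I \<Longrightarrow> vfield M U (X i)"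
  shows "L (\<lambda>q h. \<Sum>i\<in>I. c i q * X i q h) p = (\<Sum>i\<in>I. c i p * L (X i) p)"
  using assms(3,4)
proof (induction I rule: infinite_finite_induct)
  case (insert i I)
  have "L (\<lambda>q h. (\<lambda>q h. c i q * X i q h) q h + (\<lambda>q h. \<Sum>i\<in>I. c i q * X i q h) q h) p
      = L (\<lambda>q h. c i q * X i q h) p + L (\<lambda>q h. \<Sum>i\<in>I. c i q * X i q h) p"
    using insert.prems by (intro tensorial_add assms(1,2) vfield_scale vfield_sum) auto
  moreover have "L (\<lambda>q h. c i q * X i q h) p = c i p * L (X i) p"
    using insert.prems by (intro tensorial_scale assms(1,2)) auto
  ultimately show ?case using insert by simp
qed (auto simp: tensorial_zero[OF assms(1,2)])

lemma tensorial_expand: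
  assumes "tensorial L" "vfield M U X" "p \<in> U"
  shows "L X p = (\<Sum>i=1..DIM('e). coord p (X p) i * L (e i) p)"
proof -
  have v: "vfield M U (\<lambda>q h. \<Sum>i=1..DIM('e). coord q (X q) i * e i q h)"
    by (intro vfield_sum coord_smooth assms frame_vfield)
  have "L X p = L (\<lambda>q h. \<Sum>i=1..DIM('e). coord q (X q) i * e i q h) p"
    by (rule tensorial_cong[OF assms(1,2) v]) (use assms frame_expand vfieldD in auto)
  also have "\<dots> = (\<Sum>i=1..DIM('e). coord p (X p) i * L (e i) p)"
    by (rule tensorial_sum[OF assms(1,3)]) (use assms coord_smooth frame_vfield in auto)
  finally show ?thesis .
qed

text \<open>Expand \<open>e'\<^sub>i = (\<Sum>j. a\<^sub>i\<^sub>j e\<^sub>j)\<close> with \<open>a\<^sub>i\<^sub>j = g(e\<^sub>j, e\<^sub>j) g(e'\<^sub>i, e\<^sub>j)\<close>. The sums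
  \<open>\<Sum>i. g(e'\<^sub>i, e'\<^sub>i) a\<^sub>i\<^sub>j a\<^sub>i\<^sub>k\<close> are, up to signs, the expansion of \<open>g(e\<^sub>j, e\<^sub>k)\<close> in the frame
  \<open>e'\<close>, hence vanish off the diagonal.\<close>

lemma trace_frame_independent:
  assumes H1: "\<And>Y. vfield M U Y \<Longrightarrow> tensorial (\<lambda>X. H X Y)"
    and H2: "\<And>X. vfield M U X \<Longrightarrow> tensorial (H X)"
    and e': "orthonormal_frame M g U e'" and p: "p \<in> U"
  shows "(\<Sum>i=1..DIM('e). g p (e' i p) (e' i p) * H (e' i) (e' i) p)
       = (\<Sum>j=1..DIM('e). sign j p * H (e j) (e j) p)"
proof -
  interpret F: framed M g r U e'
    by unfold_locales (use dom_open dom_carrier e' in auto)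
  let ?a = "\<lambda>i j. coord p (e' i p) j"
  have "H (e' i) (e' i) p = (\<Sum>j=1..DIM('e). \<Sum>k=1..DIM('e). ?a i j * ?a i k * H (e j) (e k) p)" if i: "i \<in> {1..DIM('e)}" for i
  proof -
    note vi = F.frame_vfield[OF i]
    have "H (e' i) (e' i) p = (\<Sum>j=1..DIM('e). ?a i j * H (e j) (e' i) p)"
      by (rule tensorial_expand[OF H1[OF vi] vi p])
    also have "\<dots> = (\<Sum>j=1..DIM('e). ?a i j * (\<Sum>k=1..DIM('e). ?a i k * H (e j) (e k) p))"
      by (intro sum.cong refl arg_cong2[of _ _ _ _ "(*)"] tensorial_expand H2 frame_vfield vi p) auto
    finally show ?thesis by (simp add: sum_distrib_left mult.assoc)
  qed
  then have "(\<Sum>i=1..DIM('e). F.sign i p * H (e' i) (e' i) p)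
      = (\<Sum>i=1..DIM('e). \<Sum>j=1..DIM('e). \<Sum>k=1..DIM('e). F.sign i p * (?a i j * ?a i k) * H (e j) (e k) p)"
    by (simp add: sum_distrib_left mult.assoc)
  also have "\<dots> = (\<Sum>j=1..DIM('e). \<Sum>i=1..DIM('e). \<Sum>k=1..DIM('e). F.sign i p * (?a i j * ?a i k) * H (e j) (e k) p)"
    by (rule sum.swap)
  also have "\<dots> = (\<Sum>j=1..DIM('e). \<Sum>k=1..DIM('e). \<Sum>i=1..DIM('e). F.sign i p * (?a i j * ?a i k) * H (e j) (e k) p)"
    by (intro sum.cong refl sum.swap)
  also have "\<dots> = (\<Sum>j=1..DIM('e). \<Sum>k=1..DIM('e). (\<Sum>i=1..DIM('e). F.sign i p * (?a i j * ?a i k)) * H (e j) (e k) p)"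
    by (simp add: sum_distrib_right)
  also have "\<dots> = (\<Sum>j=1..DIM('e). \<Sum>k=1..DIM('e). (if k = j then sign j p * H (e j) (e j) p else 0))"
  proof (intro sum.cong refl)
    fix j k assume jk: "j \<in> {1..DIM('e)}" "k \<in> {1..DIM('e)}"
    have "(\<Sum>i=1..DIM('e). F.sign i p * (?a i j * ?a i k))
        = sign j p * sign k p * (\<Sum>i=1..DIM('e). F.sign i p * (g p (e j p) (e' i p) * g p (e k p) (e' i p)))"
      unfolding sum_distrib_left using jk p
      by (intro sum.cong) (auto simp: coord_def metric_sym[of p "e j p"] metric_sym[of p "e k p"]
          in_carrier frame_tangent F.frame_tangent)
    also have "\<dots> = sign j p * sign k p * g p (e j p) (e k p)"
      using F.metric_expand[OF p frame_tangent[OF jk(1) p] frame_tangent[OF jk(2) p]] by simp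
    also have "\<dots> = (if k = j then sign j p else 0)"
      using frame_orthogonal[OF p jk] sgn_square[OF p jk(1)] by (auto simp: sign_def)
    finally show "(\<Sum>i=1..DIM('e). F.sign i p * (?a i j * ?a i k)) * H (e j) (e k) p
        = (if k = j then sign j p * H (e j) (e j) p else 0)" by simp
  qed
  also have "\<dots> = (\<Sum>j=1..DIM('e). sign j p * H (e j) (e j) p)" by simp
  finally show ?thesis by (simp add: F.sign_def)
qed

end

section \<open>Connections on sections along a map\<close>

locale map_along = src: smooth_mfd M + tgt: pseudo_riem B h s
  for M :: "('m::{t2_space,second_countable_topology}, 'e::euclidean_space) atlas"
    and B :: "('b::{t2_space,second_countable_topology}, 'k::euclidean_space) atlas"
    and h s +
  fixes U :: "'m set" and \<phi> :: "'m \<Rightarrow> 'b"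
  assumes dom_open: "open U" and dom_carrier: "U \<subseteq> carrier M"
    and into_carrier: "\<And>p. p \<in> U \<Longrightarrow> \<phi> p \<in> carrier B"
    and preimage_open: "\<And>W. open W \<Longrightarrow> open (U \<inter> \<phi> -` W)"
begin

abbreviation sect :: "('m \<Rightarrow> 'b tvec) \<Rightarrow> bool" where "sect \<equiv> section_along M U B \<phi>"

lemma in_carrier: "p \<in> U \<Longrightarrow> p \<in> carrier M"
  using dom_carrier by auto

lemma sectD: "sect S \<Longrightarrow> p \<in> U \<Longrightarrow> S p \<in> tangent_space B (\<phi> p)"
  by (simp add: section_along_def)

lemma sect_smooth: "sect S \<Longrightarrow> open W \<Longrightarrow> W \<subseteq> carrier B \<Longrightarrow> smooth_fun B W f \<Longrightarrow>
    smooth_fun M (U \<inter> \<phi> -` W) (\<lambda>p. S p f)"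
  by (simp add: section_along_def)

lemma sect_cong:
  assumes "sect S" "\<And>p. p \<in> U \<Longrightarrow> S p = T p"
  shows "sect T"
  unfolding section_along_def
proof (intro conjI allI impI ballI)
  fix W f assume W: "open W \<and> W \<subseteq> carrier B \<and> smooth_fun B W f"
  show "smooth_fun M (U \<inter> \<phi> -` W) (\<lambda>p. T p f)"
    by (rule src.smooth_fun_cong[of _ "\<lambda>p. S p f"])
      (use W assms sect_smooth preimage_open in auto)
qed (use assms sectD in metis)

lemma sect_add: "sect S \<Longrightarrow> sect T \<Longrightarrow> sect (\<lambda>p f. S p f + T p f)"
  unfolding section_along_def
  by (auto intro: tgt.tangent_add src.smooth_fun_add preimage_open)

lemma sect_scale: "smooth_fun M U c \<Longrightarrow> sect S \<Longrightarrow> sect (\<lambda>p f. c p * S p f)"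
  unfolding section_along_def
  by (auto intro!: tgt.tangent_scale src.smooth_fun_mult preimage_open elim: src.smooth_fun_subset)

lemma sect_zero: "sect (\<lambda>p f. 0)"
  unfolding section_along_def by (auto intro: tgt.tangent_zero src.smooth_fun_const)

lemma sect_sum:
  "(\<And>i. i \<in> I \<Longrightarrow> smooth_fun M U (c i)) \<Longrightarrow> (\<And>i. i \<in> I \<Longrightarrow> sect (S i)) \<Longrightarrow>
    sect (\<lambda>p f. \<Sum>i\<in>I. c i p * S i p f)"
  by (induction I rule: infinite_finite_induct) (auto simp: sect_zero intro!: sect_add sect_scale)

end

text \<open>The algebraic axioms that the Levi-Civita connection (\<open>\<phi> = id\<close>) and the pull-back connection have in
  common.\<close>

definition linear_connection ::
  "('m::topological_space, 'e::euclidean_space) atlas \<Rightarrow> 'm set \<Rightarrow>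
   ('b::topological_space, 'k::euclidean_space) atlas \<Rightarrow> ('m \<Rightarrow> 'b) \<Rightarrow>
   (('m \<Rightarrow> 'm tvec) \<Rightarrow> ('m \<Rightarrow> 'b tvec) \<Rightarrow> 'm \<Rightarrow> 'b tvec) \<Rightarrow> bool" where
  "linear_connection M U B \<phi> D \<longleftrightarrow>
     (\<forall>X Y S T f. vfield M U X \<and> vfield M U Y \<and> section_along M U B \<phi> S \<and> section_along M U B \<phi> T \<and>
        smooth_fun M U f \<longrightarrow>
        section_along M U B \<phi> (D X S) \<and>
        (\<forall>p\<in>U.
           D (\<lambda>q k. X q k + Y q k) S p = (\<lambda>k. D X S p k + D Y S p k) \<and>
           D (\<lambda>q k. f q * X q k) S p = (\<lambda>k. f p * D X S p k) \<and>
           D X (\<lambda>q k. S q k + T q k) p = (\<lambda>k. D X S p k + D X T p k) \<and>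
           D X (\<lambda>q k. f q * S q k) p = (\<lambda>k. X p f * S p k + f p * D X S p k)))"

locale connection = map_along M B h s U \<phi>
  for M :: "('m::{t2_space,second_countable_topology}, 'e::euclidean_space) atlas"
    and B :: "('b::{t2_space,second_countable_topology}, 'k::euclidean_space) atlas"
    and h s U \<phi> +
  fixes D :: "('m \<Rightarrow> 'm tvec) \<Rightarrow> ('m \<Rightarrow> 'b tvec) \<Rightarrow> 'm \<Rightarrow> 'b tvec"
  assumes lin: "linear_connection M U B \<phi> D"
begin

lemma conn_sect: "vfield M U X \<Longrightarrow> sect S \<Longrightarrow> sect (D X S)"
  using lin src.smooth_fun_const unfolding linear_connection_def by blast

lemma conn_add_X: "vfield M U X \<Longrightarrow> vfield M U Y \<Longrightarrow> sect S \<Longrightarrow> p \<in> U \<Longrightarrow>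
    D (\<lambda>q k. X q k + Y q k) S p = (\<lambda>k. D X S p k + D Y S p k)"
  using lin src.smooth_fun_const unfolding linear_connection_def by blast

lemma conn_scale_X: "vfield M U X \<Longrightarrow> sect S \<Longrightarrow> smooth_fun M U f \<Longrightarrow> p \<in> U \<Longrightarrow>
    D (\<lambda>q k. f q * X q k) S p = (\<lambda>k. f p * D X S p k)"
  using lin unfolding linear_connection_def by blast

lemma conn_add_S: "vfield M U X \<Longrightarrow> sect S \<Longrightarrow> sect T \<Longrightarrow> p \<in> U \<Longrightarrow>
    D X (\<lambda>q k. S q k + T q k) p = (\<lambda>k. D X S p k + D X T p k)"
  using lin src.smooth_fun_const unfolding linear_connection_def by blast

lemma conn_leibniz: "vfield M U X \<Longrightarrow> sect S \<Longrightarrow> smooth_fun M U f \<Longrightarrow> p \<in> U \<Longrightarrow>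
    D X (\<lambda>q k. f q * S q k) p = (\<lambda>k. X p f * S p k + f p * D X S p k)"
  using lin unfolding linear_connection_def by blast

lemma indicator_smooth: "smooth_fun M U (\<lambda>p. if p \<in> U then 1 else 0)"
  by (rule src.smooth_fun_cong[OF dom_open src.smooth_fun_const[of _ 1]]) auto

text \<open>As for tensors, multiplication by the indicator function of \<open>U\<close> removes the dependence on values
  outside of \<open>U\<close>; its derivative vanishes on \<open>U\<close>, so the Leibniz term does not contribute.\<close>

lemma conn_cong:
  assumes X: "vfield M U X" "vfield M U X'" "\<And>q. q \<in> U \<Longrightarrow> X q = X' q"
    and S: "sect S" "sect S'" "\<And>q. q \<in> U \<Longrightarrow> S q = S' q" and p: "p \<in> U"
  shows "D X S p = D X' S' p"
proof -
  let ?f = "\<lambda>q. if q \<in> U then 1 else (0::real)"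
  note f = indicator_smooth
  have Xf: "Y p ?f = 0" if "vfield M U Y" for Y
    using src.tv_cong[OF src.vfieldD[OF that p] dom_open p, of ?f "\<lambda>q. 1"]
      src.tv_const[OF src.vfieldD[OF that p]] in_carrier[OF p] by auto
  have "D X S p = D (\<lambda>q k. ?f q * X q k) S p"
    using conn_scale_X[OF X(1) S(1) f p] p by simp
  also have "(\<lambda>q k. ?f q * X q k) = (\<lambda>q k. ?f q * X' q k)" using X(3) by auto
  also have "D \<dots> S p = D X' S p"
    using conn_scale_X[OF X(2) S(1) f p] p by simp
  also have "\<dots> = D X' (\<lambda>q k. ?f q * S q k) p"
    using conn_leibniz[OF X(2) S(1) f p] p Xf[OF X(2)] by simp
  also have "(\<lambda>q k. ?f q * S q k) = (\<lambda>q k. ?f q * S' q k)" using S(3) by auto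
  also have "D X' \<dots> p = D X' S' p"
    using conn_leibniz[OF X(2) S(2) f p] p Xf[OF X(2)] by simp
  finally show ?thesis .
qed

lemma conn_zero_X: "sect S \<Longrightarrow> p \<in> U \<Longrightarrow> D (\<lambda>q k. 0) S p = (\<lambda>k. 0)"
  using conn_scale_X[OF src.vfield_zero, of S "\<lambda>q. 0" p] src.smooth_fun_const by simp

lemma conn_zero_S: "vfield M U X \<Longrightarrow> p \<in> U \<Longrightarrow> D X (\<lambda>q k. 0) p = (\<lambda>k. 0)"
  using conn_leibniz[OF _ sect_zero, of X "\<lambda>q. 0" p] src.smooth_fun_const by simp

lemma conn_sum_S:
  assumes "vfield M U X" "p \<in> U"
    "\<And>i. i \<in> I \<Longrightarrow> smooth_fun M U (c i)" "\<And>i. i \<in> I \<Longrightarrow> sect (S i)"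
  shows "D X (\<lambda>q k. \<Sum>i\<in>I. c i q * S i q k) p = (\<lambda>k. \<Sum>i\<in>I. X p (c i) * S i p k + c i p * D X (S i) p k)"
  using assms(3,4)
proof (induction I rule: infinite_finite_induct)
  case (insert i I)
  have "D X (\<lambda>q k. (\<lambda>q k. c i q * S i q k) q k + (\<lambda>q k. \<Sum>i\<in>I. c i q * S i q k) q k) p
      = (\<lambda>k. D X (\<lambda>q k. c i q * S i q k) p k + D X (\<lambda>q k. \<Sum>i\<in>I. c i q * S i q k) p k)"
    using insert.prems by (intro conn_add_S assms(1,2) sect_scale sect_sum) auto
  then show ?case using insert conn_leibniz[OF assms(1) _ _ assms(2), of "S i" "c i"] by simp
qed (auto simp: conn_zero_S[OF assms(1,2)])

end

context map_along
begin

text \<open>In a frame \<open>E\<close> along the map with coordinates \<open>cf\<close>, any matrix \<open>G\<close> of one-forms defines a connection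
  by \<open>D\<^sub>X E\<^sub>b = (\<Sum>a. G\<^sub>a\<^sub>b(X) E\<^sub>a)\<close> and the Leibniz rule. Both connections needed here are
  obtained in this way.\<close>

lemma linear_connection_from_coefficients:
  fixes J :: "nat set"
  assumes E: "\<And>a. a \<in> J \<Longrightarrow> sect (E a)"
    and cf_smooth: "\<And>S a. sect S \<Longrightarrow> a \<in> J \<Longrightarrow> smooth_fun M U (\<lambda>p. cf p (S p) a)"
    and cf_add: "\<And>p u v a. p \<in> U \<Longrightarrow> u \<in> tangent_space B (\<phi> p) \<Longrightarrow> v \<in> tangent_space B (\<phi> p) \<Longrightarrow> a \<in> J \<Longrightarrow>
        cf p (\<lambda>k. u k + v k) a = cf p u a + cf p v a"
    and cf_scale: "\<And>p u c a. p \<in> U \<Longrightarrow> u \<in> tangent_space B (\<phi> p) \<Longrightarrow> a \<in> J \<Longrightarrow>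
        cf p (\<lambda>k. c * u k) a = c * cf p u a"
    and expand: "\<And>p w. p \<in> U \<Longrightarrow> w \<in> tangent_space B (\<phi> p) \<Longrightarrow> w = (\<lambda>k. \<Sum>a\<in>J. cf p w a * E a p k)"
    and G_smooth: "\<And>X a b. vfield M U X \<Longrightarrow> a \<in> J \<Longrightarrow> b \<in> J \<Longrightarrow> smooth_fun M U (\<lambda>p. G a b p (X p))"
    and G_add: "\<And>p u v a b. p \<in> U \<Longrightarrow> u \<in> tangent_space M p \<Longrightarrow> v \<in> tangent_space M p \<Longrightarrow> a \<in> J \<Longrightarrow> b \<in> J \<Longrightarrow>
        G a b p (\<lambda>k. u k + v k) = G a b p u + G a b p v"
    and G_scale: "\<And>p u c a b. p \<in> U \<Longrightarrow> u \<in> tangent_space M p \<Longrightarrow> a \<in> J \<Longrightarrow> b \<in> J \<Longrightarrow>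
        G a b p (\<lambda>k. c * u k) = c * G a b p u"
  shows "linear_connection M U B \<phi>
    (\<lambda>X S p k. \<Sum>a\<in>J. (X p (\<lambda>q. cf q (S q) a) + (\<Sum>b\<in>J. cf p (S p) b * G a b p (X p))) * E a p k)"
  unfolding linear_connection_def
proof (intro allI impI conjI ballI; elim conjE)
  fix X Y S T f
  assume X: "vfield M U X" and Y: "vfield M U Y" and S: "sect S" and T: "sect T" and f: "smooth_fun M U f"
  show "sect (\<lambda>p k. \<Sum>a\<in>J. (X p (\<lambda>q. cf q (S q) a) + (\<Sum>b\<in>J. cf p (S p) b * G a b p (X p))) * E a p k)"
    by (intro sect_sum E src.smooth_fun_add src.smooth_fun_sum src.smooth_fun_mult dom_open order_refl
        src.vfield_smooth[OF X] cf_smooth S G_smooth X) auto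
  fix p assume p: "p \<in> U"
  note sm = src.smooth_atI[OF dom_open p dom_carrier cf_smooth]
  note Xp = src.vfieldD[OF X p]
  show "(\<lambda>k. \<Sum>a\<in>J. (X p (\<lambda>q. cf q (S q) a) + Y p (\<lambda>q. cf q (S q) a) +
            (\<Sum>b\<in>J. cf p (S p) b * G a b p (\<lambda>k. X p k + Y p k))) * E a p k) =
     (\<lambda>k. (\<Sum>a\<in>J. (X p (\<lambda>q. cf q (S q) a) + (\<Sum>b\<in>J. cf p (S p) b * G a b p (X p))) * E a p k) +
          (\<Sum>a\<in>J. (Y p (\<lambda>q. cf q (S q) a) + (\<Sum>b\<in>J. cf p (S p) b * G a b p (Y p))) * E a p k))"
    unfolding sum.distrib[symmetric]
    by (intro ext sum.cong refl) (simp add: G_add p src.vfieldD[OF X p] src.vfieldD[OF Y p] algebra_simps sum.distrib)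
  show "(\<lambda>k. \<Sum>a\<in>J. (f p * X p (\<lambda>q. cf q (S q) a) +
            (\<Sum>b\<in>J. cf p (S p) b * G a b p (\<lambda>k. f p * X p k))) * E a p k) =
     (\<lambda>k. f p * (\<Sum>a\<in>J. (X p (\<lambda>q. cf q (S q) a) + (\<Sum>b\<in>J. cf p (S p) b * G a b p (X p))) * E a p k))"
    unfolding sum_distrib_left
    by (intro ext sum.cong refl) (simp add: G_scale p src.vfieldD[OF X p] algebra_simps sum_distrib_left)
  have add: "X p (\<lambda>q. cf q (\<lambda>k. S q k + T q k) a) = X p (\<lambda>q. cf q (S q) a) + X p (\<lambda>q. cf q (T q) a)"
    if a: "a \<in> J" for a
  proof -
    have "X p (\<lambda>q. cf q (\<lambda>k. S q k + T q k) a) = X p (\<lambda>q. cf q (S q) a + cf q (T q) a)"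
      by (rule src.tv_cong[OF Xp dom_open p]) (use cf_add sectD S T a in auto)
    then show ?thesis using src.tv_add[OF Xp sm[OF S a] sm[OF T a]] by simp
  qed
  show "(\<lambda>k. \<Sum>a\<in>J. (X p (\<lambda>q. cf q (\<lambda>k. S q k + T q k) a) +
            (\<Sum>b\<in>J. cf p (\<lambda>k. S p k + T p k) b * G a b p (X p))) * E a p k) =
     (\<lambda>k. (\<Sum>a\<in>J. (X p (\<lambda>q. cf q (S q) a) + (\<Sum>b\<in>J. cf p (S p) b * G a b p (X p))) * E a p k) +
          (\<Sum>a\<in>J. (X p (\<lambda>q. cf q (T q) a) + (\<Sum>b\<in>J. cf p (T p) b * G a b p (X p))) * E a p k))"
    unfolding sum.distrib[symmetric]
    by (intro ext sum.cong refl) (simp add: cf_add p S T sectD algebra_simps sum.distrib add)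
  have leib: "X p (\<lambda>q. cf q (\<lambda>k. f q * S q k) a) = X p f * cf p (S p) a + f p * X p (\<lambda>q. cf q (S q) a)"
    if a: "a \<in> J" for a
  proof -
    have "X p (\<lambda>q. cf q (\<lambda>k. f q * S q k) a) = X p (\<lambda>q. f q * cf q (S q) a)"
      by (rule src.tv_cong[OF Xp dom_open p]) (use cf_scale sectD S a in auto)
    then show ?thesis
      using src.tv_mult[OF Xp src.smooth_atI[OF dom_open p dom_carrier f] sm[OF S a]] by simp
  qed
  have "(\<Sum>a\<in>J. (X p (\<lambda>q. cf q (\<lambda>k. f q * S q k) a) +
            (\<Sum>b\<in>J. cf p (\<lambda>k. f p * S p k) b * G a b p (X p))) * E a p k)
      = X p f * (\<Sum>a\<in>J. cf p (S p) a * E a p k) +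
          f p * (\<Sum>a\<in>J. (X p (\<lambda>q. cf q (S q) a) + (\<Sum>b\<in>J. cf p (S p) b * G a b p (X p))) * E a p k)" for k
    unfolding sum_distrib_left sum.distrib[symmetric]
    by (intro sum.cong refl) (simp add: cf_scale p S sectD algebra_simps sum_distrib_left leib)
  then show "(\<lambda>k. \<Sum>a\<in>J. (X p (\<lambda>q. cf q (\<lambda>k. f q * S q k) a) +
            (\<Sum>b\<in>J. cf p (\<lambda>k. f p * S p k) b * G a b p (X p))) * E a p k) =
     (\<lambda>k. X p f * S p k +
          f p * (\<Sum>a\<in>J. (X p (\<lambda>q. cf q (S q) a) + (\<Sum>b\<in>J. cf p (S p) b * G a b p (X p))) * E a p k))"
    using fun_cong[OF expand[OF p sectD[OF S p]]] by simp
qed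

end

section \<open>The Levi-Civita connection of a framed open set\<close>

context framed
begin

lemma identity_along: "map_along M M g r U id"
  by unfold_locales (use dom_open dom_carrier in \<open>auto intro: open_Int\<close>)

text \<open>Koszul's formula for \<open>g(\<nabla>\<^sub>i e\<^sub>j, e\<^sub>k)\<close>. The terms that differentiate \<open>g(e\<^sub>i, e\<^sub>j)\<close> are absent,
  because these functions are locally constant for an orthonormal frame.\<close>

definition christoffel :: "nat \<Rightarrow> nat \<Rightarrow> nat \<Rightarrow> 'm \<Rightarrow> real" where
  "christoffel i j k p = (g p (bracket M (e i) (e j) p) (e k p) - g p (bracket M (e j) (e k) p) (e i p)
      + g p (bracket M (e k) (e i) p) (e j p)) / 2"

definition frame_connection :: "('m \<Rightarrow> 'm tvec) \<Rightarrow> ('m \<Rightarrow> 'm tvec) \<Rightarrow> 'm \<Rightarrow> 'm tvec" where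
  "frame_connection X Y p f = (\<Sum>k=1..DIM('e). (X p (\<lambda>q. coord q (Y q) k) +
     (\<Sum>j=1..DIM('e). coord p (Y p) j *
       (sign k p * (\<Sum>i=1..DIM('e). coord p (X p) i * christoffel i j k p)))) * e k p f)"

lemma frame_bracket_vfield: "i \<in> {1..DIM('e)} \<Longrightarrow> j \<in> {1..DIM('e)} \<Longrightarrow> vfield M U (bracket M (e i) (e j))"
  by (intro vfield_bracket dom_open dom_carrier frame_vfield)

lemma christoffel_smooth:
  "i \<in> {1..DIM('e)} \<Longrightarrow> j \<in> {1..DIM('e)} \<Longrightarrow> k \<in> {1..DIM('e)} \<Longrightarrow> smooth_fun M U (christoffel i j k)"
  unfolding christoffel_def divide_inverse
  by (intro smooth_fun_mult smooth_fun_const smooth_fun_add smooth_fun_diff dom_open metric_smooth dom_carrier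
      frame_bracket_vfield frame_vfield)

lemma bracket_swap_metric:
  assumes "p \<in> U" "i \<in> {1..DIM('e)}" "j \<in> {1..DIM('e)}" "k \<in> {1..DIM('e)}"
  shows "g p (bracket M (e j) (e i) p) (e k p) = - g p (bracket M (e i) (e j) p) (e k p)"
  using metric_scale[OF in_carrier[OF assms(1)] vfieldD[OF frame_bracket_vfield[OF assms(2,3)] assms(1)]
      frame_tangent[OF assms(4,1)], of "-1"]
  by (subst bracket_swap) simp

text \<open>The infinitesimal form of compatibility with the metric; the next lemma is that of vanishing torsion.\<close>

lemma christoffel_skew:
  assumes "p \<in> U" "i \<in> {1..DIM('e)}" "j \<in> {1..DIM('e)}" "k \<in> {1..DIM('e)}"
  shows "christoffel i k j p = - christoffel i j k p"
  unfolding christoffel_def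
  using bracket_swap_metric[OF assms(1), of i k j] bracket_swap_metric[OF assms(1), of j k i]
    bracket_swap_metric[OF assms(1), of i j k] assms by (simp add: field_simps)

lemma christoffel_torsion:
  assumes "p \<in> U" "i \<in> {1..DIM('e)}" "j \<in> {1..DIM('e)}" "k \<in> {1..DIM('e)}"
  shows "christoffel i j k p - christoffel j i k p = g p (bracket M (e i) (e j) p) (e k p)"
  unfolding christoffel_def
  using bracket_swap_metric[OF assms(1), of i k j] bracket_swap_metric[OF assms(1), of j k i]
    bracket_swap_metric[OF assms(1), of i j k] assms by (simp add: field_simps)

lemma frame_connection_linear: "linear_connection M U M id frame_connection"
proof -
  interpret map_along M M g r U id by (rule identity_along)
  have s: "sect = vfield M U" by (rule section_id[OF dom_open dom_carrier])
  have "linear_connection M U M id (\<lambda>X S p k. \<Sum>a=1..DIM('e). (X p (\<lambda>q. coord q (S q) a) +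
      (\<Sum>b=1..DIM('e). coord p (S p) b * (\<lambda>a b p u. sign a p * (\<Sum>i=1..DIM('e). coord p u i * christoffel i b a p)) a b p (X p))) * e a p k)"
  proof (rule linear_connection_from_coefficients, goal_cases)
    case 6 then show ?case
      by (intro smooth_fun_mult smooth_fun_sum sgn_smooth coord_smooth christoffel_smooth dom_open)
  next
    case (5 p w) then show ?case using frame_expand[of p w] by simp
  qed (simp_all add: s frame_vfield coord_smooth coord_add coord_scale sum.distrib sum_distrib_left algebra_simps)
  then show ?thesis unfolding frame_connection_def[abs_def] by simp
qed

text \<open>Both fields are written in the frame. The derivatives of the coordinates give the first sum, the
  brackets of the frame fields the second one.\<close>

lemma bracket_expand:
  assumes X: "vfield M U X" and Y: "vfield M U Y" and p: "p \<in> U"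
  shows "bracket M X Y p = (\<lambda>f. (\<Sum>k=1..DIM('e). (X p (\<lambda>q. coord q (Y q) k) - Y p (\<lambda>q. coord q (X q) k)) * e k p f)
     + (\<Sum>i=1..DIM('e). coord p (X p) i * (\<Sum>j=1..DIM('e). coord p (Y p) j * bracket M (e i) (e j) p f)))"
proof
  fix f
  show "bracket M X Y p f = (\<Sum>k=1..DIM('e). (X p (\<lambda>q. coord q (Y q) k) - Y p (\<lambda>q. coord q (X q) k)) * e k p f)
     + (\<Sum>i=1..DIM('e). coord p (X p) i * (\<Sum>j=1..DIM('e). coord p (Y p) j * bracket M (e i) (e j) p f))"
  proof (cases "smooth_at M p f")
    case False
    then show ?thesis
      using tv_nonsmooth[OF frame_tangent[OF _ p] False] by (simp add: bracket_def)
  next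
    case True
    have half: "X p (\<lambda>q. Y q f) = (\<Sum>k=1..DIM('e). X p (\<lambda>q. coord q (Y q) k) * e k p f)
        + (\<Sum>i=1..DIM('e). \<Sum>j=1..DIM('e). coord p (X p) i * coord p (Y p) j * e i p (\<lambda>q. e j q f))"
      if X: "vfield M U X" and Y: "vfield M U Y" for X Y
    proof -
      note Xp = vfieldD[OF X p]
      note s = smooth_at_U[OF coord_smooth[OF Y] p] smooth_at_vfield[OF dom_open frame_vfield p True]
      have "X p (\<lambda>q. Y q f) = X p (\<lambda>q. \<Sum>j=1..DIM('e). coord q (Y q) j * e j q f)"
        by (rule tv_cong[OF Xp dom_open p]) (use fun_cong[OF frame_expand[OF _ vfieldD[OF Y]]] in simp)
      also have "\<dots> = (\<Sum>j=1..DIM('e). X p (\<lambda>q. coord q (Y q) j * e j q f))"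
        using s by (intro tv_sum[OF Xp in_carrier[OF p]] smooth_at_mult) auto
      also have "\<dots> = (\<Sum>j=1..DIM('e). coord p (Y p) j * X p (\<lambda>q. e j q f) + e j p f * X p (\<lambda>q. coord q (Y q) j))"
        by (intro sum.cong refl tv_mult[OF Xp] s)
      also have "\<dots> = (\<Sum>k=1..DIM('e). X p (\<lambda>q. coord q (Y q) k) * e k p f)
          + (\<Sum>j=1..DIM('e). \<Sum>i=1..DIM('e). coord p (X p) i * coord p (Y p) j * e i p (\<lambda>q. e j q f))"
        using fun_cong[OF frame_expand[OF p Xp]] by (simp add: sum.distrib sum_distrib_left mult_ac)
      also have "(\<Sum>j=1..DIM('e). \<Sum>i=1..DIM('e). coord p (X p) i * coord p (Y p) j * e i p (\<lambda>q. e j q f))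
          = (\<Sum>i=1..DIM('e). \<Sum>j=1..DIM('e). coord p (X p) i * coord p (Y p) j * e i p (\<lambda>q. e j q f))"
        by (rule sum.swap)
      finally show ?thesis .
    qed
    have swap: "(\<Sum>i=1..DIM('e). \<Sum>j=1..DIM('e). coord p (Y p) i * coord p (X p) j * e i p (\<lambda>q. e j q f))
        = (\<Sum>i=1..DIM('e). \<Sum>j=1..DIM('e). coord p (X p) i * coord p (Y p) j * e j p (\<lambda>q. e i q f))"
      by (subst sum.swap) (simp add: mult_ac)
    have "bracket M X Y p f = X p (\<lambda>q. Y q f) - Y p (\<lambda>q. X q f)"
      using True by (simp add: bracket_def)
    also have "\<dots> = (\<Sum>k=1..DIM('e). (X p (\<lambda>q. coord q (Y q) k) - Y p (\<lambda>q. coord q (X q) k)) * e k p f)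
     + (\<Sum>i=1..DIM('e). \<Sum>j=1..DIM('e). coord p (X p) i * coord p (Y p) j * bracket M (e i) (e j) p f)"
      unfolding half[OF X Y] half[OF Y X] swap
      using True by (simp add: bracket_def left_diff_distrib right_diff_distrib sum_subtractf)
    finally show ?thesis by (simp add: sum_distrib_left mult.assoc)
  qed
qed

lemma frame_connection_torsion_free:
  assumes X: "vfield M U X" and Y: "vfield M U Y" and p: "p \<in> U"
  shows "(\<lambda>f. frame_connection X Y p f - frame_connection Y X p f) = bracket M X Y p"
proof -
  let ?x = "coord p (X p)"
  let ?d = "\<lambda>k. X p (\<lambda>q. coord q (Y q) k) - Y p (\<lambda>q. coord q (X q) k)"
  let ?G = "\<lambda>j k. \<Sum>i=1..DIM('e). ?x i * christoffel i j k p"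
  let ?y = "coord p (Y p)"
  note pc = in_carrier[OF p] and bt = vfieldD[OF frame_bracket_vfield p]
  have c: "coord p (bracket M X Y p) k = X p (\<lambda>q. coord q (Y q) k) - Y p (\<lambda>q. coord q (X q) k)
      + sign k p * (\<Sum>i=1..DIM('e). \<Sum>j=1..DIM('e). ?x i * ?y j *
          (christoffel i j k p - christoffel j i k p))" if k: "k \<in> {1..DIM('e)}" for k
  proof -
    note ek = frame_tangent[OF k p]
    let ?A = "\<lambda>f. \<Sum>l=1..DIM('e). ?d l * e l p f"
    let ?B = "\<lambda>f. \<Sum>i=1..DIM('e). ?x i * (\<Sum>j=1..DIM('e). ?y j * bracket M (e i) (e j) p f)"
    have "g p (bracket M X Y p) (e k p) = g p ?A (e k p) + g p ?B (e k p)"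
      unfolding bracket_expand[OF X Y p]
      by (intro metric_add pc ek tangent_sum frame_tangent p bt) auto
    moreover have "g p ?A (e k p) = (\<Sum>l=1..DIM('e). ?d l * g p (e l p) (e k p))"
      by (intro metric_sum pc ek frame_tangent p) auto
    moreover have "\<dots> = (\<Sum>l=1..DIM('e). if k = l then ?d k * sign k p else 0)"
      using frame_orthogonal[OF p _ k] by (intro sum.cong) (auto simp: sign_def)
    moreover have "g p ?B (e k p) = (\<Sum>i=1..DIM('e). ?x i * (\<Sum>j=1..DIM('e). ?y j * g p (bracket M (e i) (e j) p) (e k p)))"
    proof -
      have "g p ?B (e k p) = (\<Sum>i=1..DIM('e). ?x i * g p (\<lambda>f. \<Sum>j=1..DIM('e). ?y j * bracket M (e i) (e j) p f) (e k p))"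
        by (intro metric_sum pc ek tangent_sum bt)
      moreover have "g p (\<lambda>f. \<Sum>j=1..DIM('e). ?y j * bracket M (e i) (e j) p f) (e k p)
          = (\<Sum>j=1..DIM('e). ?y j * g p (bracket M (e i) (e j) p) (e k p))"
        if "i \<in> {1..DIM('e)}" for i
        by (intro metric_sum pc ek bt that)
      ultimately show ?thesis by simp
    qed
    moreover have "\<dots> = (\<Sum>i=1..DIM('e). \<Sum>j=1..DIM('e). ?x i * ?y j *
          (christoffel i j k p - christoffel j i k p))"
      unfolding sum_distrib_left by (intro sum.cong refl) (simp only: christoffel_torsion[OF p _ _ k] mult.assoc)
    ultimately have "g p (bracket M X Y p) (e k p) = ?d k * sign k p
       + (\<Sum>i=1..DIM('e). \<Sum>j=1..DIM('e). ?x i * ?y j *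
          (christoffel i j k p - christoffel j i k p))" using k by simp
    then have "coord p (bracket M X Y p) k = (sign k p * sign k p) * ?d k
      + sign k p * (\<Sum>i=1..DIM('e). \<Sum>j=1..DIM('e). ?x i * ?y j *
          (christoffel i j k p - christoffel j i k p))"
      unfolding coord_def by (simp only: distrib_left mult_ac)
    then show ?thesis using sgn_square[OF p k] by simp
  qed
  have d: "(X p (\<lambda>q. coord q (Y q) k) + (\<Sum>j=1..DIM('e). ?y j *
       (sign k p * ?G j k)))
    - (Y p (\<lambda>q. coord q (X q) k) + (\<Sum>j=1..DIM('e). ?x j *
       (sign k p * (\<Sum>i=1..DIM('e). ?y i * christoffel i j k p))))
    = coord p (bracket M X Y p) k" if k: "k \<in> {1..DIM('e)}" for k
  proof -
    have 1: "(\<Sum>j=1..DIM('e). ?y j * (sign k p * ?G j k))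
      = sign k p * (\<Sum>i=1..DIM('e). \<Sum>j=1..DIM('e). ?x i * ?y j * christoffel i j k p)"
      unfolding sum_distrib_left by (subst sum.swap) (simp add: mult_ac)
    have 2: "(\<Sum>j=1..DIM('e). ?x j * (sign k p * (\<Sum>i=1..DIM('e). ?y i * christoffel i j k p)))
      = sign k p * (\<Sum>i=1..DIM('e). \<Sum>j=1..DIM('e). ?x i * ?y j * christoffel j i k p)"
      unfolding sum_distrib_left by (simp add: mult_ac)
    show ?thesis unfolding c[OF k] 1 2 by (simp add: right_diff_distrib sum_subtractf)
  qed
  have "bracket M X Y p = (\<lambda>f. \<Sum>k=1..DIM('e). coord p (bracket M X Y p) k * e k p f)"
    using frame_expand[OF p vfieldD[OF vfield_bracket[OF dom_open dom_carrier X Y] p]] .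
  also have "\<dots> = (\<lambda>f. frame_connection X Y p f - frame_connection Y X p f)"
    unfolding frame_connection_def sum_subtractf[symmetric] left_diff_distrib[symmetric]
    by (intro ext sum.cong refl) (simp only: d)
  finally show ?thesis by simp
qed

lemma frame_connection_metric:
  assumes X: "vfield M U X" and Y: "vfield M U Y" and Z: "vfield M U Z" and p: "p \<in> U"
  shows "X p (\<lambda>q. g q (Y q) (Z q)) = g p (frame_connection X Y p) (Z p) + g p (Y p) (frame_connection X Z p)"
proof -
  let ?x = "coord p (X p)"
  let ?G = "\<lambda>j k. \<Sum>i=1..DIM('e). ?x i * christoffel i j k p"
  note pc = in_carrier[OF p] and Xp = vfieldD[OF X p]
  interpret id: map_along M M g r U id by (rule identity_along)
  interpret C: connection M M g r U id frame_connection
    by unfold_locales (rule frame_connection_linear)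
  note s = section_id[OF dom_open dom_carrier]
  have half: "g p (frame_connection X Y p) (Z p) = (\<Sum>k=1..DIM('e). sign k p * coord p (Z p) k * X p (\<lambda>q. coord q (Y q) k))
      + (\<Sum>k=1..DIM('e). \<Sum>j=1..DIM('e). coord p (Y p) j * coord p (Z p) k *
          ?G j k)"
    if Y: "vfield M U Y" and Z: "vfield M U Z" for Y Z
  proof -
    have "g p (frame_connection X Y p) (Z p) = (\<Sum>k=1..DIM('e). (X p (\<lambda>q. coord q (Y q) k) +
     (\<Sum>j=1..DIM('e). coord p (Y p) j *
       (sign k p * ?G j k))) * g p (e k p) (Z p))"
      unfolding frame_connection_def[abs_def] by (intro metric_sum pc frame_tangent p vfieldD[OF Z]) auto
    also have "\<dots> = (\<Sum>k=1..DIM('e). sign k p * coord p (Z p) k * X p (\<lambda>q. coord q (Y q) k)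
      + (\<Sum>j=1..DIM('e). coord p (Y p) j * coord p (Z p) k *
          ?G j k))"
    proof (intro sum.cong refl)
      fix k assume k: "k \<in> {1..DIM('e)}"
      have 1: "g p (e k p) (Z p) = sign k p * coord p (Z p) k"
        using sgn_square[OF p k] metric_sym[OF pc frame_tangent[OF k p] vfieldD[OF Z p]]
        by (simp add: coord_def flip: mult.assoc)
      have 2: "(\<Sum>j=1..DIM('e). coord p (Y p) j *
          (sign k p * ?G j k)) * (sign k p * coord p (Z p) k)
         = (sign k p * sign k p) * (\<Sum>j=1..DIM('e). coord p (Y p) j * coord p (Z p) k *
          ?G j k)"
        unfolding sum_distrib_left sum_distrib_right by (simp add: mult_ac)
      show "(X p (\<lambda>q. coord q (Y q) k) + (\<Sum>j=1..DIM('e). coord p (Y p) j *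
          (sign k p * ?G j k))) * g p (e k p) (Z p)
        = sign k p * coord p (Z p) k * X p (\<lambda>q. coord q (Y q) k)
         + (\<Sum>j=1..DIM('e). coord p (Y p) j * coord p (Z p) k *
          ?G j k)"
        unfolding 1 distrib_right 2 sgn_square[OF p k] by (simp add: mult_ac)
    qed
    finally show ?thesis by (simp add: sum.distrib)
  qed
  have skew: "(\<Sum>k=1..DIM('e). \<Sum>j=1..DIM('e). coord p (Y p) j * coord p (Z p) k *
          ?G j k)
     = - (\<Sum>k=1..DIM('e). \<Sum>j=1..DIM('e). coord p (Z p) j * coord p (Y p) k *
          ?G j k)"
    unfolding sum_negf[symmetric] sum_distrib_left
    by (subst sum.swap, intro sum.cong refl, subst christoffel_skew[OF p]) (simp_all add: mult_ac)
  have sg: "smooth_at M p (\<lambda>q. coord q (Y q) k)" if "vfield M U Y" "k \<in> {1..DIM('e)}" for Y k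
    using coord_smooth[OF that] smooth_at_U p by blast
  have "X p (\<lambda>q. g q (Y q) (Z q)) = X p (\<lambda>q. \<Sum>k=1..DIM('e). sign k q * (coord q (Y q) k * coord q (Z q) k))"
  proof (rule tv_cong[OF Xp dom_open p])
    fix q assume q: "q \<in> U"
    show "g q (Y q) (Z q) = (\<Sum>k=1..DIM('e). sign k q * (coord q (Y q) k * coord q (Z q) k))"
      unfolding metric_expand[OF q vfieldD[OF Y q] vfieldD[OF Z q]]
    proof (intro sum.cong refl)
      fix k assume k: "k \<in> {1..DIM('e)}"
      have "sign k q * (coord q (Y q) k * coord q (Z q) k)
        = (sign k q * sign k q) * (sign k q * (g q (Y q) (e k q) * g q (Z q) (e k q)))"
        by (simp only: coord_def mult_ac)
      then show "sign k q * (g q (Y q) (e k q) * g q (Z q) (e k q)) = sign k q * (coord q (Y q) k * coord q (Z q) k)"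
        by (simp only: sgn_square[OF q k] mult_1)
    qed
  qed
  also have "\<dots> = (\<Sum>k=1..DIM('e). X p (\<lambda>q. sign k q * (coord q (Y q) k * coord q (Z q) k)))"
    by (intro tv_sum[OF Xp pc] smooth_at_mult sg Y Z smooth_at_U[OF sgn_smooth p])
  also have "\<dots> = (\<Sum>k=1..DIM('e). sign k p * coord p (Z p) k * X p (\<lambda>q. coord q (Y q) k)
      + sign k p * coord p (Y p) k * X p (\<lambda>q. coord q (Z q) k))"
  proof (intro sum.cong refl)
    fix k assume k: "k \<in> {1..DIM('e)}"
    show "X p (\<lambda>q. sign k q * (coord q (Y q) k * coord q (Z q) k))
      = sign k p * coord p (Z p) k * X p (\<lambda>q. coord q (Y q) k)
      + sign k p * coord p (Y p) k * X p (\<lambda>q. coord q (Z q) k)"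
      using tv_mult[OF Xp smooth_at_U[OF sgn_smooth[OF k] p] smooth_at_mult[OF sg[OF Y k] sg[OF Z k]]]
        tv_mult[OF Xp sg[OF Y k] sg[OF Z k]] tangent_sgn[OF p k Xp]
      by (simp add: algebra_simps)
  qed
  also have "\<dots> = g p (frame_connection X Y p) (Z p) + g p (frame_connection X Z p) (Y p)"
    unfolding half[OF Y Z] half[OF Z Y] skew by (simp add: sum.distrib)
  also have "g p (frame_connection X Z p) (Y p) = g p (Y p) (frame_connection X Z p)"
    using C.conn_sect[of X Z] X Z p unfolding s by (intro metric_sym pc vfieldD[OF _ p] Y) auto
  finally show ?thesis .
qed

end

lemma is_levi_civita_iff:
  assumes "section_along M U M id = vfield M U" and ne: "\<And>c. smooth_fun M U (\<lambda>p. c)"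
  shows "is_levi_civita M g U D \<longleftrightarrow> linear_connection M U M id D \<and>
    (\<forall>X Y Z. vfield M U X \<and> vfield M U Y \<and> vfield M U Z \<longrightarrow> (\<forall>p\<in>U.
       (\<lambda>h. D X Y p h - D Y X p h) = bracket M X Y p \<and>
       X p (\<lambda>q. g q (Y q) (Z q)) = g p (D X Y p) (Z p) + g p (Y p) (D X Z p)))"
    (is "?L \<longleftrightarrow> ?R1 \<and> ?R2")
proof (intro iffI conjI)
  assume L: ?L
  note L' = L[unfolded is_levi_civita_def, rule_format]
  show ?R1
    unfolding linear_connection_def assms(1)
  proof (intro allI impI, goal_cases)
    case (1 X Y S T f)
    then show ?case using L'[of X Y S f] L'[of X S T f] by simp
  qed
  show ?R2
  proof (intro allI impI ballI)
    fix X Y Z p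
    assume "vfield M U X \<and> vfield M U Y \<and> vfield M U Z" "p \<in> U"
    then show "(\<lambda>h. D X Y p h - D Y X p h) = bracket M X Y p \<and>
       X p (\<lambda>q. g q (Y q) (Z q)) = g p (D X Y p) (Z p) + g p (Y p) (D X Z p)"
      using L'[of X Y Z "\<lambda>p. 0"] ne[of 0] by simp
  qed
next
  assume R: "?R1 \<and> ?R2"
  note R1 = R[THEN conjunct1, unfolded linear_connection_def assms(1), rule_format]
  note R2 = R[THEN conjunct2, rule_format]
  show ?L
    unfolding is_levi_civita_def
  proof (intro allI impI, goal_cases)
    case (1 X Y Z f)
    then show ?case using R1[of X X Y Z f] R1[of X Y Z Z f] R2[of X Y Z] by simp
  qed
qed

context framed
begin

text \<open>The Levi-Civita connection is defined by a choice among the operators that satisfy its axioms. The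
  explicit connection of the frame shows that there is one, so the chosen operator satisfies them.\<close>

lemma levi_civita_exists: "is_levi_civita M g U (levi_civita M g U)"
  unfolding levi_civita_def
proof (rule someI[of _ frame_connection])
  show "is_levi_civita M g U frame_connection"
    unfolding is_levi_civita_iff[OF section_id[OF dom_open dom_carrier] smooth_fun_const]
    by (intro conjI allI impI ballI frame_connection_linear frame_connection_torsion_free frame_connection_metric; elim conjE)
qed

lemmas levi_civita_axioms =
  levi_civita_exists[unfolded is_levi_civita_iff[OF section_id[OF dom_open dom_carrier] smooth_fun_const]]

sublocale LC: connection M M g r U id "levi_civita M g U"
  rewrites "section_along M U M id = vfield M U"
proof -
  interpret map_along M M g r U id by (rule identity_along)
  show "connection M M g r U id (levi_civita M g U)"
    by unfold_locales (rule levi_civita_axioms[THEN conjunct1])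
qed (rule section_id[OF dom_open dom_carrier])

abbreviation nabla :: "('m \<Rightarrow> 'm tvec) \<Rightarrow> ('m \<Rightarrow> 'm tvec) \<Rightarrow> 'm \<Rightarrow> 'm tvec" where
  "nabla \<equiv> levi_civita M g U"

lemma nabla_torsion_free: "vfield M U X \<Longrightarrow> vfield M U Y \<Longrightarrow> p \<in> U \<Longrightarrow>
    bracket M X Y p f = nabla X Y p f - nabla Y X p f"
  using levi_civita_axioms[THEN conjunct2, rule_format, of X Y X p] by (metis (mono_tags))

lemma nabla_metric: "vfield M U X \<Longrightarrow> vfield M U Y \<Longrightarrow> vfield M U Z \<Longrightarrow> p \<in> U \<Longrightarrow>
    X p (\<lambda>q. g q (Y q) (Z q)) = g p (nabla X Y p) (Z p) + g p (Y p) (nabla X Z p)"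
  using levi_civita_axioms[THEN conjunct2, rule_format, of X Y Z p] by simp

lemmas nabla_vfield = LC.conn_sect

lemma nabla_tensorial: "vfield M U Y \<Longrightarrow> tensorial (\<lambda>X p. nabla X Y p k)"
  unfolding tensorial_def by (simp add: LC.conn_add_X LC.conn_scale_X)

text \<open>Differentiate \<open>g(e\<^sub>i, e\<^sub>j)\<close>, which is locally constant.\<close>

lemma nabla_frame_skew:
  assumes "vfield M U X" "i \<in> {1..DIM('e)}" "j \<in> {1..DIM('e)}" "p \<in> U"
  shows "g p (nabla X (e i) p) (e j p) = - g p (nabla X (e j) p) (e i p)"
proof -
  note Xp = vfieldD[OF assms(1,4)] and v = frame_vfield[OF assms(2)] frame_vfield[OF assms(3)]
  have "X p (\<lambda>q. g q (e i q) (e j q)) = 0"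
  proof (cases "i = j")
    case True
    then show ?thesis using tangent_sgn[OF assms(4,2) Xp] by (simp add: sign_def[abs_def])
  next
    case False
    have "X p (\<lambda>q. g q (e i q) (e j q)) = X p (\<lambda>q. 0)"
      by (rule tv_cong[OF Xp dom_open assms(4)]) (use frame_orthogonal assms False in auto)
    then show ?thesis using tv_const[OF Xp in_carrier[OF assms(4)]] by simp
  qed
  then show ?thesis
    using nabla_metric[OF assms(1) v assms(4)]
      metric_sym[OF in_carrier[OF assms(4)] frame_tangent[OF assms(2,4)] vfieldD[OF nabla_vfield[OF assms(1) v(2)] assms(4)]]
    by simp
qed

text \<open>By metric compatibility \<open>g(\<nabla>\<^sub>i e\<^sub>i, e\<^sub>j) = - g(e\<^sub>i, \<nabla>\<^sub>i e\<^sub>j)\<close>. Torsion freeness replaces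
  \<open>\<nabla>\<^sub>i e\<^sub>j\<close> by \<open>[e\<^sub>i, e\<^sub>j] + \<nabla>\<^sub>j e\<^sub>i\<close>, and \<open>g(e\<^sub>i, \<nabla>\<^sub>j e\<^sub>i) = 0\<close>. So the integrability
  functions determine all the \<open>\<nabla>\<^sub>i e\<^sub>i\<close>.\<close>

lemma nabla_frame_self:
  assumes "i \<in> {1..DIM('e)}" "j \<in> {1..DIM('e)}" "p \<in> U"
  shows "g p (nabla (e i) (e i) p) (e j p) = - g p (bracket M (e i) (e j) p) (e i p)"
proof -
  note v = frame_vfield[OF assms(1)] frame_vfield[OF assms(2)]
  have b: "bracket M (e i) (e j) p = (\<lambda>f. nabla (e i) (e j) p f - nabla (e j) (e i) p f)"
    using nabla_torsion_free[OF v assms(3)] by auto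
  have "g p (nabla (e j) (e i) p) (e i p) = 0"
    using nabla_frame_skew[OF v(2) assms(1,1,3)] by simp
  then show ?thesis
    unfolding b nabla_frame_skew[OF v(1) assms]
    using metric_diff[OF in_carrier[OF assms(3)] vfieldD[OF nabla_vfield[OF v] assms(3)]
        vfieldD[OF nabla_vfield[OF v(2,1)] assms(3)] frame_tangent[OF assms(1,3)]]
    by simp
qed

lemma metric_frame_gradient:
  assumes p: "p \<in> U" and w: "w \<in> tangent_space M p"
  shows "g p (\<lambda>k. \<Sum>i=1..DIM('e). sign i p * e i p f * e i p k) w = w f"
proof -
  have "g p (\<lambda>k. \<Sum>i=1..DIM('e). sign i p * e i p f * e i p k) w
      = (\<Sum>i=1..DIM('e). sign i p * e i p f * g p (e i p) w)"
    by (intro metric_sum in_carrier p w frame_tangent)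
  also have "\<dots> = (\<Sum>i=1..DIM('e). coord p w i * e i p f)"
    using w p by (intro sum.cong) (auto simp: coord_def metric_sym[of p w] in_carrier frame_tangent)
  finally show ?thesis using fun_cong[OF frame_expand[OF p w], of f] by simp
qed

lemma gradient_frame:
  assumes p: "p \<in> U"
  shows "gradient M g f p = (\<lambda>k. \<Sum>i=1..DIM('e). sign i p * e i p f * e i p k)" (is "_ = ?G")
  unfolding gradient_def
proof (rule the_equality)
  have G: "?G \<in> tangent_space M p" by (intro tangent_sum frame_tangent p)
  then show "?G \<in> tangent_space M p \<and> (\<forall>w\<in>tangent_space M p. g p ?G w = w f)"
    using metric_frame_gradient[OF p] by simp
  fix v assume v: "v \<in> tangent_space M p \<and> (\<forall>w\<in>tangent_space M p. g p v w = w f)"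
  show "v = ?G"
    by (rule tangent_eqI[OF p _ G]) (use v metric_frame_gradient[OF p] frame_tangent[OF _ p] in auto)
qed

lemma gradient_vfield:
  assumes f: "smooth_fun M U f"
  shows "vfield M U (gradient M g f)"
proof (rule vfield_cong[OF dom_open])
  show "vfield M U (\<lambda>p k. \<Sum>i=1..DIM('e). (sign i p * e i p f) * e i p k)"
    by (intro vfield_sum smooth_fun_mult sgn_smooth frame_vfield dom_open vfield_smooth[OF frame_vfield] f) auto
qed (use gradient_frame in simp)

lemma metric_gradient: "p \<in> U \<Longrightarrow> w \<in> tangent_space M p \<Longrightarrow> g p (gradient M g f p) w = w f"
  using metric_frame_gradient gradient_frame by simp

lemma laplacian_frame:
  assumes f: "smooth_fun M U f" and p: "p \<in> U"
  shows "laplacian M g U e f p = (\<Sum>i=1..DIM('e). sign i p *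
    (e i p (\<lambda>q. e i q f) - nabla (e i) (e i) p f))"
  unfolding laplacian_def sign_def[symmetric]
proof (intro sum.cong refl arg_cong2[of _ _ _ _ "(*)"])
  fix i assume i: "i \<in> {1..DIM('e)}"
  note v = frame_vfield[OF i] and G = gradient_vfield[OF f]
  note n = vfieldD[OF nabla_vfield[OF v v] p]
  have "e i p (\<lambda>q. g q (gradient M g f q) (e i q)) = e i p (\<lambda>q. e i q f)"
    by (rule tv_cong[OF frame_tangent[OF i p] dom_open p]) (use metric_gradient frame_tangent[OF i] in auto)
  then show "g p (nabla (e i) (gradient M g f) p) (e i p) = e i p (\<lambda>q. e i q f) - nabla (e i) (e i) p f"
    using nabla_metric[OF v G v p] metric_gradient[OF p n] by simp
qed

section \<open>Tensoriality of the curvature\<close>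

lemma curvature_skew:
  assumes X: "vfield M U X" and Y: "vfield M U Y" and Z: "vfield M U Z" and p: "p \<in> U"
  shows "riemann M g U Y X Z p k = - riemann M g U X Y Z p k"
proof -
  note b = vfield_bracket[OF dom_open dom_carrier X Y]
  have "nabla (bracket M Y X) Z p = nabla (\<lambda>q f. (\<lambda>q. -1) q * bracket M X Y q f) Z p"
    by (intro LC.conn_cong vfield_bracket dom_open dom_carrier X Y Z p vfield_scale smooth_fun_const)
       (auto simp: bracket_swap[of Y X])
  also have "\<dots> = (\<lambda>k. (-1) * nabla (bracket M X Y) Z p k)"
    by (rule LC.conn_scale_X[OF b Z smooth_fun_const p])
  finally show ?thesis by (simp add: riemann_def Let_def)
qed

text \<open>The term \<open>- (Y f) \<nabla>\<^sub>X Z\<close> from differentiating \<open>f \<nabla>\<^sub>X Z\<close> is cancelled by the derivative of the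
  coefficient in \<open>[f X, Y] = f [X, Y] - (Y f) X\<close>.\<close>

lemma curvature_tensorial_1:
  assumes Y: "vfield M U Y" and Z: "vfield M U Z"
  shows "tensorial (\<lambda>X p. riemann M g U X Y Z p k)"
  unfolding tensorial_def
proof (intro allI impI, elim conjE)
  fix X X' f p
  assume X: "vfield M U X" and X': "vfield M U X'" and f: "smooth_fun M U f" and p: "p \<in> U"
  note b = vfield_bracket[OF dom_open dom_carrier]
  have Yf: "smooth_fun M U (\<lambda>q. - Y q f)"
    by (intro smooth_fun_minus dom_open vfield_smooth[OF Y] f order_refl)
  have 1: "nabla Y (nabla (\<lambda>q h. X q h + X' q h) Z) p = (\<lambda>k. nabla Y (nabla X Z) p k + nabla Y (nabla X' Z) p k)"
  proof -
    have "nabla Y (nabla (\<lambda>q h. X q h + X' q h) Z) p = nabla Y (\<lambda>q k. nabla X Z q k + nabla X' Z q k) p"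
      by (intro LC.conn_cong nabla_vfield vfield_add X X' Y Z p refl LC.conn_add_X)
    also have "\<dots> = (\<lambda>k. nabla Y (nabla X Z) p k + nabla Y (nabla X' Z) p k)"
      by (intro LC.conn_add_S nabla_vfield X X' Y Z p)
    finally show ?thesis .
  qed
  have 2: "nabla (bracket M (\<lambda>q h. X q h + X' q h) Y) Z p
      = (\<lambda>k. nabla (bracket M X Y) Z p k + nabla (bracket M X' Y) Z p k)"
  proof -
    have "nabla (bracket M (\<lambda>q h. X q h + X' q h) Y) Z p = nabla (\<lambda>q h. bracket M X Y q h + bracket M X' Y q h) Z p"
      by (intro LC.conn_cong b vfield_add X X' Y Z p refl bracket_add[OF dom_open dom_carrier])
    also have "\<dots> = (\<lambda>k. nabla (bracket M X Y) Z p k + nabla (bracket M X' Y) Z p k)"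
      by (intro LC.conn_add_X b X X' Y Z p)
    finally show ?thesis .
  qed
  have 3: "nabla Y (nabla (\<lambda>q h. f q * X q h) Z) p = (\<lambda>k. Y p f * nabla X Z p k + f p * nabla Y (nabla X Z) p k)"
  proof -
    have "nabla Y (nabla (\<lambda>q h. f q * X q h) Z) p = nabla Y (\<lambda>q k. f q * nabla X Z q k) p"
      by (intro LC.conn_cong nabla_vfield vfield_scale X Y Z p f refl LC.conn_scale_X)
    also have "\<dots> = (\<lambda>k. Y p f * nabla X Z p k + f p * nabla Y (nabla X Z) p k)"
      by (intro LC.conn_leibniz nabla_vfield X Y Z p f)
    finally show ?thesis .
  qed
  have 4: "nabla (bracket M (\<lambda>q h. f q * X q h) Y) Z p
      = (\<lambda>k. f p * nabla (bracket M X Y) Z p k + (- Y p f) * nabla X Z p k)"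
  proof -
    have "nabla (bracket M (\<lambda>q h. f q * X q h) Y) Z p
        = nabla (\<lambda>q h. (\<lambda>q h. f q * bracket M X Y q h) q h + (\<lambda>q h. (- Y q f) * X q h) q h) Z p"
      by (intro LC.conn_cong b vfield_add vfield_scale X Y Z p f Yf refl bracket_scale[OF dom_open dom_carrier])
    also have "\<dots> = (\<lambda>k. nabla (\<lambda>q h. f q * bracket M X Y q h) Z p k + nabla (\<lambda>q h. (- Y q f) * X q h) Z p k)"
      by (intro LC.conn_add_X b vfield_scale X Y Z p f Yf)
    also have "\<dots> = (\<lambda>k. f p * nabla (bracket M X Y) Z p k + (- Y p f) * nabla X Z p k)"
      by (simp only: LC.conn_scale_X[OF b[OF X Y] Z f p] LC.conn_scale_X[OF X Z Yf p])
    finally show ?thesis .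
  qed
  show "riemann M g U (\<lambda>q h. X q h + X' q h) Y Z p k = riemann M g U X Y Z p k + riemann M g U X' Y Z p k \<and>
      riemann M g U (\<lambda>q h. f q * X q h) Y Z p k = f p * riemann M g U X Y Z p k"
    unfolding riemann_def Let_def 1 2 3 4
      LC.conn_add_X[OF X X' nabla_vfield[OF Y Z] p] LC.conn_scale_X[OF X nabla_vfield[OF Y Z] f p]
    by (simp add: algebra_simps)
qed

lemma curvature_tensorial_2:
  assumes X: "vfield M U X" and Z: "vfield M U Z"
  shows "tensorial (\<lambda>Y p. riemann M g U X Y Z p k)"
  unfolding tensorial_def
proof (intro allI impI, elim conjE)
  fix Y Y' f p
  assume Y: "vfield M U Y" and Y': "vfield M U Y'" and f: "smooth_fun M U f" and p: "p \<in> U"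
  note t = curvature_tensorial_1[OF X Z, of k]
  show "riemann M g U X (\<lambda>q h. Y q h + Y' q h) Z p k = riemann M g U X Y Z p k + riemann M g U X Y' Z p k \<and>
      riemann M g U X (\<lambda>q h. f q * Y q h) Z p k = f p * riemann M g U X Y Z p k"
    using tensorial_add[OF t Y Y' p] tensorial_scale[OF t Y f p]
    unfolding curvature_skew[OF X vfield_add[OF Y Y'] Z p] curvature_skew[OF X vfield_scale[OF f Y] Z p]
      curvature_skew[OF X Y Z p] curvature_skew[OF X Y' Z p] by simp
qed

text \<open>The second derivatives of \<open>f\<close> combine to \<open>X (Y f) - Y (X f) - [X, Y] f = 0\<close>.\<close>

lemma curvature_tensorial_3:
  assumes X: "vfield M U X" and Y: "vfield M U Y"
  shows "tensorial (\<lambda>Z p. riemann M g U X Y Z p k)"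
  unfolding tensorial_def
proof (intro allI impI, elim conjE)
  fix Z Z' f p
  assume Z: "vfield M U Z" and Z': "vfield M U Z'" and f: "smooth_fun M U f" and p: "p \<in> U"
  note b = vfield_bracket[OF dom_open dom_carrier X Y]
  have add: "nabla X (nabla Y (\<lambda>q h. Z q h + Z' q h)) p = (\<lambda>k. nabla X (nabla Y Z) p k + nabla X (nabla Y Z') p k)"
    if X: "vfield M U X" and Y: "vfield M U Y" for X Y
  proof -
    have "nabla X (nabla Y (\<lambda>q h. Z q h + Z' q h)) p = nabla X (\<lambda>q k. nabla Y Z q k + nabla Y Z' q k) p"
      by (intro LC.conn_cong nabla_vfield vfield_add X Z' Y Z p refl LC.conn_add_S)
    also have "\<dots> = (\<lambda>k. nabla X (nabla Y Z) p k + nabla X (nabla Y Z') p k)"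
      by (intro LC.conn_add_S nabla_vfield X Z' Y Z p)
    finally show ?thesis .
  qed
  have scale: "nabla X (nabla Y (\<lambda>q h. f q * Z q h)) p
      = (\<lambda>k. X p (\<lambda>q. Y q f) * Z p k + Y p f * nabla X Z p k + X p f * nabla Y Z p k + f p * nabla X (nabla Y Z) p k)"
    if X: "vfield M U X" and Y: "vfield M U Y" for X Y
  proof -
    have Yf: "smooth_fun M U (\<lambda>q. Y q f)"
      by (intro vfield_smooth[OF Y] dom_open f order_refl)
    have "nabla X (nabla Y (\<lambda>q h. f q * Z q h)) p
        = nabla X (\<lambda>q k. (\<lambda>q k. Y q f * Z q k) q k + (\<lambda>q k. f q * nabla Y Z q k) q k) p"
      by (intro LC.conn_cong nabla_vfield vfield_add vfield_scale X Y Z p f Yf refl LC.conn_leibniz)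
    also have "\<dots> = (\<lambda>k. nabla X (\<lambda>q k. Y q f * Z q k) p k + nabla X (\<lambda>q k. f q * nabla Y Z q k) p k)"
      by (intro LC.conn_add_S nabla_vfield vfield_scale X Y Z p f Yf)
    finally show ?thesis
      unfolding LC.conn_leibniz[OF X Z Yf p] LC.conn_leibniz[OF X nabla_vfield[OF Y Z] f p] by (simp add: add.assoc)
  qed
  have br: "bracket M X Y p f = X p (\<lambda>q. Y q f) - Y p (\<lambda>q. X q f)"
    using smooth_at_U[OF f p] by (simp add: bracket_def)
  show "riemann M g U X Y (\<lambda>q h. Z q h + Z' q h) p k = riemann M g U X Y Z p k + riemann M g U X Y Z' p k \<and>
      riemann M g U X Y (\<lambda>q h. f q * Z q h) p k = f p * riemann M g U X Y Z p k"
    unfolding riemann_def Let_def add[OF X Y] add[OF Y X] scale[OF X Y] scale[OF Y X]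
      LC.conn_add_S[OF b Z Z' p] LC.conn_leibniz[OF b Z f p] br
    by (simp add: algebra_simps)
qed

lemma tensorial_pointwise:
  assumes "tensorial L" "vfield M U X" "vfield M U X'" "p \<in> U" "X p = X' p"
  shows "L X p = L X' p"
  using tensorial_expand[OF assms(1,2,4)] tensorial_expand[OF assms(1,3,4)] assms(5) by simp

text \<open>The curvature at a point is defined as the unique value obtained from all extensions of the three
  vectors; tensoriality in each argument gives the uniqueness.\<close>

lemma riemann_at_eq:
  assumes X: "vfield M U X" and Y: "vfield M U Y" and Z: "vfield M U Z" and p: "p \<in> U"
  shows "riemann_at M g U p (X p) (Y p) (Z p) = riemann M g U X Y Z p"
  unfolding riemann_at_def
proof (rule the_equality)
  fix t assume "\<exists>X' Y' Z'. vfield M U X' \<and> vfield M U Y' \<and> vfield M U Z' \<and>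
    X' p = X p \<and> Y' p = Y p \<and> Z' p = Z p \<and> t = riemann M g U X' Y' Z' p"
  then obtain X' Y' Z' where *: "vfield M U X'" "vfield M U Y'" "vfield M U Z'"
    "X' p = X p" "Y' p = Y p" "Z' p = Z p" "t = riemann M g U X' Y' Z' p" by blast
  show "t = riemann M g U X Y Z p"
  proof
    fix k
    have "t k = riemann M g U X Y' Z' p k"
      using tensorial_pointwise[OF curvature_tensorial_1[OF *(2,3)] *(1) X p *(4)] *(7) by simp
    also have "\<dots> = riemann M g U X Y Z' p k"
      by (rule tensorial_pointwise[OF curvature_tensorial_2[OF X *(3)] *(2) Y p *(5)])
    also have "\<dots> = riemann M g U X Y Z p k"
      by (rule tensorial_pointwise[OF curvature_tensorial_3[OF X Y] *(3) Z p *(6)])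
    finally show "t k = riemann M g U X Y Z p k" .
  qed
qed (use X Y Z in blast)

end

section \<open>Maps into a framed surface and the pull-back connection\<close>

locale smooth_map_frame = src: smooth_mfd M + tgt: framed B h s V \<epsilon>
  for M :: "('m::{t2_space,second_countable_topology}, 'e::euclidean_space) atlas"
    and B :: "('b::{t2_space,second_countable_topology}, 'k::euclidean_space) atlas"
    and h s V \<epsilon> +
  fixes W :: "'m set" and \<phi> :: "'m \<Rightarrow> 'b"
  assumes W_open: "open W" and W_carrier: "W \<subseteq> carrier M"
    and smooth: "smooth_map M B \<phi>" and W_V: "\<And>p. p \<in> W \<Longrightarrow> \<phi> p \<in> V"
begin

abbreviation push :: "'m \<Rightarrow> 'm tvec \<Rightarrow> 'b tvec" where
  "push \<equiv> differential B \<phi>"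

lemma preimage_open_in: "open X \<Longrightarrow> X \<subseteq> carrier M \<Longrightarrow> open N \<Longrightarrow> open (X \<inter> \<phi> -` N)"
  using smooth unfolding smooth_map_def
  by (meson continuous_on_subset continuous_open_preimage)

sublocale map_along M B h s W \<phi>
  by unfold_locales (use W_open W_carrier W_V tgt.in_carrier preimage_open_in in auto)

text \<open>In charts \<open>x\<close> and \<open>y\<close> one has \<open>f \<circ> \<phi> \<circ> x\<^sup>-\<^sup>1 = (f \<circ> y\<^sup>-\<^sup>1) \<circ> (y \<circ> \<phi> \<circ> x\<^sup>-\<^sup>1)\<close>. One chart of the target
  need not cover the image of a chart of the source, so the argument is local.\<close>

lemma smooth_fun_pullback:
  assumes X: "open X" "X \<subseteq> carrier M" and N: "open N" "N \<subseteq> carrier B" and f: "smooth_fun B N f"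
  shows "smooth_fun M (X \<inter> \<phi> -` N) (\<lambda>p. f (\<phi> p))"
proof (rule src.smooth_fun_local[OF preimage_open_in[OF X N(1)]])
  fix p assume p: "p \<in> X \<inter> \<phi> -` N"
  then obtain V' y where y: "(V', y) \<in> B" "\<phi> p \<in> V'" using N by (auto simp: carrier_def)
  let ?O = "X \<inter> \<phi> -` (N \<inter> V')"
  have O: "open ?O" using preimage_open_in[OF X] N(1) tgt.chart_domain_open[OF y(1)] by blast
  have "smooth_fun M ?O (\<lambda>p. f (\<phi> p))"
    unfolding smooth_fun_def
  proof clarify
    fix U x assume x: "(U, x) \<in> M"
    let ?S = "x ` (U \<inter> ?O)" and ?T = "y ` (V' \<inter> N)"
    have "smooth_on (x ` (U \<inter> \<phi> -` V')) (y \<circ> \<phi> \<circ> inv_into U x)"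
      using smooth x y unfolding smooth_map_def by blast
    then have 1: "smooth_on ?S (y \<circ> \<phi> \<circ> inv_into U x)" by (rule smooth_on_subset) auto
    have 2: "smooth_on ?T (f \<circ> inv_into V' y)" using f y unfolding smooth_fun_def by blast
    have inv: "inv_into U x z \<in> U \<inter> ?O" if "z \<in> ?S" for z
      using that src.chart_inj[OF x] by auto
    have 3: "smooth_on ?S ((f \<circ> inv_into V' y) \<circ> (y \<circ> \<phi> \<circ> inv_into U x))"
      by (rule smooth_on_compose[OF src.chart_image_open[OF x O] tgt.chart_image_open[OF y(1) N(1)] 1 2])
        (use inv in fastforce)
    show "smooth_on ?S ((\<lambda>p. f (\<phi> p)) \<circ> inv_into U x)"
    proof (rule smooth_on_cong[OF src.chart_image_open[OF x O] _ 3])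
      fix z assume "z \<in> ?S"
      then have "\<phi> (inv_into U x z) \<in> V'" using inv by blast
      then show "((f \<circ> inv_into V' y) \<circ> (y \<circ> \<phi> \<circ> inv_into U x)) z = ((\<lambda>p. f (\<phi> p)) \<circ> inv_into U x) z"
        using tgt.chart_inj[OF y(1)] by simp
    qed
  qed
  then show "\<exists>W'. open W' \<and> p \<in> W' \<and> W' \<subseteq> X \<inter> \<phi> -` N \<and> smooth_fun M W' (\<lambda>p. f (\<phi> p))"
    using O p y by blast
qed

lemma smooth_fun_pullback_V: "smooth_fun B V f \<Longrightarrow> smooth_fun M W (\<lambda>p. f (\<phi> p))"
proof -
  assume "smooth_fun B V f"
  then have "smooth_fun M (W \<inter> \<phi> -` V) (\<lambda>p. f (\<phi> p))"
    by (intro smooth_fun_pullback W_open W_carrier tgt.dom_open tgt.dom_carrier)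
  moreover have "W \<inter> \<phi> -` V = W" using W_V by auto
  ultimately show ?thesis by simp
qed

lemma smooth_at_pullback:
  assumes "p \<in> W" "smooth_at B (\<phi> p) f"
  shows "smooth_at M p (f \<circ> \<phi>)"
proof -
  obtain N where "open N" "\<phi> p \<in> N" "N \<subseteq> carrier B" "smooth_fun B N f"
    using assms by (auto simp: smooth_at_def)
  then show ?thesis
    using assms(1) smooth_fun_pullback[OF W_open W_carrier, of N f] preimage_open[of N] W_carrier
    by (intro src.smooth_atI[of "W \<inter> \<phi> -` N"]) (auto simp: o_def)
qed

lemma differential_tangent:
  assumes p: "p \<in> W" and v: "v \<in> tangent_space M p"
  shows "push p v \<in> tangent_space B (\<phi> p)"
proof (rule tgt.tangent_spaceI)
  fix f f' N assume *: "smooth_at B (\<phi> p) f" "open N" "\<phi> p \<in> N" "\<And>x. x \<in> N \<Longrightarrow> f x = f' x"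
  have "smooth_at B (\<phi> p) f'" using tgt.smooth_at_cong[OF *] .
  moreover have "v (f \<circ> \<phi>) = v (f' \<circ> \<phi>)"
    by (rule src.tv_cong[OF v preimage_open[OF *(2)]]) (use p * in auto)
  ultimately show "push p v f = push p v f'" using * by (simp add: differential_def)
next
  fix f f' assume f: "smooth_at B (\<phi> p) f" and f': "smooth_at B (\<phi> p) f'"
  note s = smooth_at_pullback[OF p f] smooth_at_pullback[OF p f']
  show "push p v (\<lambda>x. f x + f' x) = push p v f + push p v f'"
    using src.tv_add[OF v s] f f' tgt.smooth_at_add by (simp add: differential_def o_def)
  show "push p v (\<lambda>x. f x * f' x) = f (\<phi> p) * push p v f' + f' (\<phi> p) * push p v f"
    using src.tv_mult[OF v s] f f' tgt.smooth_at_mult by (simp add: differential_def o_def)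
next
  fix f and c :: real assume f: "smooth_at B (\<phi> p) f"
  show "push p v (\<lambda>x. c * f x) = c * push p v f"
    using src.tv_scale[OF v smooth_at_pullback[OF p f]] f
      tgt.smooth_at_mult[OF tgt.smooth_at_const[OF into_carrier[OF p]] f]
    by (simp add: differential_def o_def)
qed (simp add: differential_def)

lemma differential_add: "push p (\<lambda>f. u f + v f) = (\<lambda>f. push p u f + push p v f)"
  by (auto simp: differential_def)

lemma differential_scale: "push p (\<lambda>f. c * u f) = (\<lambda>f. c * push p u f)"
  by (auto simp: differential_def)

lemma differential_sect:
  assumes X: "vfield M W X"
  shows "sect (\<lambda>p. push p (X p))"
  unfolding section_along_def
proof (intro conjI allI impI ballI)
  fix N f assume N: "open N \<and> N \<subseteq> carrier B \<and> smooth_fun B N f"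
  have "smooth_fun M (W \<inter> \<phi> -` N) (\<lambda>p. X p (\<lambda>q. f (\<phi> q)))"
    using N by (intro src.vfield_smooth[OF X] preimage_open smooth_fun_pullback W_open W_carrier) auto
  then show "smooth_fun M (W \<inter> \<phi> -` N) (\<lambda>p. push p (X p) f)"
  proof (rule src.smooth_fun_cong[rotated])
    fix p assume "p \<in> W \<inter> \<phi> -` N"
    then have "smooth_at B (\<phi> p) f" using N by (intro tgt.smooth_atI[of N]) auto
    then show "X p (\<lambda>q. f (\<phi> q)) = push p (X p) f"
      by (simp add: differential_def o_def)
  qed (use N preimage_open in auto)
qed (use differential_tangent src.vfieldD[OF X] in auto)

lemma vfield_pullback_sect:
  assumes Y: "vfield B V Y"
  shows "sect (\<lambda>p. Y (\<phi> p))"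
  unfolding section_along_def
proof (intro conjI allI impI ballI)
  fix N f assume N: "open N \<and> N \<subseteq> carrier B \<and> smooth_fun B N f"
  have "smooth_fun M (W \<inter> \<phi> -` (N \<inter> V)) (\<lambda>p. Y (\<phi> p) f)"
    using N tgt.dom_open
    by (intro smooth_fun_pullback W_open W_carrier tgt.vfield_smooth[OF Y]) (auto elim: tgt.smooth_fun_subset)
  moreover have "W \<inter> \<phi> -` (N \<inter> V) = W \<inter> \<phi> -` N" using W_V by auto
  ultimately show "smooth_fun M (W \<inter> \<phi> -` N) (\<lambda>p. Y (\<phi> p) f)" by simp
qed (use W_V tgt.vfieldD[OF Y] in auto)

end

text \<open>Applied to the two frame vectors at a point of a surface, this yields two functions that serve as local
  coordinates.\<close>

lemma independent_functionals:
  fixes v w :: "'a \<Rightarrow> real"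
  assumes ind: "\<And>a b. (\<forall>f. a * v f + b * w f = 0) \<Longrightarrow> a = 0 \<and> b = 0"
  obtains f f' where "v f * w f' - w f * v f' \<noteq> 0"
proof -
  have "\<exists>f. v f \<noteq> 0" using ind[of 1 0] by auto
  then obtain f where f: "v f \<noteq> 0" by blast
  have "\<exists>f'. - w f * v f' + v f * w f' \<noteq> 0" using ind[of "- w f" "v f"] f by blast
  then obtain f' where "- w f * v f' + v f * w f' \<noteq> 0" by blast
  then show ?thesis using that[of f f'] by (simp add: algebra_simps)
qed

locale surface_map = smooth_map_frame M B h s V \<epsilon> W \<phi>
  for M :: "('m::{t2_space,second_countable_topology}, 'e::euclidean_space) atlas"
    and B :: "('b::{t2_space,second_countable_topology}, 'k::euclidean_space) atlas"
    and h s V \<epsilon> W \<phi> +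
  assumes dim2: "DIM('k) = 2"
begin

lemma sum_dim2: "(\<Sum>a=1..DIM('k). c a) = c 1 + (c 2 :: real)"
  unfolding dim2 by (simp add: numeral_2_eq_2)

text \<open>A section is smooth if its action on smooth functions is. The coordinates of \<open>S = c\<^sub>1 \<epsilon>\<^sub>1 + c\<^sub>2 \<epsilon>\<^sub>2\<close>
  solve the linear system \<open>S f = c\<^sub>1 \<epsilon>\<^sub>1 f + c\<^sub>2 \<epsilon>\<^sub>2 f\<close>, \<open>S f' = c\<^sub>1 \<epsilon>\<^sub>1 f' + c\<^sub>2 \<epsilon>\<^sub>2 f'\<close> with smooth
  coefficients, whose determinant is nonzero near the given point for suitable \<open>f\<close>, \<open>f'\<close>. Cramer's rule
  exhibits them as smooth functions.\<close>

lemma coord_sect_smooth: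
  assumes S: "sect S" and a: "a \<in> {1..DIM('k)}"
  shows "smooth_fun M W (\<lambda>p. tgt.coord (\<phi> p) (S p) a)"
proof (rule src.smooth_fun_local[OF W_open])
  fix p assume p: "p \<in> W"
  note q = W_V[OF p]
  have i12: "1 \<in> {1..DIM('k)}" "2 \<in> {1..DIM('k)}" using dim2 by auto
  note t = tgt.frame_tangent[OF i12(1) q] tgt.frame_tangent[OF i12(2) q]
  have "a = 0 \<and> b = 0" if *: "\<forall>f. a * \<epsilon> 1 (\<phi> p) f + b * \<epsilon> 2 (\<phi> p) f = 0" for a b
  proof -
    have "h (\<phi> p) (\<lambda>f. a * \<epsilon> 1 (\<phi> p) f + b * \<epsilon> 2 (\<phi> p) f) (\<epsilon> i (\<phi> p)) = 0" if "i \<in> {1..DIM('k)}" for i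
      using * tgt.metric_zero[OF into_carrier[OF p] tgt.frame_tangent[OF that q]] by simp
    then have "a * h (\<phi> p) (\<epsilon> 1 (\<phi> p)) (\<epsilon> i (\<phi> p)) + b * h (\<phi> p) (\<epsilon> 2 (\<phi> p)) (\<epsilon> i (\<phi> p)) = 0" if "i \<in> {1..DIM('k)}" for i
      using tgt.metric_lin[OF into_carrier[OF p] t tgt.frame_tangent[OF that q]] that by metis
    from this[OF i12(1)] this[OF i12(2)] show ?thesis
      using tgt.frame_orthogonal[OF q i12] tgt.frame_orthogonal[OF q i12(2,1)]
        tgt.sgn_square[OF q i12(1)] tgt.sgn_square[OF q i12(2)]
      by (auto simp: tgt.sign_def)
  qed
  then obtain f f' where det: "\<epsilon> 1 (\<phi> p) f * \<epsilon> 2 (\<phi> p) f' - \<epsilon> 2 (\<phi> p) f * \<epsilon> 1 (\<phi> p) f' \<noteq> 0"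
    by (rule independent_functionals)
  have "\<epsilon> 1 (\<phi> p) f \<noteq> 0 \<or> \<epsilon> 2 (\<phi> p) f \<noteq> 0" "\<epsilon> 1 (\<phi> p) f' \<noteq> 0 \<or> \<epsilon> 2 (\<phi> p) f' \<noteq> 0"
    using det by auto
  then have "smooth_at B (\<phi> p) f" "smooth_at B (\<phi> p) f'"
    using tgt.tv_nonsmooth[OF t(1)] tgt.tv_nonsmooth[OF t(2)] by blast+
  then obtain N N' where N: "open N" "\<phi> p \<in> N" "N \<subseteq> carrier B" "smooth_fun B N f"
    and N': "open N'" "\<phi> p \<in> N'" "smooth_fun B N' f'"
    unfolding smooth_at_def by blast
  let ?N = "N \<inter> N'"
  let ?O = "W \<inter> \<phi> -` ?N"
  have sN: "open ?N" "?N \<subseteq> carrier B" "smooth_fun B ?N f" "smooth_fun B ?N f'"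
    using N N' by (auto elim: tgt.smooth_fun_subset)
  have O: "open ?O" "?O \<subseteq> carrier M" using preimage_open[OF sN(1)] W_carrier by auto
  note sm = sect_smooth[OF _ sN(1,2,3)] sect_smooth[OF _ sN(1,2,4)]
  note e1 = vfield_pullback_sect[OF tgt.frame_vfield[OF i12(1)]]
    and e2 = vfield_pullback_sect[OF tgt.frame_vfield[OF i12(2)]]
  define d where "d = (\<lambda>p. \<epsilon> 1 (\<phi> p) f * \<epsilon> 2 (\<phi> p) f' - \<epsilon> 2 (\<phi> p) f * \<epsilon> 1 (\<phi> p) f')"
  have d: "smooth_fun M ?O d"
    unfolding d_def by (intro src.smooth_fun_diff src.smooth_fun_mult O sm e1 e2)
  let ?O' = "?O \<inter> d -` (- {0})"
  have "open ?O'"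
    by (rule continuous_open_preimage[OF src.smooth_fun_continuous[OF O d] O(1)]) auto
  have num: "smooth_fun M ?O' (\<lambda>p. (S p f * \<epsilon> 2 (\<phi> p) f' - S p f' * \<epsilon> 2 (\<phi> p) f) * inverse (d p))"
    "smooth_fun M ?O' (\<lambda>p. (S p f' * \<epsilon> 1 (\<phi> p) f - S p f * \<epsilon> 1 (\<phi> p) f') * inverse (d p))"
    by (intro src.smooth_fun_mult src.smooth_fun_diff src.smooth_fun_inverse \<open>open ?O'\<close>
        src.smooth_fun_subset[OF sm(1)[OF S]] src.smooth_fun_subset[OF sm(2)[OF S]]
        src.smooth_fun_subset[OF sm(1)[OF e1]] src.smooth_fun_subset[OF sm(2)[OF e1]]
        src.smooth_fun_subset[OF sm(1)[OF e2]] src.smooth_fun_subset[OF sm(2)[OF e2]]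
        src.smooth_fun_subset[OF d]; auto)+
  have c: "tgt.coord (\<phi> q) (S q) 1 = (S q f * \<epsilon> 2 (\<phi> q) f' - S q f' * \<epsilon> 2 (\<phi> q) f) * inverse (d q)"
    "tgt.coord (\<phi> q) (S q) 2 = (S q f' * \<epsilon> 1 (\<phi> q) f - S q f * \<epsilon> 1 (\<phi> q) f') * inverse (d q)"
    if q: "q \<in> ?O'" for q
  proof -
    have "S q = (\<lambda>f. tgt.coord (\<phi> q) (S q) 1 * \<epsilon> 1 (\<phi> q) f + tgt.coord (\<phi> q) (S q) 2 * \<epsilon> 2 (\<phi> q) f)"
      using tgt.frame_expand[OF W_V sectD[OF S], of q] q by (simp only: sum_dim2) blast
    then have *: "S q f = tgt.coord (\<phi> q) (S q) 1 * \<epsilon> 1 (\<phi> q) f + tgt.coord (\<phi> q) (S q) 2 * \<epsilon> 2 (\<phi> q) f" for f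
      by (rule fun_cong)
    have "d q \<noteq> 0" using q by simp
    moreover have "tgt.coord (\<phi> q) (S q) 1 * d q = S q f * \<epsilon> 2 (\<phi> q) f' - S q f' * \<epsilon> 2 (\<phi> q) f"
      "tgt.coord (\<phi> q) (S q) 2 * d q = S q f' * \<epsilon> 1 (\<phi> q) f - S q f * \<epsilon> 1 (\<phi> q) f'"
      unfolding *[of f] *[of f'] d_def by (simp_all add: algebra_simps)
    ultimately show "tgt.coord (\<phi> q) (S q) 1 = (S q f * \<epsilon> 2 (\<phi> q) f' - S q f' * \<epsilon> 2 (\<phi> q) f) * inverse (d q)"
      "tgt.coord (\<phi> q) (S q) 2 = (S q f' * \<epsilon> 1 (\<phi> q) f - S q f * \<epsilon> 1 (\<phi> q) f') * inverse (d q)"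
      by (simp_all add: field_simps)
  qed
  have "a = 1 \<or> a = 2" using a dim2 by auto
  then have "smooth_fun M ?O' (\<lambda>p. tgt.coord (\<phi> p) (S p) a)"
  proof
    assume "a = 1"
    then show ?thesis by (intro src.smooth_fun_cong[OF \<open>open ?O'\<close> num(1)]) (simp only: c)
  next
    assume "a = 2"
    then show ?thesis by (intro src.smooth_fun_cong[OF \<open>open ?O'\<close> num(2)]) (simp only: c)
  qed
  moreover have "p \<in> ?O'" using p N N' det by (simp add: d_def)
  ultimately show "\<exists>W'. open W' \<and> p \<in> W' \<and> W' \<subseteq> W \<and> smooth_fun M W' (\<lambda>p. tgt.coord (\<phi> p) (S p) a)"
    using \<open>open ?O'\<close> by blast
qed

text \<open>The connection matrix of the target frame, evaluated on the image of \<open>u\<close> under the differential.\<close>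

definition pullback_coefficient :: "nat \<Rightarrow> nat \<Rightarrow> 'm \<Rightarrow> 'm tvec \<Rightarrow> real" where
  "pullback_coefficient a b p u = (\<Sum>c=1..DIM('k). tgt.coord (\<phi> p) (push p u) c *
     tgt.coord (\<phi> p) (tgt.nabla (\<epsilon> c) (\<epsilon> b) (\<phi> p)) a)"

definition frame_pullback_connection :: "('m \<Rightarrow> 'm tvec) \<Rightarrow> ('m \<Rightarrow> 'b tvec) \<Rightarrow> 'm \<Rightarrow> 'b tvec" where
  "frame_pullback_connection X S p k = (\<Sum>a=1..DIM('k). (X p (\<lambda>q. tgt.coord (\<phi> q) (S q) a) +
     (\<Sum>b=1..DIM('k). tgt.coord (\<phi> p) (S p) b * pullback_coefficient a b p (X p))) * \<epsilon> a (\<phi> p) k)"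

lemma frame_pullback_connection_linear: "linear_connection M W B \<phi> frame_pullback_connection"
proof -
  have "linear_connection M W B \<phi> (\<lambda>X S p k. \<Sum>a=1..DIM('k). (X p (\<lambda>q. (\<lambda>q. tgt.coord (\<phi> q)) q (S q) a) +
     (\<Sum>b=1..DIM('k). (\<lambda>q. tgt.coord (\<phi> q)) p (S p) b * pullback_coefficient a b p (X p))) * (\<lambda>a p. \<epsilon> a (\<phi> p)) a p k)"
  proof (rule linear_connection_from_coefficients, goal_cases)
    case (1 a) then show ?case by (intro vfield_pullback_sect tgt.frame_vfield)
  next
    case (2 S a) then show ?case by (rule coord_sect_smooth)
  next
    case (3 p u v a) then show ?case using tgt.coord_add[OF W_V] by blast
  next
    case (4 p u c a) then show ?case using tgt.coord_scale[OF W_V] by blast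
  next
    case (5 p w) then show ?case using tgt.frame_expand[OF W_V] by blast
  next
    case (6 X a b)
    then show ?case
      unfolding pullback_coefficient_def
      by (intro src.smooth_fun_sum src.smooth_fun_mult W_open coord_sect_smooth differential_sect
          vfield_pullback_sect tgt.nabla_vfield tgt.frame_vfield)
  next
    case (7 p u v a b)
    then show ?case
      unfolding pullback_coefficient_def differential_add
      by (simp add: tgt.coord_add[OF W_V] differential_tangent distrib_right sum.distrib)
  next
    case (8 p u c a b)
    then show ?case
      unfolding pullback_coefficient_def differential_scale
      by (simp add: tgt.coord_scale[OF W_V] differential_tangent sum_distrib_left mult.assoc)
  qed
  then show ?thesis unfolding frame_pullback_connection_def[abs_def] .
qed

text \<open>This is the property that characterises the pull-back connection. It holds since
  \<open>(Z y) \<circ> \<phi> = X (y \<circ> \<phi>)\<close> for the coordinates \<open>y\<close> of \<open>Y\<close> if \<open>Z\<close> is the image of \<open>X\<close>.\<close>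

lemma frame_pullback_connection_along:
  assumes X: "vfield M W X" and Y: "vfield B V Y" and Z: "vfield B V Z" and p: "p \<in> W"
    and XZ: "Z (\<phi> p) = push p (X p)"
  shows "frame_pullback_connection X (\<lambda>q. Y (\<phi> q)) p = tgt.nabla Z Y (\<phi> p)"
proof
  fix k
  note q = W_V[OF p]
  let ?y = "\<lambda>b q. tgt.coord q (Y q) b"
  let ?I = "{1..DIM('k)}"
  have y: "smooth_fun B V (?y b)" if "b \<in> ?I" for b using tgt.coord_smooth[OF Y that] .
  have "tgt.nabla Z Y (\<phi> p) = tgt.nabla Z (\<lambda>q f. \<Sum>b\<in>?I. ?y b q * \<epsilon> b q f) (\<phi> p)"
    by (rule tgt.LC.conn_cong[OF Z Z refl Y _ _ q])
      (use tgt.frame_expand[OF _ tgt.vfieldD[OF Y]] in \<open>auto intro!: tgt.vfield_sum y tgt.frame_vfield\<close>)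
  also have "\<dots> = (\<lambda>k. \<Sum>b\<in>?I. Z (\<phi> p) (?y b) * \<epsilon> b (\<phi> p) k + ?y b (\<phi> p) * tgt.nabla Z (\<epsilon> b) (\<phi> p) k)"
    by (rule tgt.LC.conn_sum_S[OF Z q]) (auto intro: y tgt.frame_vfield)
  finally have "tgt.nabla Z Y (\<phi> p) k
      = (\<Sum>b\<in>?I. Z (\<phi> p) (?y b) * \<epsilon> b (\<phi> p) k + ?y b (\<phi> p) * tgt.nabla Z (\<epsilon> b) (\<phi> p) k)" by simp
  also have "\<dots> = (\<Sum>b\<in>?I. X p (\<lambda>q. ?y b (\<phi> q)) * \<epsilon> b (\<phi> p) k
      + ?y b (\<phi> p) * (\<Sum>a\<in>?I. pullback_coefficient a b p (X p) * \<epsilon> a (\<phi> p) k))"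
  proof (intro sum.cong refl arg_cong2[of _ _ _ _ "(+)"] arg_cong2[of _ _ _ _ "(*)"])
    fix b assume b: "b \<in> ?I"
    show "Z (\<phi> p) (?y b) = X p (\<lambda>q. ?y b (\<phi> q))"
      unfolding XZ differential_def using tgt.smooth_at_U[OF y[OF b] q] by (simp add: o_def)
    have n: "tgt.nabla (\<epsilon> c) (\<epsilon> b) (\<phi> p) \<in> tangent_space B (\<phi> p)" if "c \<in> ?I" for c
      using tgt.vfieldD[OF tgt.nabla_vfield[OF tgt.frame_vfield[OF that] tgt.frame_vfield[OF b]] q] .
    have "tgt.nabla Z (\<epsilon> b) (\<phi> p) k = (\<Sum>c\<in>?I. tgt.coord (\<phi> p) (Z (\<phi> p)) c * tgt.nabla (\<epsilon> c) (\<epsilon> b) (\<phi> p) k)"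
      by (rule tgt.tensorial_expand[OF tgt.nabla_tensorial[OF tgt.frame_vfield[OF b]] Z q])
    also have "\<dots> = (\<Sum>c\<in>?I. \<Sum>a\<in>?I. tgt.coord (\<phi> p) (Z (\<phi> p)) c *
        (tgt.coord (\<phi> p) (tgt.nabla (\<epsilon> c) (\<epsilon> b) (\<phi> p)) a * \<epsilon> a (\<phi> p) k))"
      unfolding sum_distrib_left[symmetric]
      by (intro sum.cong refl arg_cong2[of _ _ _ _ "(*)"] fun_cong[OF tgt.frame_expand[OF q]] n)
    also have "\<dots> = (\<Sum>a\<in>?I. pullback_coefficient a b p (X p) * \<epsilon> a (\<phi> p) k)"
      unfolding pullback_coefficient_def sum_distrib_right XZ by (subst sum.swap) (simp add: mult.assoc)
    finally show "tgt.nabla Z (\<epsilon> b) (\<phi> p) k = (\<Sum>a\<in>?I. pullback_coefficient a b p (X p) * \<epsilon> a (\<phi> p) k)" .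
  qed
  also have "\<dots> = (\<Sum>b\<in>?I. X p (\<lambda>q. ?y b (\<phi> q)) * \<epsilon> b (\<phi> p) k)
      + (\<Sum>a\<in>?I. \<Sum>b\<in>?I. ?y b (\<phi> p) * pullback_coefficient a b p (X p) * \<epsilon> a (\<phi> p) k)"
    unfolding sum.distrib sum_distrib_left by (subst (2) sum.swap) (simp add: mult.assoc)
  also have "\<dots> = frame_pullback_connection X (\<lambda>q. Y (\<phi> q)) p k"
    unfolding frame_pullback_connection_def distrib_right sum.distrib sum_distrib_right ..
  finally show "frame_pullback_connection X (\<lambda>q. Y (\<phi> q)) p k = tgt.nabla Z Y (\<phi> p) k" ..
qed

abbreviation pb :: "('m \<Rightarrow> 'm tvec) \<Rightarrow> ('m \<Rightarrow> 'b tvec) \<Rightarrow> 'm \<Rightarrow> 'b tvec" where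
  "pb \<equiv> pullback_connection M W B h V \<phi>"

lemma pullback_connection_exists: "is_pullback_connection M W B h V \<phi> pb"
  unfolding pullback_connection_def
proof (rule someI[of _ frame_pullback_connection])
  show "is_pullback_connection M W B h V \<phi> frame_pullback_connection"
    unfolding is_pullback_connection_def linear_connection_def[symmetric]
    by (intro conjI allI impI ballI frame_pullback_connection_linear frame_pullback_connection_along; elim conjE)
qed

lemmas pullback_axioms =
  pullback_connection_exists[unfolded is_pullback_connection_def, folded linear_connection_def]

sublocale PB: connection M B h s W \<phi> pb
  by unfold_locales (rule pullback_axioms[THEN conjunct1])

lemma pullback_along:
  "vfield M W X \<Longrightarrow> vfield B V Y \<Longrightarrow> vfield B V Z \<Longrightarrow> p \<in> W \<Longrightarrow> Z (\<phi> p) = push p (X p) \<Longrightarrow>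
    pb X (\<lambda>q. Y (\<phi> q)) p = tgt.nabla Z Y (\<phi> p)"
  by (rule pullback_axioms[THEN conjunct2, rule_format, of X Y Z p]) auto

end

context framed
begin

lemma metric_combination:
  assumes "p \<in> U" "k \<in> {1..DIM('e)}"
  shows "g p (\<lambda>f. \<Sum>i=1..DIM('e). c i * e i p f) (e k p) = c k * sign k p"
proof -
  have "g p (\<lambda>f. \<Sum>i=1..DIM('e). c i * e i p f) (e k p) = (\<Sum>i=1..DIM('e). c i * g p (e i p) (e k p))"
    using assms by (intro metric_sum in_carrier frame_tangent)
  also have "\<dots> = (\<Sum>i=1..DIM('e). if k = i then c k * sign k p else 0)"
    using frame_orthogonal[OF assms(1) _ assms(2)] by (intro sum.cong) (auto simp: sign_def)
  finally show ?thesis using assms(2) by simp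
qed

text \<open>The curvature at a point is evaluated on vector fields, so single tangent vectors have to be extended.\<close>

definition const_ext :: "'m \<Rightarrow> 'm tvec \<Rightarrow> 'm \<Rightarrow> 'm tvec" where
  "const_ext p v q f = (\<Sum>i=1..DIM('e). coord p v i * e i q f)"

lemma const_ext_vfield: "vfield M U (const_ext p v)"
  unfolding const_ext_def[abs_def] by (intro vfield_sum smooth_fun_const frame_vfield)

lemma const_ext_at: "p \<in> U \<Longrightarrow> v \<in> tangent_space M p \<Longrightarrow> const_ext p v p = v"
  using frame_expand[of p v] by (simp add: const_ext_def[abs_def])

lemma riemann_at_const_ext:
  "p \<in> U \<Longrightarrow> u \<in> tangent_space M p \<Longrightarrow> v \<in> tangent_space M p \<Longrightarrow> w \<in> tangent_space M p \<Longrightarrow>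
    riemann_at M g U p u v w = riemann M g U (const_ext p u) (const_ext p v) (const_ext p w) p"
  using riemann_at_eq[OF const_ext_vfield[of p u] const_ext_vfield[of p v] const_ext_vfield[of p w], of p]
  by (simp add: const_ext_at)

context
  fixes p u u' v w :: _ and c :: real
  assumes p: "p \<in> U" and u: "u \<in> tangent_space M p" and u': "u' \<in> tangent_space M p"
    and v: "v \<in> tangent_space M p" and w: "w \<in> tangent_space M p"
begin

lemma riemann_at_add_1:
  "riemann_at M g U p (\<lambda>f. u f + u' f) v w k = riemann_at M g U p u v w k + riemann_at M g U p u' v w k"
  using riemann_at_eq[OF vfield_add[OF const_ext_vfield[of p u] const_ext_vfield[of p u']]
      const_ext_vfield[of p v] const_ext_vfield[of p w] p]
    tensorial_add[OF curvature_tensorial_1[OF const_ext_vfield[of p v] const_ext_vfield[of p w], of k]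
      const_ext_vfield[of p u] const_ext_vfield[of p u'] p]
  by (simp add: const_ext_at p u u' v w riemann_at_const_ext)

lemma riemann_at_scale_1:
  "riemann_at M g U p (\<lambda>f. c * u f) v w k = c * riemann_at M g U p u v w k"
  using riemann_at_eq[OF vfield_scale_const[OF const_ext_vfield[of p u]]
      const_ext_vfield[of p v] const_ext_vfield[of p w] p, of c]
    tensorial_scale[OF curvature_tensorial_1[OF const_ext_vfield[of p v] const_ext_vfield[of p w], of k]
      const_ext_vfield[of p u] smooth_fun_const p, of c]
  by (simp add: const_ext_at p u u' v w riemann_at_const_ext)

lemma riemann_at_add_3:
  "riemann_at M g U p v w (\<lambda>f. u f + u' f) k = riemann_at M g U p v w u k + riemann_at M g U p v w u' k"
  using riemann_at_eq[OF const_ext_vfield[of p v] const_ext_vfield[of p w]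
      vfield_add[OF const_ext_vfield[of p u] const_ext_vfield[of p u']] p]
    tensorial_add[OF curvature_tensorial_3[OF const_ext_vfield[of p v] const_ext_vfield[of p w], of k]
      const_ext_vfield[of p u] const_ext_vfield[of p u'] p]
  by (simp add: const_ext_at p u u' v w riemann_at_const_ext)

lemma riemann_at_scale_3:
  "riemann_at M g U p v w (\<lambda>f. c * u f) k = c * riemann_at M g U p v w u k"
  using riemann_at_eq[OF const_ext_vfield[of p v] const_ext_vfield[of p w]
      vfield_scale_const[OF const_ext_vfield[of p u]] p, of c]
    tensorial_scale[OF curvature_tensorial_3[OF const_ext_vfield[of p v] const_ext_vfield[of p w], of k]
      const_ext_vfield[of p u] smooth_fun_const p, of c]
  by (simp add: const_ext_at p u u' v w riemann_at_const_ext)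

end

end

section \<open>Framed surfaces and their Gauss curvature\<close>

lemma sum_DIM_2: "(\<Sum>i=1..DIM(real^2). c i) = c 1 + (c 2 :: real)"
  by (simp add: numeral_2_eq_2)

lemma sum_DIM_3: "(\<Sum>i=1..DIM(real^3). c i) = c 1 + c 2 + (c 3 :: real)"
  by (simp add: numeral_3_eq_3 numeral_2_eq_2)

lemma index_2: "1 \<in> {1..DIM(real^2)}" "2 \<in> {1..DIM(real^2)}" by auto

lemma index_3: "1 \<in> {1..DIM(real^3)}" "2 \<in> {1..DIM(real^3)}" "3 \<in> {1..DIM(real^3)}" by auto

(* The frame indices 1 and 2 stay numerals, so that they match the values recorded for the frame. *)
declare One_nat_def [simp del]

locale framed_surface = framed B h s V \<epsilon>
  for B :: "('b::{t2_space,second_countable_topology}, real^2) atlas" and h s V \<epsilon> +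
  fixes L1 L2 :: "'b \<Rightarrow> real"
  assumes L_smooth: "smooth_fun B V L1" "smooth_fun B V L2"
    and frame_bracket: "\<And>q. q \<in> V \<Longrightarrow> bracket B (\<epsilon> 1) (\<epsilon> 2) q = (\<lambda>f. L1 q * \<epsilon> 1 q f + L2 q * \<epsilon> 2 q f)"
begin

lemmas frame_fields = frame_vfield[OF index_2(1)] frame_vfield[OF index_2(2)]

lemma expand_2:
  assumes "q \<in> V" "v \<in> tangent_space B q"
  shows "v = (\<lambda>f. coord q v 1 * \<epsilon> 1 q f + coord q v 2 * \<epsilon> 2 q f)"
  using frame_expand[OF assms] unfolding sum_DIM_2 .

lemma frame_bracket_metric:
  assumes "q \<in> V"
  shows "h q (bracket B (\<epsilon> 1) (\<epsilon> 2) q) (\<epsilon> 1 q) = L1 q * sign 1 q"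
    "h q (bracket B (\<epsilon> 1) (\<epsilon> 2) q) (\<epsilon> 2 q) = L2 q * sign 2 q"
  using metric_combination[OF assms index_2(1), where c="\<lambda>i. if i = 1 then L1 q else L2 q"]
    metric_combination[OF assms index_2(2), where c="\<lambda>i. if i = 1 then L1 q else L2 q"]
  unfolding sum_DIM_2 frame_bracket[OF assms] by simp_all

lemma nabla_metric_values:
  assumes q: "q \<in> V"
  shows "h q (nabla (\<epsilon> 1) (\<epsilon> 1) q) (\<epsilon> 1 q) = 0" "h q (nabla (\<epsilon> 1) (\<epsilon> 1) q) (\<epsilon> 2 q) = - L1 q * sign 1 q"
    "h q (nabla (\<epsilon> 1) (\<epsilon> 2) q) (\<epsilon> 1 q) = L1 q * sign 1 q" "h q (nabla (\<epsilon> 1) (\<epsilon> 2) q) (\<epsilon> 2 q) = 0"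
    "h q (nabla (\<epsilon> 2) (\<epsilon> 1) q) (\<epsilon> 1 q) = 0" "h q (nabla (\<epsilon> 2) (\<epsilon> 1) q) (\<epsilon> 2 q) = - L2 q * sign 2 q"
    "h q (nabla (\<epsilon> 2) (\<epsilon> 2) q) (\<epsilon> 1 q) = L2 q * sign 2 q" "h q (nabla (\<epsilon> 2) (\<epsilon> 2) q) (\<epsilon> 2 q) = 0"
proof -
  note i = index_2
  show 1: "h q (nabla (\<epsilon> 1) (\<epsilon> 1) q) (\<epsilon> 2 q) = - L1 q * sign 1 q"
    using nabla_frame_self[OF i q] frame_bracket_metric[OF q] by simp
  show 2: "h q (nabla (\<epsilon> 2) (\<epsilon> 2) q) (\<epsilon> 1 q) = L2 q * sign 2 q"
    using nabla_frame_self[OF i(2,1) q] bracket_swap_metric[OF q i i(2)] frame_bracket_metric[OF q] by simp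
  show "h q (nabla (\<epsilon> 1) (\<epsilon> 2) q) (\<epsilon> 1 q) = L1 q * sign 1 q"
    using nabla_frame_skew[OF frame_fields(1) i(2,1) q] 1 by simp
  show "h q (nabla (\<epsilon> 2) (\<epsilon> 1) q) (\<epsilon> 2 q) = - L2 q * sign 2 q"
    using nabla_frame_skew[OF frame_fields(2) i q] 2 by simp
  show "h q (nabla (\<epsilon> 1) (\<epsilon> 1) q) (\<epsilon> 1 q) = 0" "h q (nabla (\<epsilon> 1) (\<epsilon> 2) q) (\<epsilon> 2 q) = 0"
    "h q (nabla (\<epsilon> 2) (\<epsilon> 1) q) (\<epsilon> 1 q) = 0" "h q (nabla (\<epsilon> 2) (\<epsilon> 2) q) (\<epsilon> 2 q) = 0"
    using nabla_frame_skew[OF frame_fields(1) i(1,1) q] nabla_frame_skew[OF frame_fields(1) i(2,2) q]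
      nabla_frame_skew[OF frame_fields(2) i(1,1) q] nabla_frame_skew[OF frame_fields(2) i(2,2) q] by simp_all
qed

lemma nabla_frame:
  assumes q: "q \<in> V"
  shows "nabla (\<epsilon> 1) (\<epsilon> 1) q = (\<lambda>f. - (sign 1 q * sign 2 q * L1 q) * \<epsilon> 2 q f)"
    "nabla (\<epsilon> 1) (\<epsilon> 2) q = (\<lambda>f. L1 q * \<epsilon> 1 q f)"
    "nabla (\<epsilon> 2) (\<epsilon> 1) q = (\<lambda>f. - L2 q * \<epsilon> 2 q f)"
    "nabla (\<epsilon> 2) (\<epsilon> 2) q = (\<lambda>f. sign 1 q * sign 2 q * L2 q * \<epsilon> 1 q f)"
proof -
  have t: "nabla (\<epsilon> i) (\<epsilon> j) q \<in> tangent_space B q" if "i \<in> {1..DIM(real^2)}" "j \<in> {1..DIM(real^2)}" for i j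
    using vfieldD[OF nabla_vfield[OF frame_vfield[OF that(1)] frame_vfield[OF that(2)]] q] .
  have sq': "sign 1 q * (x * sign 1 q) = x" "sign 2 q * (x * sign 2 q) = x" for x
    using sgn_cases[OF q index_2(1)] sgn_cases[OF q index_2(2)] by auto
  note c = coord_def nabla_metric_values[OF q]
  show "nabla (\<epsilon> 1) (\<epsilon> 1) q = (\<lambda>f. - (sign 1 q * sign 2 q * L1 q) * \<epsilon> 2 q f)"
    by (subst expand_2[OF q t[OF index_2(1,1)]]) (simp add: c mult_ac)
  show "nabla (\<epsilon> 1) (\<epsilon> 2) q = (\<lambda>f. L1 q * \<epsilon> 1 q f)"
    by (subst expand_2[OF q t[OF index_2(1,2)]]) (simp add: c sq')
  show "nabla (\<epsilon> 2) (\<epsilon> 1) q = (\<lambda>f. - L2 q * \<epsilon> 2 q f)"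
    by (subst expand_2[OF q t[OF index_2(2,1)]]) (simp add: c sq')
  show "nabla (\<epsilon> 2) (\<epsilon> 2) q = (\<lambda>f. sign 1 q * sign 2 q * L2 q * \<epsilon> 1 q f)"
    by (subst expand_2[OF q t[OF index_2(2,2)]]) (simp add: c mult_ac)
qed

text \<open>The Gauss curvature in terms of the structure functions of the frame.\<close>

definition gauss :: "'b \<Rightarrow> real" where
  "gauss q = sign 2 q * \<epsilon> 1 q L2 - sign 1 q * \<epsilon> 2 q L1 - sign 1 q * (L1 q)^2 - sign 2 q * (L2 q)^2"

lemma tangent_sgn_product:
  assumes q: "q \<in> V" and v: "v \<in> tangent_space B q" and f: "smooth_fun B V f"
  shows "v (\<lambda>q. sign 1 q * sign 2 q * f q) = sign 1 q * sign 2 q * v f"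
proof -
  note s = smooth_at_U[OF sgn_smooth[OF index_2(1)] q] smooth_at_U[OF sgn_smooth[OF index_2(2)] q]
  show ?thesis
    using tv_mult[OF v smooth_at_mult[OF s] smooth_at_U[OF f q]] tv_mult[OF v s]
      tangent_sgn[OF q index_2(1) v] tangent_sgn[OF q index_2(2) v] by simp
qed

text \<open>In dimension 2 the curvature operator \<open>R(\<epsilon>\<^sub>1, \<epsilon>\<^sub>2)\<close> is an infinitesimal isometry: it is the Gauss
  curvature times the map that exchanges the frame vectors up to sign.\<close>

lemma curvature_frame:
  assumes q: "q \<in> V"
  shows "riemann B h V (\<epsilon> 1) (\<epsilon> 2) (\<epsilon> 1) q = (\<lambda>f. - sign 2 q * gauss q * \<epsilon> 2 q f)"
    "riemann B h V (\<epsilon> 1) (\<epsilon> 2) (\<epsilon> 2) q = (\<lambda>f. sign 1 q * gauss q * \<epsilon> 1 q f)"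
proof -
  note et = vfieldD[OF frame_fields(1) q] vfieldD[OF frame_fields(2) q]
  note ss = smooth_fun_mult[OF dom_open smooth_fun_mult[OF dom_open sgn_smooth[OF index_2(1)] sgn_smooth[OF index_2(2)]]]
  have lf: "nabla X (nabla Y Z) q = (\<lambda>k. X q c * T q k + c q * nabla X T q k)"
    if "vfield B V X" "vfield B V Y" "vfield B V Z" "vfield B V T" "smooth_fun B V c"
      "\<And>q. q \<in> V \<Longrightarrow> nabla Y Z q = (\<lambda>f. c q * T q f)" for X Y Z T c
  proof -
    have "nabla X (nabla Y Z) q = nabla X (\<lambda>q f. c q * T q f) q"
      using that by (intro LC.conn_cong nabla_vfield vfield_scale q) auto
    then show ?thesis using LC.conn_leibniz[OF that(1,4,5) q] by simp
  qed
  have br: "nabla (bracket B (\<epsilon> 1) (\<epsilon> 2)) Z q k = L1 q * nabla (\<epsilon> 1) Z q k + L2 q * nabla (\<epsilon> 2) Z q k"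
    if Z: "vfield B V Z" for Z k
    using tensorial_expand[OF nabla_tensorial[OF Z, of k] vfield_bracket[OF dom_open dom_carrier frame_fields] q]
      sgn_cases[OF q index_2(1)] sgn_cases[OF q index_2(2)]
    unfolding sum_DIM_2 coord_def frame_bracket_metric[OF q] by auto
  have L1': "smooth_fun B V (\<lambda>q. - (sign 1 q * sign 2 q * L1 q))"
    by (intro smooth_fun_minus dom_open ss L_smooth)
  have L2': "smooth_fun B V (\<lambda>q. sign 1 q * sign 2 q * L2 q)"
    by (intro ss L_smooth)
  have L2'': "smooth_fun B V (\<lambda>q. - L2 q)" by (intro smooth_fun_minus dom_open L_smooth)
  have v1: "\<epsilon> 2 q (\<lambda>q. - (sign 1 q * sign 2 q * L1 q)) = - (sign 1 q * sign 2 q * \<epsilon> 2 q L1)"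
    using tv_minus[OF et(2) smooth_at_U[OF ss[OF L_smooth(1)] q]] tangent_sgn_product[OF q et(2) L_smooth(1)] by simp
  have v2: "\<epsilon> 1 q (\<lambda>q. - L2 q) = - \<epsilon> 1 q L2"
    using tv_minus[OF et(1) smooth_at_U[OF L_smooth(2) q]] .
  have dd: "nabla (\<epsilon> 1) (nabla (\<epsilon> 2) (\<epsilon> 1)) q
        = (\<lambda>k. \<epsilon> 1 q (\<lambda>q. - L2 q) * \<epsilon> 2 q k + - L2 q * nabla (\<epsilon> 1) (\<epsilon> 2) q k)"
    "nabla (\<epsilon> 2) (nabla (\<epsilon> 1) (\<epsilon> 1)) q
        = (\<lambda>k. \<epsilon> 2 q (\<lambda>q. - (sign 1 q * sign 2 q * L1 q)) * \<epsilon> 2 q k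
            + - (sign 1 q * sign 2 q * L1 q) * nabla (\<epsilon> 2) (\<epsilon> 2) q k)"
    "nabla (\<epsilon> 1) (nabla (\<epsilon> 2) (\<epsilon> 2)) q
        = (\<lambda>k. \<epsilon> 1 q (\<lambda>q. sign 1 q * sign 2 q * L2 q) * \<epsilon> 1 q k
            + sign 1 q * sign 2 q * L2 q * nabla (\<epsilon> 1) (\<epsilon> 1) q k)"
    "nabla (\<epsilon> 2) (nabla (\<epsilon> 1) (\<epsilon> 2)) q
        = (\<lambda>k. \<epsilon> 2 q L1 * \<epsilon> 1 q k + L1 q * nabla (\<epsilon> 2) (\<epsilon> 1) q k)"
    by (rule lf[OF frame_fields(1) frame_fields(2) frame_fields(1) frame_fields(2) L2'' nabla_frame(3)], assumption,
        rule lf[OF frame_fields(2) frame_fields(1) frame_fields(1) frame_fields(2) L1' nabla_frame(1)], assumption,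
        rule lf[OF frame_fields(1) frame_fields(2) frame_fields(2) frame_fields(1) L2' nabla_frame(4)], assumption,
        rule lf[OF frame_fields(2) frame_fields(1) frame_fields(2) frame_fields(1) L_smooth(1) nabla_frame(2)])
  have cases: "sign 1 q = 1 \<or> sign 1 q = -1" "sign 2 q = 1 \<or> sign 2 q = -1"
    using sgn_cases[OF q] index_2 by blast+
  show "riemann B h V (\<epsilon> 1) (\<epsilon> 2) (\<epsilon> 1) q = (\<lambda>f. - sign 2 q * gauss q * \<epsilon> 2 q f)"
    unfolding riemann_def Let_def br[OF frame_fields(1)] dd nabla_frame[OF q] v1 v2 gauss_def
    using cases by (auto simp: algebra_simps power2_eq_square)
  show "riemann B h V (\<epsilon> 1) (\<epsilon> 2) (\<epsilon> 2) q = (\<lambda>f. sign 1 q * gauss q * \<epsilon> 1 q f)"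
    unfolding riemann_def Let_def br[OF frame_fields(2)] dd nabla_frame[OF q] tangent_sgn_product[OF q et(1) L_smooth(2)] gauss_def
    using cases by (auto simp: algebra_simps power2_eq_square)
qed

lemma R1221_gauss:
  assumes q: "q \<in> V"
  shows "R1221 B h V \<epsilon> q = gauss q"
  unfolding R1221_def curvature_frame(2)[OF q]
  using metric_scale[OF in_carrier[OF q] frame_tangent[OF index_2(1) q] frame_tangent[OF index_2(1) q]]
    sgn_cases[OF q index_2(1)]
  by (auto simp: sign_def[symmetric])

end

section \<open>Tension and bitension fields do not depend on the frame\<close>

context surface_map
begin

lemma riemann_tgt_tensor:
  assumes "p \<in> W" "u \<in> tangent_space M p" "u' \<in> tangent_space M p" "v \<in> tangent_space B (\<phi> p)" "w \<in> tangent_space M p"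
  shows "riemann_at B h V (\<phi> p) (push p (\<lambda>f. u f + u' f)) v (push p w) k
      = riemann_at B h V (\<phi> p) (push p u) v (push p w) k
      + riemann_at B h V (\<phi> p) (push p u') v (push p w) k"
    "riemann_at B h V (\<phi> p) (push p (\<lambda>f. c * u f)) v (push p w) k
      = c * riemann_at B h V (\<phi> p) (push p u) v (push p w) k"
    "riemann_at B h V (\<phi> p) (push p w) v (push p (\<lambda>f. u f + u' f)) k
      = riemann_at B h V (\<phi> p) (push p w) v (push p u) k
      + riemann_at B h V (\<phi> p) (push p w) v (push p u') k"
    "riemann_at B h V (\<phi> p) (push p w) v (push p (\<lambda>f. c * u f)) k
      = c * riemann_at B h V (\<phi> p) (push p w) v (push p u) k"
  unfolding differential_add differential_scale
  using assms
  by (auto intro!: tgt.riemann_at_add_1 tgt.riemann_at_scale_1 tgt.riemann_at_add_3 tgt.riemann_at_scale_3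
      W_V differential_tangent)

end

locale framed_surface_map = surface_map M B h s V \<epsilon> W \<phi> + src: framed M g r W e
  for M :: "('m::{t2_space,second_countable_topology}, 'e::euclidean_space) atlas"
    and B :: "('b::{t2_space,second_countable_topology}, 'k::euclidean_space) atlas"
    and h s V \<epsilon> W \<phi> g r e
begin

text \<open>The second fundamental form \<open>\<nabla>d\<phi>(X, Y) = D\<^sub>X (d\<phi> Y) - d\<phi> (\<nabla>\<^sub>X Y)\<close>, whose trace is the tension
  field. The Leibniz terms of the two summands cancel.\<close>

lemma second_fundamental_tensorial:
  "vfield M W Y \<Longrightarrow> src.tensorial (\<lambda>X p. pb X (\<lambda>q. push q (Y q)) p k - push p (src.nabla X Y p) k)"
  "vfield M W X \<Longrightarrow> src.tensorial (\<lambda>Y p. pb X (\<lambda>q. push q (Y q)) p k - push p (src.nabla X Y p) k)"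
proof -
  assume Y: "vfield M W Y"
  show "src.tensorial (\<lambda>X p. pb X (\<lambda>q. push q (Y q)) p k - push p (src.nabla X Y p) k)"
    unfolding src.tensorial_def
  proof (intro allI impI, elim conjE, goal_cases)
    case (1 X X' f p)
    note X = 1(1) and X' = 1(2) and f = 1(3) and p = 1(4)
    note d = differential_sect[OF Y]
    show ?case
      unfolding PB.conn_add_X[OF X X' d p] PB.conn_scale_X[OF X d f p]
        src.LC.conn_add_X[OF X X' Y p] src.LC.conn_scale_X[OF X Y f p] differential_add differential_scale
      by (simp add: algebra_simps)
  qed
next
  assume X: "vfield M W X"
  show "src.tensorial (\<lambda>Y p. pb X (\<lambda>q. push q (Y q)) p k - push p (src.nabla X Y p) k)"
    unfolding src.tensorial_def
  proof (intro allI impI, elim conjE, goal_cases)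
    case (1 Y Y' f p)
    note Y = 1(1) and Y' = 1(2) and f = 1(3) and p = 1(4)
    note d = differential_sect[OF Y] and d' = differential_sect[OF Y']
    show ?case
      unfolding differential_add differential_scale PB.conn_add_S[OF X d d' p] PB.conn_leibniz[OF X d f p]
        src.LC.conn_add_S[OF X Y Y' p] src.LC.conn_leibniz[OF X Y f p]
      by (simp add: algebra_simps)
  qed
qed

lemma tension_frame_independent:
  assumes e': "orthonormal_frame M g W e'" and p: "p \<in> W"
  shows "tension M g W B h V \<phi> e' p = tension M g W B h V \<phi> e p"
  using src.trace_frame_independent[OF second_fundamental_tensorial e' p]
  unfolding tension_def src.sign_def by (intro ext)

text \<open>The bilinear form whose trace is the bitension field, for a section \<open>T\<close> in place of the tension field:
  the second covariant derivative of \<open>T\<close> minus a curvature term.\<close>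

definition bitension_form where
  "bitension_form T k X Y p = pb X (pb Y T) p k - pb (src.nabla X Y) T p k
     - riemann_at B h V (\<phi> p) (push p (X p)) (T p) (push p (Y p)) k"

lemma bitension_form_tensorial_1:
  assumes T: "sect T" and Y: "vfield M W Y"
  shows "src.tensorial (\<lambda>X. bitension_form T k X Y)"
  unfolding src.tensorial_def
proof (intro allI impI, elim conjE, goal_cases)
  case (1 X X' f p)
  note X = 1(1) and X' = 1(2) and f = 1(3) and p = 1(4)
  note DT = PB.conn_sect[OF Y T] and tv = src.vfieldD[OF X p] src.vfieldD[OF X' p] sectD[OF T p] src.vfieldD[OF Y p]
  have 1: "pb (src.nabla (\<lambda>q h. X q h + X' q h) Y) T p = (\<lambda>k. pb (src.nabla X Y) T p k + pb (src.nabla X' Y) T p k)"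
  proof -
    have "pb (src.nabla (\<lambda>q h. X q h + X' q h) Y) T p = pb (\<lambda>q h. src.nabla X Y q h + src.nabla X' Y q h) T p"
      by (intro PB.conn_cong src.nabla_vfield src.vfield_add X X' Y T p refl src.LC.conn_add_X)
    also have "\<dots> = (\<lambda>k. pb (src.nabla X Y) T p k + pb (src.nabla X' Y) T p k)"
      by (intro PB.conn_add_X src.nabla_vfield X X' Y T p)
    finally show ?thesis .
  qed
  have 2: "pb (src.nabla (\<lambda>q h. f q * X q h) Y) T p = (\<lambda>k. f p * pb (src.nabla X Y) T p k)"
  proof -
    have "pb (src.nabla (\<lambda>q h. f q * X q h) Y) T p = pb (\<lambda>q h. f q * src.nabla X Y q h) T p"
      by (intro PB.conn_cong src.nabla_vfield src.vfield_scale X f Y T p refl src.LC.conn_scale_X)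
    also have "\<dots> = (\<lambda>k. f p * pb (src.nabla X Y) T p k)"
      by (intro PB.conn_scale_X src.nabla_vfield X Y T p f)
    finally show ?thesis .
  qed
  show ?case
    unfolding bitension_form_def 1 2 PB.conn_add_X[OF X X' DT p] PB.conn_scale_X[OF X DT f p]
      riemann_tgt_tensor(1,2)[OF p tv(1,2,3,4)]
    by (simp add: algebra_simps)
qed

lemma bitension_form_tensorial_2:
  assumes T: "sect T" and X: "vfield M W X"
  shows "src.tensorial (bitension_form T k X)"
  unfolding src.tensorial_def
proof (intro allI impI, elim conjE, goal_cases)
  case (1 Y Y' f p)
  note Y = 1(1) and Y' = 1(2) and f = 1(3) and p = 1(4)
  note DT = PB.conn_sect[OF Y T] and DT' = PB.conn_sect[OF Y' T]
    and tv = src.vfieldD[OF Y p] src.vfieldD[OF Y' p] sectD[OF T p] src.vfieldD[OF X p]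
  have Xf: "smooth_fun M W (\<lambda>q. X q f)" by (intro src.vfield_smooth[OF X] W_open f order_refl)
  have 1: "pb (src.nabla X (\<lambda>q h. Y q h + Y' q h)) T p = (\<lambda>k. pb (src.nabla X Y) T p k + pb (src.nabla X Y') T p k)"
  proof -
    have "pb (src.nabla X (\<lambda>q h. Y q h + Y' q h)) T p = pb (\<lambda>q h. src.nabla X Y q h + src.nabla X Y' q h) T p"
      by (intro PB.conn_cong src.nabla_vfield src.vfield_add X Y' Y T p refl src.LC.conn_add_S)
    also have "\<dots> = (\<lambda>k. pb (src.nabla X Y) T p k + pb (src.nabla X Y') T p k)"
      by (intro PB.conn_add_X src.nabla_vfield X Y' Y T p)
    finally show ?thesis .
  qed
  have 2: "pb (src.nabla X (\<lambda>q h. f q * Y q h)) T p = (\<lambda>k. X p f * pb Y T p k + f p * pb (src.nabla X Y) T p k)"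
  proof -
    have "pb (src.nabla X (\<lambda>q h. f q * Y q h)) T p
        = pb (\<lambda>q h. (\<lambda>q h. X q f * Y q h) q h + (\<lambda>q h. f q * src.nabla X Y q h) q h) T p"
      by (intro PB.conn_cong src.nabla_vfield src.vfield_scale src.vfield_add X f Xf Y T p refl src.LC.conn_leibniz)
    also have "\<dots> = (\<lambda>k. pb (\<lambda>q h. X q f * Y q h) T p k + pb (\<lambda>q h. f q * src.nabla X Y q h) T p k)"
      by (intro PB.conn_add_X src.nabla_vfield src.vfield_scale X Y T p f Xf)
    finally show ?thesis
      unfolding PB.conn_scale_X[OF Y T Xf p] PB.conn_scale_X[OF src.nabla_vfield[OF X Y] T f p] .
  qed
  have 3: "pb X (pb (\<lambda>q h. Y q h + Y' q h) T) p = (\<lambda>k. pb X (pb Y T) p k + pb X (pb Y' T) p k)"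
  proof -
    have "pb X (pb (\<lambda>q h. Y q h + Y' q h) T) p = pb X (\<lambda>q h. pb Y T q h + pb Y' T q h) p"
      by (intro PB.conn_cong PB.conn_sect sect_add src.vfield_add X Y' Y T p refl PB.conn_add_X)
    also have "\<dots> = (\<lambda>k. pb X (pb Y T) p k + pb X (pb Y' T) p k)"
      by (intro PB.conn_add_S X DT DT' p)
    finally show ?thesis .
  qed
  have 4: "pb X (pb (\<lambda>q h. f q * Y q h) T) p = (\<lambda>k. X p f * pb Y T p k + f p * pb X (pb Y T) p k)"
  proof -
    have "pb X (pb (\<lambda>q h. f q * Y q h) T) p = pb X (\<lambda>q h. f q * pb Y T q h) p"
      by (intro PB.conn_cong PB.conn_sect sect_scale src.vfield_scale X f Y T p refl PB.conn_scale_X)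
    also have "\<dots> = (\<lambda>k. X p f * pb Y T p k + f p * pb X (pb Y T) p k)"
      by (intro PB.conn_leibniz X DT p f)
    finally show ?thesis .
  qed
  show ?case
    unfolding bitension_form_def 1 2 3 4 riemann_tgt_tensor(3,4)[OF p tv(1,2,3,4)]
    by (simp add: algebra_simps)
qed

text \<open>Biharmonicity quantifies over all orthonormal frames. As tension and bitension are traces of tensors, it
  is enough to compute in one frame.\<close>

lemma bitension_any_frame:
  assumes e': "orthonormal_frame M g W e'" and p: "p \<in> W"
    and T: "sect T" "\<And>q. q \<in> W \<Longrightarrow> tension M g W B h V \<phi> e q = T q"
  shows "bitension M g W B h V \<phi> e' p k = (\<Sum>i=1..DIM('e). src.sign i p * bitension_form T k (e i) (e i) p)"
proof -
  let ?t = "tension M g W B h V \<phi> e'"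
  interpret e': framed M g r W e'
    by unfold_locales (use W_open W_carrier e' in auto)
  have t: "?t q = T q" if "q \<in> W" for q
    using tension_frame_independent[OF e' that] T(2)[OF that] by simp
  have ts: "sect ?t" by (rule sect_cong[OF T(1)]) (simp add: t)
  have "bitension M g W B h V \<phi> e' p k = (\<Sum>i=1..DIM('e). g p (e' i p) (e' i p) * bitension_form T k (e' i) (e' i) p)"
    unfolding bitension_def Let_def bitension_form_def
  proof (intro sum.cong refl arg_cong2[of _ _ _ _ "(*)"] arg_cong2[of _ _ _ _ "(-)"])
    fix i assume i: "i \<in> {1..DIM('e)}"
    note v = e'.frame_vfield[OF i]
    have c: "pb X ?t q = pb X T q" if "vfield M W X" "q \<in> W" for X q
      by (rule PB.conn_cong[OF that(1,1) refl ts T(1) t that(2)])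
    have "pb (e' i) (pb (e' i) ?t) p = pb (e' i) (pb (e' i) T) p"
      by (rule PB.conn_cong[OF v v refl PB.conn_sect[OF v ts] PB.conn_sect[OF v T(1)] c[OF v] p])
    then show "pb (e' i) (pb (e' i) ?t) p k = pb (e' i) (pb (e' i) T) p k" by simp
    show "pb (src.nabla (e' i) (e' i)) ?t p k = pb (src.nabla (e' i) (e' i)) T p k"
      using c[OF src.nabla_vfield[OF v v] p] by simp
    show "riemann_at B h V (\<phi> p) (push p (e' i p)) (?t p) (push p (e' i p)) k
       = riemann_at B h V (\<phi> p) (push p (e' i p)) (T p) (push p (e' i p)) k"
      by (simp add: t[OF p])
  qed
  also have "\<dots> = (\<Sum>i=1..DIM('e). src.sign i p * bitension_form T k (e i) (e i) p)"
    by (rule src.trace_frame_independent[OF bitension_form_tensorial_1[OF T(1)] bitension_form_tensorial_2[OF T(1)] e' p])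
  finally show ?thesis .
qed

end

section \<open>Submersions in an adapted frame\<close>

text \<open>The data of the theorem over an open subset \<open>W\<close> of the domain of the adapted frame. As biharmonicity is
  tested on all such subsets, the locale is used for several \<open>W\<close> with the same frame.\<close>

locale adapted = framed_surface_map M B h s V \<epsilon> W \<pi> g r e + tgt: framed_surface B h s V \<epsilon> L1 L2
  for M :: "('m::{t2_space,second_countable_topology}, real^3) atlas"
    and B :: "('b::{t2_space,second_countable_topology}, real^2) atlas"
    and h s V \<epsilon> W \<pi> g r e L1 L2 +
  fixes l1 l2 lam \<mu> \<sigma> :: "'m \<Rightarrow> real" and \<delta>1 \<delta>2 \<delta>3 :: real
  assumes de: "\<And>p. p \<in> W \<Longrightarrow> push p (e 1 p) = \<epsilon> 1 (\<pi> p)"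
    "\<And>p. p \<in> W \<Longrightarrow> push p (e 2 p) = \<epsilon> 2 (\<pi> p)"
    "\<And>p. p \<in> W \<Longrightarrow> push p (e 3 p) = (\<lambda>f. 0)"
    and l: "\<And>p. p \<in> W \<Longrightarrow> l1 p = L1 (\<pi> p)" "\<And>p. p \<in> W \<Longrightarrow> l2 p = L2 (\<pi> p)"
    and lam_smooth: "smooth_fun M W lam" and mu_smooth: "smooth_fun M W \<mu>"
    and brackets: "\<And>p. p \<in> W \<Longrightarrow> bracket M (e 1) (e 3) p = (\<lambda>f. lam p * e 3 p f)"
    "\<And>p. p \<in> W \<Longrightarrow> bracket M (e 2) (e 3) p = (\<lambda>f. \<mu> p * e 3 p f)"
    "\<And>p. p \<in> W \<Longrightarrow> bracket M (e 1) (e 2) p = (\<lambda>f. l1 p * e 1 p f + l2 p * e 2 p f - 2 * \<sigma> p * e 3 p f)"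
    and signs: "\<And>p. p \<in> W \<Longrightarrow> src.sign 1 p = \<delta>1" "\<And>p. p \<in> W \<Longrightarrow> src.sign 2 p = \<delta>2"
    "\<And>p. p \<in> W \<Longrightarrow> src.sign 3 p = \<delta>3"
    "\<And>p. p \<in> W \<Longrightarrow> tgt.sign 1 (\<pi> p) = \<delta>1" "\<And>p. p \<in> W \<Longrightarrow> tgt.sign 2 (\<pi> p) = \<delta>2"
    and \<delta>: "\<delta>1 = 1 \<or> \<delta>1 = -1" "\<delta>2 = 1 \<or> \<delta>2 = -1" "\<delta>3 = 1 \<or> \<delta>3 = -1"
begin

lemma \<delta>_square: "\<delta>1 * \<delta>1 = 1" "\<delta>2 * \<delta>2 = 1" "\<delta>3 * \<delta>3 = 1"
  "\<delta>1 * (\<delta>1 * x) = x" "\<delta>2 * (\<delta>2 * x) = x" "\<delta>3 * (\<delta>3 * x) = x"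
  using \<delta> by auto

lemmas frame_fields = src.frame_vfield[OF index_3(1)] src.frame_vfield[OF index_3(2)] src.frame_vfield[OF index_3(3)]

lemma l_smooth: "smooth_fun M W l1" "smooth_fun M W l2"
  using src.smooth_fun_cong[OF W_open smooth_fun_pullback_V[OF tgt.L_smooth(1)], of l1]
    src.smooth_fun_cong[OF W_open smooth_fun_pullback_V[OF tgt.L_smooth(2)], of l2] l by auto

text \<open>Since \<open>e\<^sub>a\<close> is \<open>\<pi>\<close>-related to \<open>\<epsilon>\<^sub>a\<close>, derivatives of \<open>L\<^sub>i\<close> on the base become derivatives of \<open>l\<^sub>i\<close>.\<close>

lemma gauss_pullback:
  assumes p: "p \<in> W"
  shows "tgt.gauss (\<pi> p) = \<delta>2 * e 1 p l2 - \<delta>1 * e 2 p l1 - \<delta>1 * (l1 p)^2 - \<delta>2 * (l2 p)^2"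
proof -
  have 1: "\<epsilon> 1 (\<pi> p) L2 = e 1 p l2"
  proof -
    have "\<epsilon> 1 (\<pi> p) L2 = e 1 p (\<lambda>q. L2 (\<pi> q))"
      using tgt.smooth_at_U[OF tgt.L_smooth(2) W_V[OF p]]
      by (simp add: de(1)[OF p, symmetric] differential_def o_def)
    also have "\<dots> = e 1 p l2"
      by (rule src.tv_cong[OF src.vfieldD[OF frame_fields(1) p] W_open p]) (simp add: l)
    finally show ?thesis .
  qed
  have 2: "\<epsilon> 2 (\<pi> p) L1 = e 2 p l1"
  proof -
    have "\<epsilon> 2 (\<pi> p) L1 = e 2 p (\<lambda>q. L1 (\<pi> q))"
      using tgt.smooth_at_U[OF tgt.L_smooth(1) W_V[OF p]]
      by (simp add: de(2)[OF p, symmetric] differential_def o_def)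
    also have "\<dots> = e 2 p l1"
      by (rule src.tv_cong[OF src.vfieldD[OF frame_fields(2) p] W_open p]) (simp add: l)
    finally show ?thesis .
  qed
  show ?thesis unfolding tgt.gauss_def 1 2 signs(4,5)[OF p] l[OF p] by simp
qed

lemma bracket_metric:
  assumes p: "p \<in> W"
  shows "g p (bracket M (e 1) (e 2) p) (e 1 p) = l1 p * \<delta>1" "g p (bracket M (e 1) (e 2) p) (e 2 p) = l2 p * \<delta>2"
    "g p (bracket M (e 1) (e 3) p) (e 1 p) = 0" "g p (bracket M (e 1) (e 3) p) (e 3 p) = lam p * \<delta>3"
    "g p (bracket M (e 2) (e 3) p) (e 2 p) = 0" "g p (bracket M (e 2) (e 3) p) (e 3 p) = \<mu> p * \<delta>3"
proof -
  note m = src.metric_combination[OF p, unfolded sum_DIM_3]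
  show "g p (bracket M (e 1) (e 2) p) (e 1 p) = l1 p * \<delta>1" "g p (bracket M (e 1) (e 2) p) (e 2 p) = l2 p * \<delta>2"
    using m[OF index_3(1), of "\<lambda>i. if i = 1 then l1 p else if i = 2 then l2 p else - 2 * \<sigma> p"]
      m[OF index_3(2), of "\<lambda>i. if i = 1 then l1 p else if i = 2 then l2 p else - 2 * \<sigma> p"]
    by (simp_all add: brackets[OF p] signs[OF p])
  show "g p (bracket M (e 1) (e 3) p) (e 1 p) = 0" "g p (bracket M (e 1) (e 3) p) (e 3 p) = lam p * \<delta>3"
    using m[OF index_3(1), of "\<lambda>i. if i = 3 then lam p else 0"] m[OF index_3(3), of "\<lambda>i. if i = 3 then lam p else 0"]
    by (simp_all add: brackets[OF p] signs[OF p])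
  show "g p (bracket M (e 2) (e 3) p) (e 2 p) = 0" "g p (bracket M (e 2) (e 3) p) (e 3 p) = \<mu> p * \<delta>3"
    using m[OF index_3(2), of "\<lambda>i. if i = 3 then \<mu> p else 0"] m[OF index_3(3), of "\<lambda>i. if i = 3 then \<mu> p else 0"]
    by (simp_all add: brackets[OF p] signs[OF p])
qed

text \<open>The first two fields project onto \<open>\<nabla>\<^sub>a \<epsilon>\<^sub>a\<close> on the base, so horizontal directions contribute nothing to
  the tension field. The third one is the curvature vector of the fibre, the source of the tension.\<close>

lemma nabla_self:
  assumes p: "p \<in> W"
  shows "src.nabla (e 1) (e 1) p = (\<lambda>f. - (\<delta>1 * \<delta>2 * l1 p) * e 2 p f)"
    "src.nabla (e 2) (e 2) p = (\<lambda>f. \<delta>1 * \<delta>2 * l2 p * e 1 p f)"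
    "src.nabla (e 3) (e 3) p = (\<lambda>f. \<delta>1 * \<delta>3 * lam p * e 1 p f + \<delta>2 * \<delta>3 * \<mu> p * e 2 p f)"
proof -
  note i = index_3
  have ex: "src.nabla (e j) (e j) p = (\<lambda>f. src.sign 1 p * g p (src.nabla (e j) (e j) p) (e 1 p) * e 1 p f
      + src.sign 2 p * g p (src.nabla (e j) (e j) p) (e 2 p) * e 2 p f
      + src.sign 3 p * g p (src.nabla (e j) (e j) p) (e 3 p) * e 3 p f)" if "j \<in> {1..DIM(real^3)}" for j
    using src.frame_expand[OF p src.vfieldD[OF src.nabla_vfield[OF src.frame_vfield[OF that] src.frame_vfield[OF that]] p]]
    unfolding sum_DIM_3 src.coord_def .
  have z: "g p (src.nabla (e j) (e j) p) (e j p) = 0" if "j \<in> {1..DIM(real^3)}" for j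
    using src.nabla_frame_skew[OF src.frame_vfield[OF that] that that p] by simp
  have sw: "g p (bracket M (e 2) (e 1) p) (e 2 p) = - g p (bracket M (e 1) (e 2) p) (e 2 p)"
    "g p (bracket M (e 3) (e 1) p) (e 3 p) = - g p (bracket M (e 1) (e 3) p) (e 3 p)"
    "g p (bracket M (e 3) (e 2) p) (e 3 p) = - g p (bracket M (e 2) (e 3) p) (e 3 p)"
    by (rule src.bracket_swap_metric[OF p]; simp)+
  have 1: "g p (src.nabla (e 1) (e 1) p) (e 2 p) = - (l1 p * \<delta>1)" "g p (src.nabla (e 1) (e 1) p) (e 3 p) = 0"
    using src.nabla_frame_self[OF i(1,2) p] src.nabla_frame_self[OF i(1,3) p] bracket_metric[OF p] by simp_all
  have 2: "g p (src.nabla (e 2) (e 2) p) (e 1 p) = l2 p * \<delta>2" "g p (src.nabla (e 2) (e 2) p) (e 3 p) = 0"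
    using src.nabla_frame_self[OF i(2,1) p] src.nabla_frame_self[OF i(2,3) p] bracket_metric[OF p] sw by simp_all
  have 3: "g p (src.nabla (e 3) (e 3) p) (e 1 p) = lam p * \<delta>3" "g p (src.nabla (e 3) (e 3) p) (e 2 p) = \<mu> p * \<delta>3"
    using src.nabla_frame_self[OF i(3,1) p] src.nabla_frame_self[OF i(3,2) p] bracket_metric[OF p] sw by simp_all
  show "src.nabla (e 1) (e 1) p = (\<lambda>f. - (\<delta>1 * \<delta>2 * l1 p) * e 2 p f)"
    by (subst ex[OF i(1)]) (simp add: z[OF i(1)] 1 signs[OF p] mult_ac)
  show "src.nabla (e 2) (e 2) p = (\<lambda>f. \<delta>1 * \<delta>2 * l2 p * e 1 p f)"
    by (subst ex[OF i(2)]) (simp add: z[OF i(2)] 2 signs[OF p] mult_ac)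
  show "src.nabla (e 3) (e 3) p = (\<lambda>f. \<delta>1 * \<delta>3 * lam p * e 1 p f + \<delta>2 * \<delta>3 * \<mu> p * e 2 p f)"
    by (subst ex[OF i(3)]) (simp add: z[OF i(3)] 3 signs[OF p] mult_ac)
qed

text \<open>The Laplacian with the fields \<open>\<nabla>\<^sub>i e\<^sub>i\<close> expressed by the integrability functions. This expression is
  local: the same one serves all open subsets of the domain of the frame.\<close>

definition frame_laplacian :: "('m \<Rightarrow> real) \<Rightarrow> 'm \<Rightarrow> real" where
  "frame_laplacian f p = \<delta>1 * e 1 p (\<lambda>q. e 1 q f) + \<delta>2 * e 2 p (\<lambda>q. e 2 q f) + \<delta>3 * e 3 p (\<lambda>q. e 3 q f)
     - (\<delta>1 * (l2 p + lam p) * e 1 p f + \<delta>2 * (\<mu> p - l1 p) * e 2 p f)"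

lemma laplacian_adapted:
  assumes f: "smooth_fun M W f" and p: "p \<in> W"
  shows "laplacian M g W e f p = frame_laplacian f p"
  unfolding src.laplacian_frame[OF f p] sum_DIM_3 frame_laplacian_def nabla_self[OF p] signs[OF p]
  by (simp add: algebra_simps \<delta>_square)

definition comb :: "('m \<Rightarrow> real) \<Rightarrow> ('m \<Rightarrow> real) \<Rightarrow> 'm \<Rightarrow> 'b tvec" where
  "comb s1 s2 p k = s1 p * \<epsilon> 1 (\<pi> p) k + s2 p * \<epsilon> 2 (\<pi> p) k"

lemmas frame_sect = vfield_pullback_sect[OF tgt.frame_fields(1)] vfield_pullback_sect[OF tgt.frame_fields(2)]

lemma comb_sect: "smooth_fun M W s1 \<Longrightarrow> smooth_fun M W s2 \<Longrightarrow> sect (comb s1 s2)"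
  unfolding comb_def[abs_def] by (intro sect_add sect_scale frame_sect)

lemma pb_comb:
  assumes X: "vfield M W X" and s: "smooth_fun M W s1" "smooth_fun M W s2" and p: "p \<in> W"
  shows "pb X (comb s1 s2) p = (\<lambda>k. X p s1 * \<epsilon> 1 (\<pi> p) k + s1 p * pb X (\<lambda>q. \<epsilon> 1 (\<pi> q)) p k
     + (X p s2 * \<epsilon> 2 (\<pi> p) k + s2 p * pb X (\<lambda>q. \<epsilon> 2 (\<pi> q)) p k))"
  using PB.conn_add_S[OF X sect_scale[OF s(1) frame_sect(1)] sect_scale[OF s(2) frame_sect(2)] p]
  unfolding comb_def[abs_def] PB.conn_leibniz[OF X frame_sect(1) s(1) p] PB.conn_leibniz[OF X frame_sect(2) s(2) p] .

text \<open>For \<open>e\<^sub>1\<close> and \<open>e\<^sub>2\<close> these are the covariant derivatives of \<open>\<epsilon>\<^sub>1\<close>, \<open>\<epsilon>\<^sub>2\<close> on the base; in the vertical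
  direction the pulled-back frame is parallel.\<close>

lemma pb_frame:
  assumes p: "p \<in> W"
  shows "pb (e 1) (\<lambda>q. \<epsilon> 1 (\<pi> q)) p = (\<lambda>k. - (\<delta>1 * \<delta>2 * l1 p) * \<epsilon> 2 (\<pi> p) k)"
    "pb (e 1) (\<lambda>q. \<epsilon> 2 (\<pi> q)) p = (\<lambda>k. l1 p * \<epsilon> 1 (\<pi> p) k)"
    "pb (e 2) (\<lambda>q. \<epsilon> 1 (\<pi> q)) p = (\<lambda>k. - l2 p * \<epsilon> 2 (\<pi> p) k)"
    "pb (e 2) (\<lambda>q. \<epsilon> 2 (\<pi> q)) p = (\<lambda>k. \<delta>1 * \<delta>2 * l2 p * \<epsilon> 1 (\<pi> p) k)"
    "pb (e 3) (\<lambda>q. \<epsilon> 1 (\<pi> q)) p = (\<lambda>k. 0)"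
    "pb (e 3) (\<lambda>q. \<epsilon> 2 (\<pi> q)) p = (\<lambda>k. 0)"
proof -
  note a1 = pullback_along[OF frame_fields(1) _ tgt.frame_fields(1) p de(1)[OF p, symmetric]]
    and a2 = pullback_along[OF frame_fields(2) _ tgt.frame_fields(2) p de(2)[OF p, symmetric]]
  note n = tgt.nabla_frame[OF W_V[OF p]]
  show "pb (e 1) (\<lambda>q. \<epsilon> 1 (\<pi> q)) p = (\<lambda>k. - (\<delta>1 * \<delta>2 * l1 p) * \<epsilon> 2 (\<pi> p) k)"
    unfolding a1[OF tgt.frame_fields(1)] n signs(4,5)[OF p] l[OF p] ..
  show "pb (e 1) (\<lambda>q. \<epsilon> 2 (\<pi> q)) p = (\<lambda>k. l1 p * \<epsilon> 1 (\<pi> p) k)"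
    unfolding a1[OF tgt.frame_fields(2)] n signs(4,5)[OF p] l[OF p] ..
  show "pb (e 2) (\<lambda>q. \<epsilon> 1 (\<pi> q)) p = (\<lambda>k. - l2 p * \<epsilon> 2 (\<pi> p) k)"
    unfolding a2[OF tgt.frame_fields(1)] n signs(4,5)[OF p] l[OF p] ..
  show "pb (e 2) (\<lambda>q. \<epsilon> 2 (\<pi> q)) p = (\<lambda>k. \<delta>1 * \<delta>2 * l2 p * \<epsilon> 1 (\<pi> p) k)"
    unfolding a2[OF tgt.frame_fields(2)] n signs(4,5)[OF p] l[OF p] ..
  have "pb (e 3) (\<lambda>q. Y (\<pi> q)) p = (\<lambda>k. 0)" if "vfield B V Y" for Y
    using pullback_along[OF frame_fields(3) that tgt.vfield_zero p] de(3)[OF p]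
      tgt.LC.conn_zero_X[OF that W_V[OF p]] by simp
  from this[OF tgt.frame_fields(1)] this[OF tgt.frame_fields(2)]
  show "pb (e 3) (\<lambda>q. \<epsilon> 1 (\<pi> q)) p = (\<lambda>k. 0)" "pb (e 3) (\<lambda>q. \<epsilon> 2 (\<pi> q)) p = (\<lambda>k. 0)" .
qed

lemma pb_adapted:
  assumes s: "smooth_fun M W s1" "smooth_fun M W s2" and p: "p \<in> W"
  shows "pb (e 1) (comb s1 s2) p
      = comb (\<lambda>q. e 1 q s1 + l1 q * s2 q) (\<lambda>q. e 1 q s2 - \<delta>1 * \<delta>2 * l1 q * s1 q) p"
    "pb (e 2) (comb s1 s2) p
      = comb (\<lambda>q. e 2 q s1 + \<delta>1 * \<delta>2 * l2 q * s2 q) (\<lambda>q. e 2 q s2 - l2 q * s1 q) p"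
    "pb (e 3) (comb s1 s2) p = comb (\<lambda>q. e 3 q s1) (\<lambda>q. e 3 q s2) p"
  unfolding pb_comb[OF frame_fields(1) s p] pb_comb[OF frame_fields(2) s p] pb_comb[OF frame_fields(3) s p] pb_frame[OF p]
  unfolding comb_def[abs_def]
  by (auto simp: algebra_simps)

text \<open>\<open>\<tau> = - \<delta>\<^sub>3 d\<pi>(\<nabla>\<^sub>3 e\<^sub>3)\<close>: only the fibre direction contributes.\<close>

lemma tension_adapted:
  assumes p: "p \<in> W"
  shows "tension M g W B h V \<pi> e p = comb (\<lambda>q. - \<delta>1 * lam q) (\<lambda>q. - \<delta>2 * \<mu> q) p"
proof -
  have a: "pb (e i) (\<lambda>q. push q (e i q)) p = pb (e i) S p"
    if "i \<in> {1..DIM(real^3)}" "sect S" "\<And>q. q \<in> W \<Longrightarrow> push q (e i q) = S q" for i S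
    using that by (intro PB.conn_cong src.frame_vfield differential_sect p) auto
  have 1: "pb (e 1) (\<lambda>q. push q (e 1 q)) p = pb (e 1) (\<lambda>q. \<epsilon> 1 (\<pi> q)) p"
    by (rule a[OF index_3(1) frame_sect(1) de(1)])
  have 2: "pb (e 2) (\<lambda>q. push q (e 2 q)) p = pb (e 2) (\<lambda>q. \<epsilon> 2 (\<pi> q)) p"
    by (rule a[OF index_3(2) frame_sect(2) de(2)])
  have 3: "pb (e 3) (\<lambda>q. push q (e 3 q)) p = (\<lambda>k. 0)"
    using a[OF index_3(3) sect_zero de(3)] PB.conn_zero_S[OF frame_fields(3) p] by simp
  show ?thesis
    unfolding tension_def src.sign_def[symmetric] sum_DIM_3 1 2 3 pb_frame[OF p] nabla_self[OF p]
      differential_add differential_scale de[OF p] signs[OF p] comb_def[abs_def]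
    by (auto simp: algebra_simps \<delta>_square)
qed

lemma curvature_adapted:
  assumes p: "p \<in> W"
  shows "riemann_at B h V (\<pi> p) (push p (e 1 p)) (comb s1 s2 p) (push p (e 1 p))
      = (\<lambda>k. - \<delta>2 * s2 p * tgt.gauss (\<pi> p) * \<epsilon> 2 (\<pi> p) k)"
    "riemann_at B h V (\<pi> p) (push p (e 2 p)) (comb s1 s2 p) (push p (e 2 p))
      = (\<lambda>k. - \<delta>1 * s1 p * tgt.gauss (\<pi> p) * \<epsilon> 1 (\<pi> p) k)"
    "riemann_at B h V (\<pi> p) (push p (e 3 p)) (comb s1 s2 p) (push p (e 3 p)) = (\<lambda>k. 0)"
proof -
  note q = W_V[OF p]
  define T where "T = (\<lambda>q f. s1 p * \<epsilon> 1 q f + s2 p * \<epsilon> 2 q f)"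
  have Tv: "vfield B V T" unfolding T_def by (intro tgt.vfield_add tgt.vfield_scale_const tgt.frame_fields)
  have T: "comb s1 s2 p = T (\<pi> p)" by (simp add: T_def comb_def[abs_def])
  have lin: "riemann B h V X T Z (\<pi> p) k = s1 p * riemann B h V X (\<epsilon> 1) Z (\<pi> p) k + s2 p * riemann B h V X (\<epsilon> 2) Z (\<pi> p) k"
    if X: "vfield B V X" and Z: "vfield B V Z" for X Z k
  proof -
    note t = tgt.curvature_tensorial_2[OF X Z, of k]
    have "riemann B h V X T Z (\<pi> p) k = riemann B h V X (\<lambda>q f. s1 p * \<epsilon> 1 q f) Z (\<pi> p) k
        + riemann B h V X (\<lambda>q f. s2 p * \<epsilon> 2 q f) Z (\<pi> p) k"
      unfolding T_def by (rule tgt.tensorial_add[OF t tgt.vfield_scale_const[OF tgt.frame_fields(1)] tgt.vfield_scale_const[OF tgt.frame_fields(2)] q])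
    then show ?thesis
      using tgt.tensorial_scale[OF t tgt.frame_fields(1) tgt.smooth_fun_const q, of "s1 p"]
        tgt.tensorial_scale[OF t tgt.frame_fields(2) tgt.smooth_fun_const q, of "s2 p"] by simp
  qed
  have self: "riemann B h V X X Z (\<pi> p) k = 0" if "vfield B V X" "vfield B V Z" for X Z k
    using tgt.curvature_skew[OF that(1,1,2) q, of k] by simp
  show "riemann_at B h V (\<pi> p) (push p (e 1 p)) (comb s1 s2 p) (push p (e 1 p))
      = (\<lambda>k. - \<delta>2 * s2 p * tgt.gauss (\<pi> p) * \<epsilon> 2 (\<pi> p) k)"
    unfolding de[OF p] T tgt.riemann_at_eq[OF tgt.frame_fields(1) Tv tgt.frame_fields(1) q]
    using tgt.curvature_frame(1)[OF q] signs(5)[OF p]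
    by (intro ext) (simp add: lin[OF tgt.frame_fields(1,1)] self[OF tgt.frame_fields(1,1)])
  show "riemann_at B h V (\<pi> p) (push p (e 2 p)) (comb s1 s2 p) (push p (e 2 p))
      = (\<lambda>k. - \<delta>1 * s1 p * tgt.gauss (\<pi> p) * \<epsilon> 1 (\<pi> p) k)"
    unfolding de[OF p] T tgt.riemann_at_eq[OF tgt.frame_fields(2) Tv tgt.frame_fields(2) q]
    using tgt.curvature_frame(2)[OF q] signs(4)[OF p]
    by (intro ext) (simp add: lin[OF tgt.frame_fields(2,2)] self[OF tgt.frame_fields(2,2)] tgt.curvature_skew[OF tgt.frame_fields(1,2,2) q])
  have "riemann B h V (\<lambda>q f. 0) T (\<lambda>q f. 0) (\<pi> p) k = 0" for k
    by (rule tgt.tensorial_zero[OF tgt.curvature_tensorial_1[OF Tv tgt.vfield_zero] q])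
  then show "riemann_at B h V (\<pi> p) (push p (e 3 p)) (comb s1 s2 p) (push p (e 3 p)) = (\<lambda>k. 0)"
    unfolding de[OF p] T
    using tgt.riemann_at_eq[OF tgt.vfield_zero Tv tgt.vfield_zero q] by auto
qed

lemma tv_linear:
  assumes "v \<in> tangent_space M p" "p \<in> W" "smooth_fun M W f" "smooth_fun M W f'"
  shows "v (\<lambda>q. a * f q + b * f' q) = a * v f + b * v f'"
proof -
  note f = src.smooth_at_U[OF assms(3,2)] and f' = src.smooth_at_U[OF assms(4,2)]
    and c = src.smooth_at_const[OF src.in_carrier[OF assms(2)]]
  have "v (\<lambda>q. a * f q + b * f' q) = v (\<lambda>q. a * f q) + v (\<lambda>q. b * f' q)"
    by (intro src.tv_add[OF assms(1)] src.smooth_at_mult c f f')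
  then show ?thesis using src.tv_scale[OF assms(1) f] src.tv_scale[OF assms(1) f'] by simp
qed

text \<open>The difference of the two sides of the first equation of the theorem; \<open>equation2\<close> is that of the
  second one.\<close>

definition equation1 :: "'m \<Rightarrow> real" where
  "equation1 p = frame_laplacian lam p - (- \<delta>2 * l1 p * e 1 p \<mu> - \<delta>2 * e 1 p (\<lambda>q. \<mu> q * l1 q)
          - \<delta>2 * l2 p * e 2 p \<mu> - \<delta>2 * e 2 p (\<lambda>q. \<mu> q * l2 q)
          + \<delta>2 * lam p * \<mu> p * l1 p + \<delta>2 * (\<mu> p)^2 * l2 p
          + lam p * (\<delta>2 * (l1 p)^2 + \<delta>1 * (l2 p)^2 - \<delta>1 * \<delta>2 * tgt.gauss (\<pi> p)))"

definition equation2 :: "'m \<Rightarrow> real" where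
  "equation2 p = frame_laplacian \<mu> p - (\<delta>1 * l1 p * e 1 p lam + \<delta>1 * e 1 p (\<lambda>q. lam q * l1 q)
          + \<delta>1 * l2 p * e 2 p lam + \<delta>1 * e 2 p (\<lambda>q. lam q * l2 q)
          - \<delta>1 * lam p * \<mu> p * l2 p - \<delta>1 * (lam p)^2 * l1 p
          + \<mu> p * (\<delta>2 * (l1 p)^2 + \<delta>1 * (l2 p)^2 - \<delta>1 * \<delta>2 * tgt.gauss (\<pi> p)))"

text \<open>With \<open>\<tau> = - \<delta>\<^sub>1 \<lambda> \<epsilon>\<^sub>1 - \<delta>\<^sub>2 \<mu> \<epsilon>\<^sub>2\<close> the covariant derivatives \<open>D\<^sub>i \<tau>\<close> and \<open>D\<^sub>i D\<^sub>i \<tau>\<close> follow from the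
  connection matrix of the pulled-back frame. The terms \<open>D\<^sub>i\<^sub>i \<tau>\<close> in the direction of \<open>\<nabla>\<^sub>i e\<^sub>i\<close> are
  combinations of \<open>D\<^sub>1 \<tau>\<close> and \<open>D\<^sub>2 \<tau>\<close>, and the curvature term is \<open>K\<^sup>B\<close> times \<open>\<tau>\<close> up to sign. The two
  coefficients of the sum are the equations of the theorem.\<close>

lemma bitension_adapted:
  assumes e': "orthonormal_frame M g W e'" and p: "p \<in> W"
  shows "bitension M g W B h V \<pi> e' p = comb (\<lambda>q. - \<delta>1 * equation1 q) (\<lambda>q. - \<delta>2 * equation2 q) p"
proof
  fix k
  let ?T = "comb (\<lambda>q. - \<delta>1 * lam q) (\<lambda>q. - \<delta>2 * \<mu> q)"
  \<comment> \<open>coefficients of \<open>D\<^sub>1 \<tau>\<close>, \<open>D\<^sub>2 \<tau>\<close> and \<open>D\<^sub>3 \<tau>\<close>\<close>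
  define A1 where "A1 = (\<lambda>q. - \<delta>1 * e 1 q lam + - \<delta>2 * (\<mu> q * l1 q))"
  define A2 where "A2 = (\<lambda>q. - \<delta>2 * e 1 q \<mu> + \<delta>2 * (lam q * l1 q))"
  define B1 where "B1 = (\<lambda>q. - \<delta>1 * e 2 q lam + - \<delta>1 * (\<mu> q * l2 q))"
  define B2 where "B2 = (\<lambda>q. - \<delta>2 * e 2 q \<mu> + \<delta>1 * (lam q * l2 q))"
  define C1 where "C1 = (\<lambda>q. - \<delta>1 * e 3 q lam)"
  define C2 where "C2 = (\<lambda>q. - \<delta>2 * e 3 q \<mu>)"
  note sm = src.smooth_fun_const lam_smooth mu_smooth l_smooth src.smooth_fun_add src.smooth_fun_mult W_open
  have es: "smooth_fun M W (\<lambda>q. e i q f)" if "smooth_fun M W f" "i \<in> {1..DIM(real^3)}" for i f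
    by (rule src.vfield_smooth[OF src.frame_vfield[OF that(2)] W_open order_refl that(1)])
  note es = es[OF _ index_3(1)] es[OF _ index_3(2)] es[OF _ index_3(3)]
  have T1: "smooth_fun M W (\<lambda>q. - \<delta>1 * lam q)" and T2: "smooth_fun M W (\<lambda>q. - \<delta>2 * \<mu> q)"
    by (intro sm)+
  have T: "sect ?T" by (intro comb_sect T1 T2)
  have s: "smooth_fun M W A1" "smooth_fun M W A2" "smooth_fun M W B1" "smooth_fun M W B2"
      "smooth_fun M W C1" "smooth_fun M W C2"
    unfolding A1_def A2_def B1_def B2_def C1_def C2_def by (intro sm es)+
  have sc: "v (\<lambda>q. a * f q) = a * v f" if "v \<in> tangent_space M q" "q \<in> W" "smooth_fun M W f" for v q a f
    using src.tv_scale[OF that(1) src.smooth_at_U[OF that(3,2)]] .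
  have D: "pb (e 1) ?T q = comb A1 A2 q" "pb (e 2) ?T q = comb B1 B2 q" "pb (e 3) ?T q = comb C1 C2 q"
    if q: "q \<in> W" for q
  proof -
    note t = src.vfieldD[OF frame_fields(1) q] src.vfieldD[OF frame_fields(2) q] src.vfieldD[OF frame_fields(3) q]
    note c = sc[OF t(1) q lam_smooth] sc[OF t(1) q mu_smooth] sc[OF t(2) q lam_smooth] sc[OF t(2) q mu_smooth]
      sc[OF t(3) q lam_smooth] sc[OF t(3) q mu_smooth]
    show "pb (e 1) ?T q = comb A1 A2 q" "pb (e 2) ?T q = comb B1 B2 q" "pb (e 3) ?T q = comb C1 C2 q"
      unfolding pb_adapted[OF T1 T2 q]
      unfolding comb_def[abs_def] c A1_def A2_def B1_def B2_def C1_def C2_def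
      using \<delta> by (auto simp: algebra_simps)
  qed
  have DD: "pb (e 1) (pb (e 1) ?T) p = pb (e 1) (comb A1 A2) p"
    "pb (e 2) (pb (e 2) ?T) p = pb (e 2) (comb B1 B2) p"
    "pb (e 3) (pb (e 3) ?T) p = pb (e 3) (comb C1 C2) p"
    by (intro PB.conn_cong frame_fields refl PB.conn_sect T comb_sect s D p; assumption)+
  note t = src.vfieldD[OF frame_fields(1) p] src.vfieldD[OF frame_fields(2) p] src.vfieldD[OF frame_fields(3) p]
  have N: "pb (src.nabla (e 1) (e 1)) ?T p k = - (\<delta>1 * \<delta>2 * l1 p) * comb B1 B2 p k"
    "pb (src.nabla (e 2) (e 2)) ?T p k = \<delta>1 * \<delta>2 * l2 p * comb A1 A2 p k"
    "pb (src.nabla (e 3) (e 3)) ?T p k = \<delta>1 * \<delta>3 * lam p * comb A1 A2 p k + \<delta>2 * \<delta>3 * \<mu> p * comb B1 B2 p k"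
  proof -
    have n: "smooth_fun M W (\<lambda>q. - (\<delta>1 * \<delta>2 * l1 q))" "smooth_fun M W (\<lambda>q. \<delta>1 * \<delta>2 * l2 q)"
      "smooth_fun M W (\<lambda>q. \<delta>1 * \<delta>3 * lam q)" "smooth_fun M W (\<lambda>q. \<delta>2 * \<delta>3 * \<mu> q)"
      by (intro src.smooth_fun_minus sm)+
    have 1: "pb (src.nabla (e 1) (e 1)) ?T p = pb (\<lambda>q f. - (\<delta>1 * \<delta>2 * l1 q) * e 2 q f) ?T p"
      by (rule PB.conn_cong[OF src.nabla_vfield[OF frame_fields(1,1)] src.vfield_scale[OF n(1) frame_fields(2)] nabla_self(1) T T refl p])
    have 2: "pb (src.nabla (e 2) (e 2)) ?T p = pb (\<lambda>q f. \<delta>1 * \<delta>2 * l2 q * e 1 q f) ?T p"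
      by (rule PB.conn_cong[OF src.nabla_vfield[OF frame_fields(2,2)] src.vfield_scale[OF n(2) frame_fields(1)] nabla_self(2) T T refl p])
    have 3: "pb (src.nabla (e 3) (e 3)) ?T p
        = pb (\<lambda>q f. (\<lambda>q f. \<delta>1 * \<delta>3 * lam q * e 1 q f) q f + (\<lambda>q f. \<delta>2 * \<delta>3 * \<mu> q * e 2 q f) q f) ?T p"
      by (rule PB.conn_cong[OF src.nabla_vfield[OF frame_fields(3,3)]
            src.vfield_add[OF src.vfield_scale[OF n(3) frame_fields(1)] src.vfield_scale[OF n(4) frame_fields(2)]] nabla_self(3) T T refl p])
    show "pb (src.nabla (e 1) (e 1)) ?T p k = - (\<delta>1 * \<delta>2 * l1 p) * comb B1 B2 p k"
      unfolding 1 PB.conn_scale_X[OF frame_fields(2) T n(1) p] D[OF p] ..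
    show "pb (src.nabla (e 2) (e 2)) ?T p k = \<delta>1 * \<delta>2 * l2 p * comb A1 A2 p k"
      unfolding 2 PB.conn_scale_X[OF frame_fields(1) T n(2) p] D[OF p] ..
    show "pb (src.nabla (e 3) (e 3)) ?T p k = \<delta>1 * \<delta>3 * lam p * comb A1 A2 p k + \<delta>2 * \<delta>3 * \<mu> p * comb B1 B2 p k"
      unfolding 3 PB.conn_add_X[OF src.vfield_scale[OF n(3) frame_fields(1)] src.vfield_scale[OF n(4) frame_fields(2)] T p]
        PB.conn_scale_X[OF frame_fields(1) T n(3) p] PB.conn_scale_X[OF frame_fields(2) T n(4) p] D[OF p] ..
  qed
  have d: "e 1 p A1 = - \<delta>1 * e 1 p (\<lambda>q. e 1 q lam) + - \<delta>2 * e 1 p (\<lambda>q. \<mu> q * l1 q)"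
    "e 1 p A2 = - \<delta>2 * e 1 p (\<lambda>q. e 1 q \<mu>) + \<delta>2 * e 1 p (\<lambda>q. lam q * l1 q)"
    "e 2 p B1 = - \<delta>1 * e 2 p (\<lambda>q. e 2 q lam) + - \<delta>1 * e 2 p (\<lambda>q. \<mu> q * l2 q)"
    "e 2 p B2 = - \<delta>2 * e 2 p (\<lambda>q. e 2 q \<mu>) + \<delta>1 * e 2 p (\<lambda>q. lam q * l2 q)"
    "e 3 p C1 = - \<delta>1 * e 3 p (\<lambda>q. e 3 q lam)" "e 3 p C2 = - \<delta>2 * e 3 p (\<lambda>q. e 3 q \<mu>)"
    unfolding A1_def A2_def B1_def B2_def C1_def C2_def
    by (intro tv_linear[OF t(1) p] tv_linear[OF t(2) p] sc[OF t(3) p] sm es)+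
  \<comment> \<open>the coefficients of the bitension field: the traces of the second covariant derivatives, minus the
    derivatives along \<open>\<nabla>\<^sub>i e\<^sub>i\<close>, minus the curvature term\<close>
  define c1 where "c1 = \<delta>1 * (e 1 p A1 + l1 p * A2 p) + \<delta>2 * (e 2 p B1 + \<delta>1 * \<delta>2 * l2 p * B2 p) + \<delta>3 * e 3 p C1
    - (\<delta>1 * (- (\<delta>1 * \<delta>2 * l1 p) * B1 p) + \<delta>2 * (\<delta>1 * \<delta>2 * l2 p * A1 p)
       + \<delta>3 * (\<delta>1 * \<delta>3 * lam p * A1 p + \<delta>2 * \<delta>3 * \<mu> p * B1 p))
    - \<delta>2 * (- \<delta>1 * (- \<delta>1 * lam p) * tgt.gauss (\<pi> p))"
  define c2 where "c2 = \<delta>1 * (e 1 p A2 - \<delta>1 * \<delta>2 * l1 p * A1 p) + \<delta>2 * (e 2 p B2 - l2 p * B1 p) + \<delta>3 * e 3 p C2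
    - (\<delta>1 * (- (\<delta>1 * \<delta>2 * l1 p) * B2 p) + \<delta>2 * (\<delta>1 * \<delta>2 * l2 p * A2 p)
       + \<delta>3 * (\<delta>1 * \<delta>3 * lam p * A2 p + \<delta>2 * \<delta>3 * \<mu> p * B2 p))
    - \<delta>1 * (- \<delta>2 * (- \<delta>2 * \<mu> p) * tgt.gauss (\<pi> p))"
  have c: "c1 = - \<delta>1 * equation1 p" "c2 = - \<delta>2 * equation2 p"
    unfolding c1_def c2_def d equation1_def equation2_def frame_laplacian_def
    unfolding A1_def A2_def B1_def B2_def
    using \<delta> by (elim disjE; simp add: algebra_simps power2_eq_square)+
  have "bitension M g W B h V \<pi> e' p k = (\<Sum>i=1..DIM(real^3). src.sign i p * bitension_form ?T k (e i) (e i) p)"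
    by (rule bitension_any_frame[OF e' p T tension_adapted])
  also have "\<dots> = \<delta>1 * bitension_form ?T k (e 1) (e 1) p + \<delta>2 * bitension_form ?T k (e 2) (e 2) p
      + \<delta>3 * bitension_form ?T k (e 3) (e 3) p"
    unfolding sum_DIM_3 signs[OF p] ..
  also have "\<dots> = c1 * \<epsilon> 1 (\<pi> p) k + c2 * \<epsilon> 2 (\<pi> p) k"
    unfolding bitension_form_def DD N curvature_adapted[OF p] pb_adapted[OF s(1,2) p] pb_adapted[OF s(3,4) p] pb_adapted[OF s(5,6) p]
    unfolding comb_def c1_def c2_def by (simp add: algebra_simps)
  also have "\<dots> = comb (\<lambda>q. - \<delta>1 * equation1 q) (\<lambda>q. - \<delta>2 * equation2 q) p k"
    unfolding comb_def c ..
  finally show "bitension M g W B h V \<pi> e' p k = comb (\<lambda>q. - \<delta>1 * equation1 q) (\<lambda>q. - \<delta>2 * equation2 q) p k" .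
qed

lemma bitension_zero_iff:
  assumes e': "orthonormal_frame M g W e'" and p: "p \<in> W"
  shows "bitension M g W B h V \<pi> e' p = (\<lambda>k. 0) \<longleftrightarrow> equation1 p = 0 \<and> equation2 p = 0"
proof
  assume "bitension M g W B h V \<pi> e' p = (\<lambda>k. 0)"
  then have 0: "(\<lambda>k. - \<delta>1 * equation1 p * \<epsilon> 1 (\<pi> p) k + - \<delta>2 * equation2 p * \<epsilon> 2 (\<pi> p) k) = (\<lambda>k. 0)"
    unfolding bitension_adapted[OF assms] comb_def[abs_def] .
  note q = W_V[OF p]
  let ?c = "\<lambda>i::nat. if i = 1 then - \<delta>1 * equation1 p else - \<delta>2 * equation2 p"
  have "(\<lambda>k. \<Sum>i=1..DIM(real^2). ?c i * \<epsilon> i (\<pi> p) k) = (\<lambda>k. 0)"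
    unfolding sum_DIM_2 using 0 by simp
  then have "?c i * tgt.sign i (\<pi> p) = 0" if "i \<in> {1..DIM(real^2)}" for i
    using tgt.metric_combination[OF q that, of ?c]
      tgt.metric_zero[OF into_carrier[OF p] tgt.frame_tangent[OF that q]] by simp
  from this[OF index_2(1)] this[OF index_2(2)]
  have "- \<delta>1 * equation1 p * \<delta>1 = 0" "- \<delta>2 * equation2 p * \<delta>2 = 0"
    by (simp_all add: signs[OF p])
  moreover have "\<delta>1 \<noteq> 0" "\<delta>2 \<noteq> 0" using \<delta>(1,2) by linarith+
  ultimately show "equation1 p = 0 \<and> equation2 p = 0" by simp
next
  assume "equation1 p = 0 \<and> equation2 p = 0"
  then show "bitension M g W B h V \<pi> e' p = (\<lambda>k. 0)"
    unfolding bitension_adapted[OF assms] comb_def[abs_def] by simp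
qed

end

theorem proposition1:
  fixes M :: "('m::{t2_space,second_countable_topology}, real^3) atlas"
    and B :: "('b::{t2_space,second_countable_topology}, real^2) atlas"
    and g :: "'m metric" and h :: "'b metric"
    and r s :: nat
    and \<pi> :: "'m \<Rightarrow> 'b"
    and U :: "'m set" and V :: "'b set"
    and e :: "nat \<Rightarrow> 'm \<Rightarrow> 'm tvec" and \<epsilon> :: "nat \<Rightarrow> 'b \<Rightarrow> 'b tvec"
    and l1 l2 lam \<mu> \<sigma> K :: "'m \<Rightarrow> real"
    and \<delta>1 \<delta>2 \<delta>3 :: real
  assumes "pseudo_riemannian_submersion M g r B h s \<pi>"
    and "r \<le> 3" and "s \<le> 2" and "s \<le> r"
    and "adapted_frame M g U B h V \<pi> e \<epsilon>"
    and "integrability_functions M U B V \<pi> e \<epsilon> l1 l2 lam \<mu> \<sigma>"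
    and "\<delta>1 \<in> {1, -1}" and "\<delta>2 \<in> {1, -1}" and "\<delta>3 \<in> {1, -1}"
    and "\<And>p. p \<in> U \<Longrightarrow>
           g p (e 1 p) (e 1 p) = \<delta>1 \<and> g p (e 2 p) (e 2 p) = \<delta>2 \<and> g p (e 3 p) (e 3 p) = \<delta>3"
    and "\<And>p. p \<in> U \<Longrightarrow> K p = R1221 B h V \<epsilon> (\<pi> p)"
  shows "(\<forall>p\<in>U. K p = \<delta>2 * e 1 p l2 - \<delta>1 * e 2 p l1 - \<delta>1 * (l1 p)^2 - \<delta>2 * (l2 p)^2) \<and>
    (biharmonic M g U B h V \<pi> \<longleftrightarrow>
      (\<forall>p\<in>U.
        laplacian M g U e lam p =
          - \<delta>2 * l1 p * e 1 p \<mu> - \<delta>2 * e 1 p (\<lambda>q. \<mu> q * l1 q)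
          - \<delta>2 * l2 p * e 2 p \<mu> - \<delta>2 * e 2 p (\<lambda>q. \<mu> q * l2 q)
          + \<delta>2 * lam p * \<mu> p * l1 p + \<delta>2 * (\<mu> p)^2 * l2 p
          + lam p * (\<delta>2 * (l1 p)^2 + \<delta>1 * (l2 p)^2 - \<delta>1 * \<delta>2 * K p) \<and>
        laplacian M g U e \<mu> p =
          \<delta>1 * l1 p * e 1 p lam + \<delta>1 * e 1 p (\<lambda>q. lam q * l1 q)
          + \<delta>1 * l2 p * e 2 p lam + \<delta>1 * e 2 p (\<lambda>q. lam q * l2 q)
          - \<delta>1 * lam p * \<mu> p * l2 p - \<delta>1 * (lam p)^2 * l1 p
          + \<mu> p * (\<delta>2 * (l1 p)^2 + \<delta>1 * (l2 p)^2 - \<delta>1 * \<delta>2 * K p)))"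
proof -
  note sub = assms(1)[unfolded pseudo_riemannian_submersion_def]
  have prM: "pseudo_riemannian M g r" and prB: "pseudo_riemannian B h s" and sm: "smooth_map M B \<pi>"
    using sub by simp_all
  have isom: "h (\<pi> p) (differential B \<pi> p v) (differential B \<pi> p w) = g p v w"
    if "p \<in> carrier M" "v \<in> horizontal_space M g B \<pi> p" "w \<in> horizontal_space M g B \<pi> p" for p v w
    using sub that by (elim conjE) simp
  have mfM: "smooth_manifold M" and mfB: "smooth_manifold B"
    using prM[unfolded pseudo_riemannian_def, THEN conjunct1] prB[unfolded pseudo_riemannian_def, THEN conjunct1] .
  note af = assms(5)[unfolded adapted_frame_def]
  have U: "open U" "U \<subseteq> carrier M" and V: "open V" "V \<subseteq> carrier B" and UV: "\<pi> ` U \<subseteq> V"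
    and oe: "orthonormal_frame M g U e" and oeps: "orthonormal_frame B h V \<epsilon>"
    and e3: "\<And>p. p \<in> U \<Longrightarrow> e 3 p \<in> vertical_space M B \<pi> p"
    using af by simp_all
  have e12': "e 1 p \<in> horizontal_space M g B \<pi> p" "differential B \<pi> p (e 1 p) = \<epsilon> 1 (\<pi> p)"
    "e 2 p \<in> horizontal_space M g B \<pi> p" "differential B \<pi> p (e 2 p) = \<epsilon> 2 (\<pi> p)" if "p \<in> U" for p
    using af that by simp_all
  note ig = assms(6)[unfolded integrability_functions_def]
  obtain L1 L2 where L: "smooth_fun B V L1" "smooth_fun B V L2"
    "\<And>q. q \<in> V \<Longrightarrow> bracket B (\<epsilon> 1) (\<epsilon> 2) q = (\<lambda>f. L1 q * \<epsilon> 1 q f + L2 q * \<epsilon> 2 q f)"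
    "\<And>p. p \<in> U \<Longrightarrow> l1 p = L1 (\<pi> p)" "\<And>p. p \<in> U \<Longrightarrow> l2 p = L2 (\<pi> p)"
    using ig by (elim conjE exE) blast
  have smf: "smooth_fun M U lam" "smooth_fun M U \<mu>"
    and br: "\<And>p. p \<in> U \<Longrightarrow> bracket M (e 1) (e 3) p = (\<lambda>f. lam p * e 3 p f)"
    "\<And>p. p \<in> U \<Longrightarrow> bracket M (e 2) (e 3) p = (\<lambda>f. \<mu> p * e 3 p f)"
    "\<And>p. p \<in> U \<Longrightarrow> bracket M (e 1) (e 2) p = (\<lambda>f. l1 p * e 1 p f + l2 p * e 2 p f - 2 * \<sigma> p * e 3 p f)"
    using ig by simp_all
  have adapted: "adapted M B h s V \<epsilon> W \<pi> g r e L1 L2 l1 l2 lam \<mu> \<sigma> \<delta>1 \<delta>2 \<delta>3"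
    if W: "open W" "W \<subseteq> U" for W
  proof -
    interpret M: smooth_mfd M by unfold_locales (rule mfM)
    have oW: "orthonormal_frame M g W e"
      using oe W(2) M.vfield_subset[OF _ W(2)] unfolding orthonormal_frame_def by blast
    interpret src: framed M g r W e
      by unfold_locales (use mfM prM W U oW in auto)
    interpret tgt: framed_surface B h s V \<epsilon> L1 L2
      by unfold_locales (use mfB prB V oeps L in auto)
    \<comment> \<open>a submersion preserves the scalar products of horizontal vectors, so the signs on the base agree\<close>
    have *: "h (\<pi> p) (\<epsilon> 1 (\<pi> p)) (\<epsilon> 1 (\<pi> p)) = \<delta>1" "h (\<pi> p) (\<epsilon> 2 (\<pi> p)) (\<epsilon> 2 (\<pi> p)) = \<delta>2" if "p \<in> W" for p
    proof -
      have p: "p \<in> U" "p \<in> carrier M" using that W U by auto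
      show "h (\<pi> p) (\<epsilon> 1 (\<pi> p)) (\<epsilon> 1 (\<pi> p)) = \<delta>1" "h (\<pi> p) (\<epsilon> 2 (\<pi> p)) (\<epsilon> 2 (\<pi> p)) = \<delta>2"
        using isom[OF p(2) e12'(1,1)[OF p(1)]] isom[OF p(2) e12'(3,3)[OF p(1)]] e12'[OF p(1)] assms(10)[OF p(1)]
        by simp_all
    qed
    have **: "differential B \<pi> p (e 3 p) = (\<lambda>f. 0)" if "p \<in> W" for p
      using e3[of p] W that by (auto simp: vertical_space_def)
    show ?thesis
      by unfold_locales
        (use W U UV sm smf L br e12' * ** assms(7-10) M.smooth_fun_subset[OF _ W(2)] in
          \<open>auto simp: src.sign_def tgt.sign_def subset_iff\<close>)
  qed
  interpret A: adapted M B h s V \<epsilon> U \<pi> g r e L1 L2 l1 l2 lam \<mu> \<sigma> \<delta>1 \<delta>2 \<delta>3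
    by (rule adapted[OF U(1) order_refl])
  have K: "K p = A.tgt.gauss (\<pi> p)" if "p \<in> U" for p
    using assms(11)[OF that] A.tgt.R1221_gauss[OF A.W_V[OF that]] by simp
  have "biharmonic M g U B h V \<pi> \<longleftrightarrow> (\<forall>p\<in>U. A.equation1 p = 0 \<and> A.equation2 p = 0)"
  proof
    assume "biharmonic M g U B h V \<pi>"
    then have "bitension M g U B h V \<pi> e p = (\<lambda>k. 0)" if "p \<in> U" for p
      using U(1) oe that unfolding biharmonic_def by blast
    then show "\<forall>p\<in>U. A.equation1 p = 0 \<and> A.equation2 p = 0"
      using A.bitension_zero_iff[OF oe] by blast
  next
    assume eq: "\<forall>p\<in>U. A.equation1 p = 0 \<and> A.equation2 p = 0"
    show "biharmonic M g U B h V \<pi>"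
      unfolding biharmonic_def
    proof (intro allI impI ballI)
      fix W e' p assume W: "open W \<and> W \<subseteq> U \<and> orthonormal_frame M g W e'" and p: "p \<in> W"
      then show "bitension M g W B h V \<pi> e' p = (\<lambda>k. 0)"
        using adapted.bitension_zero_iff[OF adapted, of W e' p] eq by blast
    qed
  qed
  then show ?thesis
    using K A.gauss_pullback
    by (simp add: A.equation1_def A.equation2_def A.laplacian_adapted[OF smf(1)] A.laplacian_adapted[OF smf(2)])
qed

end
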